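(* For every $n\in\mathbb{N}$, let $x_{1,n},\dots,x_{n,n}$ be i.i.d. random $p_n$-vectors with mean $\mu_n\in\mathbb{R}^{p_n}$ and positive definite covariance matrix $\Sigma_n$ satisfying the following two conditions. (a) $x_{i,n}=\mu_n+\Gamma_nz_{i,n}$, where $\Gamma_n$ is a (non-random) $p_n\times m_n$ matrix with $m_n\ge p_n$ and $\Gamma_n\Gamma_n'=\Sigma_n$, and the random $m_n$-vectors $z_{1,n},\dots,z_{n,n}$ are i.i.d. with $\mathbb{E}[z_{1,n}]=0$ and $\mathbb{E}[z_{1,n}z_{1,n}']=I_{m_n}$. (b) With $X_n=[x_{1,n},\dots,x_{n,n}]'$, $\iota=(1,\dots,1)'\in\mathbb{R}^n$ and $U_n=[\iota,X_n]$, the $(n-1)\times(p_n+1)$ matrix $[0,I_{n-1}]U_n$ (i.e. $U_n$ with its first row removed) has rank $p_n+1$ with probability one. Moreover, suppose that $\mathrm{Var}[z_{1,n}'M_nz_{1,n}]=O(\mathrm{trace}(M_n^2))+(\mathrm{trace}(M_n))^2o(1)$, as $n\to\infty$, for every choice of symmetric $m_n\times m_n$ matrices $M_n$. Let $R_n$ be a non-random $(p_n+1)\times k_n$ matrix such that $\mathrm{rank}(R_n)=k_n\le p_n+1$ and define $W_n=[\iota,X_n]R_n$. Let $h_{1,n},\dots,h_{n,n}$ denote the diagonal entries of the projection matrix $P_{W_n}$. Then the $(h_{j,n})_{j=1}^n$ are exchangeable random variables and $$|h_{1,n}-k_n/n|\;\xrightarrow[n\to\infty]{}\;0\quad\text{in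 probability}.$$
   Context: $P_M$ denotes the matrix of the orthogonal projection onto the column span of the matrix $M$. The prime denotes transpose. All of $p_n,m_n,k_n$ are positive integers that may depend on $n$. *)

theory Defs
  imports
    "HOL-Probability.Probability"
    "HOL-Library.Landau_Symbols"
    "Jordan_Normal_Form.DL_Rank"
begin

(* The notation v $ i below always refers to the vectors of Jordan_Normal_Form, not to the
   finite Cartesian products of HOL-Analysis. *)
unbundle no vec_syntax

section \<open>Matrices\<close>

definition mat_trace :: "real mat \<Rightarrow> real" where
  "mat_trace A = (\<Sum>i<dim_row A. A $$ (i, i))"

definition outer_prod :: "real vec \<Rightarrow> real vec \<Rightarrow> real mat" where
  "outer_prod v w = Matrix.mat (dim_vec v) (dim_vec w) (\<lambda>(i, j). v $ i * w $ j)"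

definition pos_def_mat :: "nat \<Rightarrow> real mat \<Rightarrow> bool" where
  "pos_def_mat d A \<longleftrightarrow>
     A \<in> carrier_mat d d \<and> A\<^sup>T = A \<and>
     (\<forall>v\<in>carrier_vec d. v \<noteq> 0\<^sub>v d \<longrightarrow> 0 < v \<bullet> (A *\<^sub>v v))"

(* The matrix of the orthogonal projection onto the column span of A (of arbitrary rank):
   P v lies in the column span and v - P v is orthogonal to it. *)
definition proj_mat :: "real mat \<Rightarrow> real mat" where
  "proj_mat A = (THE P. P \<in> carrier_mat (dim_row A) (dim_row A) \<and>
     (\<forall>v\<in>carrier_vec (dim_row A).
        P *\<^sub>v v \<in> vec_space.col_space (dim_row A) A \<and>
        (\<forall>w\<in>vec_space.col_space (dim_row A) A. w \<bullet> (v - P *\<^sub>v v) = 0)))"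

(* The n x (p + 1) matrix [iota, X] with X = [x_1, ..., x_n]'.  Rows and columns are indexed
   from 0, so observation x_i sits in row i - 1. *)
definition aug_data_mat :: "nat \<Rightarrow> nat \<Rightarrow> (nat \<Rightarrow> real vec) \<Rightarrow> real mat" where
  "aug_data_mat n p x = Matrix.mat n (Suc p)
     (\<lambda>(i, j). case j of 0 \<Rightarrow> 1 | Suc l \<Rightarrow> mat_of_rows p (map x [0..<n]) $$ (i, l))"

(* The (n - 1) x n matrix [0, I]. *)
definition drop_first_mat :: "nat \<Rightarrow> real mat" where
  "drop_first_mat n = Matrix.mat (n - 1) n (\<lambda>(i, j). if j = Suc i then 1 else 0)"

section \<open>Random vectors\<close>

(* Vectors of length d with the Borel sets of R^d. *)
definition vec_borel :: "nat \<Rightarrow> real vec measure" where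
  "vec_borel d = vimage_algebra (carrier_vec d) (\<lambda>v. \<lambda>k\<in>{..<d}. v $ k)
     (Pi\<^sub>M {..<d} (\<lambda>_. borel))"

(* The random vectors X 0, ..., X (n - 1) are i.i.d.; measurability is part of indep_vars. *)
definition iid_vecs :: "'w measure \<Rightarrow> nat \<Rightarrow> nat \<Rightarrow> (nat \<Rightarrow> 'w \<Rightarrow> real vec) \<Rightarrow> bool" where
  "iid_vecs M d n X \<longleftrightarrow>
     prob_space.indep_vars M (\<lambda>_. vec_borel d) X {..<n} \<and>
     (\<forall>i<n. \<forall>j<n. distr M (vec_borel d) (X i) = distr M (vec_borel d) (X j))"

definition has_mean_vec :: "'w measure \<Rightarrow> ('w \<Rightarrow> real vec) \<Rightarrow> real vec \<Rightarrow> bool" where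
  "has_mean_vec M X \<mu> \<longleftrightarrow>
     (\<forall>i<dim_vec \<mu>. has_bochner_integral M (\<lambda>\<omega>. X \<omega> $ i) (\<mu> $ i))"

definition has_mean_mat :: "'w measure \<Rightarrow> ('w \<Rightarrow> real mat) \<Rightarrow> real mat \<Rightarrow> bool" where
  "has_mean_mat M Y A \<longleftrightarrow>
     (\<forall>i<dim_row A. \<forall>j<dim_col A. has_bochner_integral M (\<lambda>\<omega>. Y \<omega> $$ (i, j)) (A $$ (i, j)))"

definition has_mean_cov :: "'w measure \<Rightarrow> ('w \<Rightarrow> real vec) \<Rightarrow> real vec \<Rightarrow> real mat \<Rightarrow> bool" where
  "has_mean_cov M X \<mu> S \<longleftrightarrow>
     has_mean_vec M X \<mu> \<and> has_mean_mat M (\<lambda>\<omega>. outer_prod (X \<omega> - \<mu>) (X \<omega> - \<mu>)) S"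

definition exchangeable :: "'w measure \<Rightarrow> nat \<Rightarrow> (nat \<Rightarrow> 'w \<Rightarrow> real) \<Rightarrow> bool" where
  "exchangeable M n h \<longleftrightarrow>
     (\<forall>i<n. h i \<in> borel_measurable M) \<and>
     (\<forall>\<pi>. \<pi> permutes {..<n} \<longrightarrow>
        distr M (Pi\<^sub>M {..<n} (\<lambda>_. borel)) (\<lambda>\<omega>. \<lambda>i\<in>{..<n}. h (\<pi> i) \<omega>) =
        distr M (Pi\<^sub>M {..<n} (\<lambda>_. borel)) (\<lambda>\<omega>. \<lambda>i\<in>{..<n}. h i \<omega>))"

(* Convergence in probability to 0, where the probability space may change with n. *)
definition tendsto_0_in_prob :: "(nat \<Rightarrow> 'w measure) \<Rightarrow> (nat \<Rightarrow> 'w \<Rightarrow> real) \<Rightarrow> bool" where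
  "tendsto_0_in_prob M Y \<longleftrightarrow>
     (\<forall>\<epsilon>>0. (\<lambda>n. measure (M n) {\<omega> \<in> space (M n). \<epsilon> < \<bar>Y n \<omega>\<bar>}) \<longlonglongrightarrow> 0)"

end

theory Submission
  imports Defs
begin

text \<open>
  Let \<open>w\<^sub>i = a + B z\<^sub>i\<close> be the rows of \<open>W\<close>, let \<open>\<Omega> = a a' + B B'\<close>, which is positive definite, and regularise:
  with \<open>S = \<eta> n \<Omega> + W' W\<close> put \<open>l\<^sub>i = w\<^sub>i' S\<^sup>-\<^sup>1 w\<^sub>i\<close> and \<open>t = trace (S\<^sup>-\<^sup>1 \<Omega>)\<close>. Leaving out observation \<open>i\<close>,
  \<open>1 - l\<^sub>i = 1 / (1 + q)\<close> for a quadratic form \<open>q\<close> in \<open>w\<^sub>i\<close> whose matrix is independent of \<open>w\<^sub>i\<close> and bounded by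
  \<open>\<Omega>\<^sup>-\<^sup>1 / (\<eta> n)\<close>; the variance condition gives \<open>q = t + o(1)\<close> for fixed \<open>\<eta>\<close>, hence
  \<open>1 - l\<^sub>i = 1 / (1 + t) + o(1)\<close>. As the \<open>l\<^sub>i\<close> sum to \<open>k - \<eta> n t\<close>, averaging over \<open>i\<close> yields
  \<open>1 - k/n + \<eta> t = 1 / (1 + t) + o(1)\<close>. Since \<open>k \<le> n\<close>, this forces \<open>\<eta> t \<le> \<surd>\<eta> + o(1)\<close>, so \<open>l\<^sub>i\<close> is
  close to \<open>k/n\<close>. Finally \<open>0 \<le> h\<^sub>i - l\<^sub>i\<close>, and the sum of these differences is at most \<open>\<eta> n t\<close>, so by
  exchangeability the expectation of each is at most that of \<open>\<eta> t\<close>. Let \<open>n \<longlonglongrightarrow> \<infinity>\<close>, then \<open>\<eta> \<longlonglongrightarrow> 0\<close>.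
\<close>

unbundle no inner_syntax

section \<open>Positive definite matrices\<close>

text \<open>The obstacle is that \<open>W' W\<close> with one row left out has an inverse without
  moment control, whereas the variance condition speaks of non-random matrices. Regularisation gives
  bounds that hold for every outcome: if \<open>K\<close> is the inverse of a leave-one-out
  \<open>S\<close>, then \<open>trace (K \<Omega>) \<le> 1/\<eta>\<close> and
  \<open>trace ((K \<Omega>)\<^sup>2) \<le> 1/(\<eta>\<^sup>2 n)\<close>. The other observations can
  therefore be frozen by Fubini and the condition applied to the fixed matrix \<open>B' K B\<close>.
  The regulariser is a multiple of \<open>\<Omega>\<close>, not of the identity, so that it controls
  directly the mean \<open>trace (K \<Omega>)\<close> of \<open>q\<close> and the bounds are free of
  \<open>\<mu>\<close>, \<open>\<Sigma>\<close> and \<open>R\<close>. The trace \<open>t\<close> is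
  formed with all observations, at the cost of an error \<open>1/(\<eta> n)\<close>, so that one
  number serves every \<open>i\<close> and the approximations can be summed.\<close>

lemma square_mult_carrier [simp]:
  "A \<in> carrier_mat d d \<Longrightarrow> B \<in> carrier_mat d d \<Longrightarrow> A * B \<in> carrier_mat d d"
  by (rule mult_carrier_mat)

lemma square_mult_vec_carrier [simp]:
  "A \<in> carrier_mat d d \<Longrightarrow> v \<in> carrier_vec d \<Longrightarrow> A *\<^sub>v v \<in> carrier_vec d"
  by (rule mult_mat_vec_carrier)

lemma scalar_prod_lessThan: "(v :: real vec) \<in> carrier_vec d \<Longrightarrow> w \<in> carrier_vec d \<Longrightarrow> v \<bullet> w = (\<Sum>i<d. v $ i * w $ i)"
  by (simp add: scalar_prod_def atLeast0LessThan)

lemma scalar_prod_mult_mat_vec: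
  fixes A :: "real mat"
  assumes "A \<in> carrier_mat n d" "u \<in> carrier_vec n" "v \<in> carrier_vec d"
  shows "u \<bullet> (A *\<^sub>v v) = (\<Sum>i<n. \<Sum>j<d. u $ i * A $$ (i, j) * v $ j)"
  using assms by (auto simp: scalar_prod_def atLeast0LessThan sum_distrib_left mult.assoc intro!: sum.cong)

lemma symmetric_mat_scalar_prod:
  fixes A :: "real mat"
  assumes "A \<in> carrier_mat d d" "A\<^sup>T = A" "u \<in> carrier_vec d" "v \<in> carrier_vec d"
  shows "u \<bullet> (A *\<^sub>v v) = v \<bullet> (A *\<^sub>v u)"
  using transpose_vec_mult_scalar[of A d d v u] assms comm_scalar_prod[of "A *\<^sub>v u" d v]
  by simp

lemma mat_trace_mult:
  assumes "A \<in> carrier_mat n d" "B \<in> carrier_mat d n"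
  shows "mat_trace (A * B) = (\<Sum>i<n. \<Sum>j<d. A $$ (i, j) * B $$ (j, i))"
  using assms by (auto simp: mat_trace_def scalar_prod_def atLeast0LessThan intro!: sum.cong)

lemma mat_trace_mult_comm:
  assumes "A \<in> carrier_mat n d" "B \<in> carrier_mat d n"
  shows "mat_trace (A * B) = mat_trace (B * A)"
  unfolding mat_trace_mult[OF assms] mat_trace_mult[OF assms(2,1)]
  by (subst sum.swap) (simp add: mult.commute)

text \<open>Symmetry turns the trace of the square into the sum of the squared entries.\<close>

lemma mat_trace_symmetric_square_nonneg:
  assumes A: "A \<in> carrier_mat n n" and sym: "A\<^sup>T = A"
  shows "0 \<le> mat_trace (A * A)"
proof -
  have "A $$ (j, i) = A $$ (i, j)" if "i < n" "j < n" for i j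
    using A arg_cong[OF sym, of "\<lambda>M. M $$ (i, j)"] that by simp
  then have "mat_trace (A * A) = (\<Sum>i<n. \<Sum>j<n. A $$ (i, j) * A $$ (i, j))"
    unfolding mat_trace_mult[OF A A] by simp
  then show ?thesis by (simp add: sum_nonneg)
qed

lemma mat_trace_add:
  "A \<in> carrier_mat n n \<Longrightarrow> B \<in> carrier_mat n n \<Longrightarrow> mat_trace (A + B) = mat_trace A + mat_trace B"
  by (simp add: mat_trace_def sum.distrib)

lemma mat_trace_minus:
  "A \<in> carrier_mat n n \<Longrightarrow> B \<in> carrier_mat n n \<Longrightarrow> mat_trace (A - B) = mat_trace A - mat_trace B"
  by (simp add: mat_trace_def sum_subtractf)

lemma mat_trace_smult: "A \<in> carrier_mat n n \<Longrightarrow> mat_trace (c \<cdot>\<^sub>m A) = c * mat_trace A"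
  by (simp add: mat_trace_def sum_distrib_left)

lemma mat_trace_one: "mat_trace (1\<^sub>m n) = real n"
  by (simp add: mat_trace_def)

lemma outer_prod_carrier [simp]:
  "v \<in> carrier_vec n \<Longrightarrow> w \<in> carrier_vec d \<Longrightarrow> outer_prod v w \<in> carrier_mat n d"
  by (simp add: outer_prod_def)

lemma mat_trace_mult_outer_prod:
  assumes "A \<in> carrier_mat d n" "v \<in> carrier_vec n" "w \<in> carrier_vec d"
  shows "mat_trace (A * outer_prod v w) = w \<bullet> (A *\<^sub>v v)"
  unfolding mat_trace_mult[OF assms(1) outer_prod_carrier[OF assms(2,3)]]
    scalar_prod_mult_mat_vec[OF assms(1,3,2)]
  using assms by (auto simp: outer_prod_def intro!: sum.cong)

lemma outer_prod_mult_vec: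
  assumes "v \<in> carrier_vec n" "w \<in> carrier_vec d" "u \<in> carrier_vec d"
  shows "outer_prod v w *\<^sub>v u = (w \<bullet> u) \<cdot>\<^sub>v v"
  using assms by (intro eq_vecI)
    (auto simp: outer_prod_def scalar_prod_def sum_distrib_left sum_distrib_right mult_ac intro!: sum.cong)

text \<open>The adjugate formula makes the entries of the inverse measurable functions of the entries of \<open>A\<close>.
  A singular \<open>A\<close> gives the zero matrix, because \<open>1 / 0 = 0\<close>.\<close>
definition inverse_mat :: "real mat \<Rightarrow> real mat" where
  "inverse_mat A = (1 / det A) \<cdot>\<^sub>m adj_mat A"

lemma inverse_mat_carrier [simp]: "A \<in> carrier_mat d d \<Longrightarrow> inverse_mat A \<in> carrier_mat d d"
  using adj_mat(1)[of A d] by (simp add: inverse_mat_def)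

lemma
  assumes "A \<in> carrier_mat d d" "det A \<noteq> 0"
  shows inverse_mat_right: "A * inverse_mat A = 1\<^sub>m d"
    and inverse_mat_left: "inverse_mat A * A = 1\<^sub>m d"
  using assms adj_mat[OF assms(1)] by (auto simp: inverse_mat_def mult_smult_distrib[of _ d d _ d]
      mult_smult_assoc_mat[of _ d d _ d] intro!: eq_matI)

lemma pos_def_matD:
  assumes "pos_def_mat d A"
  shows "A \<in> carrier_mat d d" "A\<^sup>T = A" "v \<in> carrier_vec d \<Longrightarrow> 0 \<le> v \<bullet> (A *\<^sub>v v)"
    "v \<in> carrier_vec d \<Longrightarrow> v \<noteq> 0\<^sub>v d \<Longrightarrow> 0 < v \<bullet> (A *\<^sub>v v)"
proof -
  show "0 \<le> v \<bullet> (A *\<^sub>v v)" if "v \<in> carrier_vec d"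
    using assms that by (cases "v = 0\<^sub>v d") (auto simp: pos_def_mat_def intro: less_imp_le)
qed (use assms in \<open>auto simp: pos_def_mat_def\<close>)

lemma pos_def_mat_det:
  assumes "pos_def_mat d A" shows "det A \<noteq> 0"
proof
  note A = pos_def_matD[OF assms]
  assume "det A = 0"
  then obtain v where "v \<in> carrier_vec d" "v \<noteq> 0\<^sub>v d" "A *\<^sub>v v = 0\<^sub>v d"
    using det_0_iff_vec_prod_zero_field[OF A(1)] by auto
  with A(4)[of v] show False by simp
qed

text \<open>Positivity passes to the inverse \<open>K\<close> by
  \<open>v' K v = (K v)' A (K v)\<close>, and symmetry comes from
  \<open>K' = K' (A K) = (A K)' K\<close>, where \<open>A' = A\<close>.\<close>

lemma pos_def_mat_inverse:
  assumes "pos_def_mat d A"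
  shows "A * inverse_mat A = 1\<^sub>m d" "inverse_mat A * A = 1\<^sub>m d"
    "v \<in> carrier_vec d \<Longrightarrow> A *\<^sub>v (inverse_mat A *\<^sub>v v) = v"
    "v \<in> carrier_vec d \<Longrightarrow> inverse_mat A *\<^sub>v (A *\<^sub>v v) = v"
    "pos_def_mat d (inverse_mat A)"
proof -
  note A = pos_def_matD[OF assms] and det = pos_def_mat_det[OF assms]
  let ?K = "inverse_mat A"
  have K: "?K \<in> carrier_mat d d" using A by simp
  show 1: "A * ?K = 1\<^sub>m d" and 2: "?K * A = 1\<^sub>m d"
    using inverse_mat_left[OF A(1) det] inverse_mat_right[OF A(1) det] by auto
  show 3: "A *\<^sub>v (?K *\<^sub>v v) = v" "?K *\<^sub>v (A *\<^sub>v v) = v" if "v \<in> carrier_vec d" for v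
    using that A K by (simp_all flip: assoc_mult_mat_vec[of _ d d _ d] add: 1 2)
  have "?K\<^sup>T = ?K\<^sup>T * (A * ?K)" using 1 K by simp
  also have "\<dots> = (A * ?K)\<^sup>T * ?K"
    using A K by (subst transpose_mult[of _ d d _ d]) (auto simp: assoc_mult_mat[of _ d d _ d _ d])
  also have "\<dots> = ?K" using 1 K by simp
  finally have sym: "?K\<^sup>T = ?K" .
  show "pos_def_mat d ?K"
    unfolding pos_def_mat_def
  proof (intro conjI ballI impI K sym)
    fix v :: "real vec" assume v: "v \<in> carrier_vec d" "v \<noteq> 0\<^sub>v d"
    have "?K *\<^sub>v v \<noteq> 0\<^sub>v d"
    proof
      assume "?K *\<^sub>v v = 0\<^sub>v d"
      then have "v = A *\<^sub>v 0\<^sub>v d" using 3(1)[OF v(1)] by simp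
      also have "\<dots> = 0\<^sub>v d" using A(1) by (intro eq_vecI) auto
      finally show False using v by simp
    qed
    then have "0 < (?K *\<^sub>v v) \<bullet> (A *\<^sub>v (?K *\<^sub>v v))"
      using A(4)[of "?K *\<^sub>v v"] K v by simp
    also have "\<dots> = v \<bullet> (?K *\<^sub>v v)"
      using 3(1)[OF v(1)] comm_scalar_prod[of v d "?K *\<^sub>v v"] v K by simp
    finally show "0 < v \<bullet> (?K *\<^sub>v v)" .
  qed
qed

section \<open>Ridge leverages and orthogonal projections\<close>

text \<open>This is \<open>Q\<close> plus the outer products \<open>w i (w i)'\<close> over
  \<open>I\<close>, that is \<open>S\<close> for \<open>Q = \<eta> n \<Omega>\<close>. The index set
  is a parameter so that leaving an observation out means passing to a smaller set; the entrywise
  form reduces measurability and permutation invariance to finite sums.\<close>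

definition gram_mat :: "real mat \<Rightarrow> nat set \<Rightarrow> (nat \<Rightarrow> real vec) \<Rightarrow> real mat" where
  "gram_mat Q I w = Matrix.mat (dim_row Q) (dim_row Q)
     (\<lambda>(a, b). Q $$ (a, b) + (\<Sum>i\<in>I. w i $ a * w i $ b))"

lemma gram_mat_carrier [simp]: "Q \<in> carrier_mat d d \<Longrightarrow> gram_mat Q I w \<in> carrier_mat d d"
  by (simp add: gram_mat_def)

lemma scalar_prod_gram_mat:
  assumes Q: "Q \<in> carrier_mat d d" and w: "\<And>i. i \<in> I \<Longrightarrow> w i \<in> carrier_vec d"
    and u: "u \<in> carrier_vec d" and v: "v \<in> carrier_vec d"
  shows "u \<bullet> (gram_mat Q I w *\<^sub>v v) = u \<bullet> (Q *\<^sub>v v) + (\<Sum>i\<in>I. (w i \<bullet> u) * (w i \<bullet> v))"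
proof -
  have "u \<bullet> (gram_mat Q I w *\<^sub>v v) =
      (\<Sum>a<d. \<Sum>b<d. u $ a * Q $$ (a, b) * v $ b + (\<Sum>i\<in>I. (w i $ a * u $ a) * (w i $ b * v $ b)))"
    unfolding scalar_prod_mult_mat_vec[OF gram_mat_carrier[OF Q] u v]
    using Q by (auto simp: gram_mat_def algebra_simps sum_distrib_left intro!: sum.cong)
  also have "\<dots> = u \<bullet> (Q *\<^sub>v v) + (\<Sum>a<d. \<Sum>b<d. \<Sum>i\<in>I. (w i $ a * u $ a) * (w i $ b * v $ b))"
    by (simp add: sum.distrib scalar_prod_mult_mat_vec[OF Q u v])
  also have "(\<Sum>a<d. \<Sum>b<d. \<Sum>i\<in>I. (w i $ a * u $ a) * (w i $ b * v $ b)) =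
      (\<Sum>i\<in>I. \<Sum>a<d. \<Sum>b<d. (w i $ a * u $ a) * (w i $ b * v $ b))"
    by (simp only: sum.swap[of _ I])
  also have "\<dots> = (\<Sum>i\<in>I. (w i \<bullet> u) * (w i \<bullet> v))"
    using w u v by (intro sum.cong refl) (simp add: scalar_prod_lessThan[of _ d] sum_product)
  finally show ?thesis .
qed

lemma mat_trace_mult_gram_mat:
  assumes A: "A \<in> carrier_mat d d" and Q: "Q \<in> carrier_mat d d"
    and w: "\<And>i. i \<in> I \<Longrightarrow> w i \<in> carrier_vec d"
  shows "mat_trace (A * gram_mat Q I w) = mat_trace (A * Q) + (\<Sum>i\<in>I. w i \<bullet> (A *\<^sub>v w i))"
proof -
  have "mat_trace (A * gram_mat Q I w) =
      (\<Sum>a<d. \<Sum>b<d. A $$ (a, b) * Q $$ (b, a) + (\<Sum>i\<in>I. w i $ a * A $$ (a, b) * w i $ b))"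
    unfolding mat_trace_mult[OF A gram_mat_carrier[OF Q]]
    using Q by (auto simp: gram_mat_def algebra_simps sum_distrib_left intro!: sum.cong)
  also have "\<dots> = mat_trace (A * Q) + (\<Sum>a<d. \<Sum>b<d. \<Sum>i\<in>I. w i $ a * A $$ (a, b) * w i $ b)"
    by (simp add: sum.distrib mat_trace_mult[OF A Q])
  also have "(\<Sum>a<d. \<Sum>b<d. \<Sum>i\<in>I. w i $ a * A $$ (a, b) * w i $ b) =
      (\<Sum>i\<in>I. \<Sum>a<d. \<Sum>b<d. w i $ a * A $$ (a, b) * w i $ b)"
    by (simp only: sum.swap[of _ I])
  also have "\<dots> = (\<Sum>i\<in>I. w i \<bullet> (A *\<^sub>v w i))"
    using w by (intro sum.cong refl) (simp add: scalar_prod_mult_mat_vec[OF A])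
  finally show ?thesis .
qed

lemma gram_mat_insert:
  assumes Q: "Q \<in> carrier_mat d d" and w: "w i \<in> carrier_vec d" and i: "finite I" "i \<notin> I"
  shows "gram_mat Q (insert i I) w = gram_mat Q I w + outer_prod (w i) (w i)"
  using assms by (intro eq_matI) (auto simp: gram_mat_def outer_prod_def)

lemma pos_def_gram_mat:
  assumes Q: "pos_def_mat d Q" and w: "\<And>i. i \<in> I \<Longrightarrow> w i \<in> carrier_vec d"
  shows "pos_def_mat d (gram_mat Q I w)"
proof -
  note QD = pos_def_matD[OF Q]
  have "Q $$ (j, i) = Q $$ (i, j)" if "i < d" "j < d" for i j
    using QD(1) arg_cong[OF QD(2), of "\<lambda>M. M $$ (i, j)"] that by simp
  then have "(gram_mat Q I w)\<^sup>T = gram_mat Q I w"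
    using QD(1) by (intro eq_matI) (auto simp: gram_mat_def mult.commute)
  moreover have "0 < v \<bullet> (gram_mat Q I w *\<^sub>v v)" if "v \<in> carrier_vec d" "v \<noteq> 0\<^sub>v d" for v
    using QD(4)[OF that] that by (subst scalar_prod_gram_mat[OF QD(1) w])
      (auto intro!: add_pos_nonneg sum_nonneg)
  ultimately show ?thesis
    using QD(1) by (auto simp: pos_def_mat_def)
qed

lemma pos_def_smult:
  assumes "pos_def_mat d Q" "0 < (\<gamma> :: real)" shows "pos_def_mat d (\<gamma> \<cdot>\<^sub>m Q)"
proof -
  note QD = pos_def_matD[OF assms(1)]
  have "v \<bullet> ((\<gamma> \<cdot>\<^sub>m Q) *\<^sub>v v) = \<gamma> * (v \<bullet> (Q *\<^sub>v v))" if "v \<in> carrier_vec d" for v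
    unfolding scalar_prod_mult_mat_vec[OF QD(1) that that]
      scalar_prod_mult_mat_vec[OF smult_carrier_mat[OF QD(1)] that that]
    using QD(1) by (auto simp: sum_distrib_left algebra_simps intro!: sum.cong)
  moreover have "(\<gamma> \<cdot>\<^sub>m Q)\<^sup>T = \<gamma> \<cdot>\<^sub>m Q"
  proof -
    have "(\<gamma> \<cdot>\<^sub>m Q)\<^sup>T = \<gamma> \<cdot>\<^sub>m Q\<^sup>T" by auto
    then show ?thesis by (simp add: QD(2))
  qed
  ultimately show ?thesis using QD assms(2) by (auto simp: pos_def_mat_def)
qed

text \<open>The index need not lie in \<open>I\<close>: inside \<open>I\<close> this is a ridge
  leverage, outside \<open>I\<close> it is the leave-one-out form \<open>q\<close>.\<close>

abbreviation leverage :: "real mat \<Rightarrow> nat set \<Rightarrow> (nat \<Rightarrow> real vec) \<Rightarrow> nat \<Rightarrow> real" where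
  "leverage Q I w i \<equiv> w i \<bullet> (inverse_mat (gram_mat Q I w) *\<^sub>v w i)"

text \<open>Take the trace of \<open>S\<^sup>-\<^sup>1 S = 1\<close> and split \<open>S\<close> into
  \<open>Q\<close> and the outer products.\<close>

lemma sum_leverage:
  assumes Q: "pos_def_mat d Q" and w: "\<And>i. i \<in> I \<Longrightarrow> w i \<in> carrier_vec d"
  shows "(\<Sum>i\<in>I. leverage Q I w i) = real d - mat_trace (inverse_mat (gram_mat Q I w) * Q)"
proof -
  note S = pos_def_gram_mat[OF Q w] and QD = pos_def_matD[OF Q]
  have "real d = mat_trace (inverse_mat (gram_mat Q I w) * gram_mat Q I w)"
    using pos_def_mat_inverse(2)[OF S] by (simp add: mat_trace_one)
  also have "\<dots> = mat_trace (inverse_mat (gram_mat Q I w) * Q) + (\<Sum>i\<in>I. leverage Q I w i)"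
    by (rule mat_trace_mult_gram_mat) (use w QD in auto)
  finally show ?thesis by simp
qed

lemma leverage_nonneg:
  assumes "pos_def_mat d Q" "\<And>i. i \<in> I \<Longrightarrow> w i \<in> carrier_vec d" "v \<in> carrier_vec d"
  shows "0 \<le> v \<bullet> (inverse_mat (gram_mat Q I w) *\<^sub>v v)"
  using pos_def_matD(3)[OF pos_def_mat_inverse(5)[OF pos_def_gram_mat[OF assms(1,2)]] assms(3)] .

text \<open>The Sherman-Morrison formula along \<open>w = w j\<close>: since
  \<open>S = S1 + w w'\<close>, one has \<open>S (S1\<^sup>-\<^sup>1 w) = (1 + q) w\<close>, and
  \<open>q \<ge> 0\<close> permits division by \<open>1 + q\<close>.\<close>

lemma leverage_loo:
  assumes Q: "pos_def_mat d Q" and w: "\<And>i. i \<in> insert j I \<Longrightarrow> w i \<in> carrier_vec d"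
    and I: "finite I" "j \<notin> I"
  shows "leverage Q (insert j I) w j = leverage Q I w j / (1 + leverage Q I w j)"
    and "inverse_mat (gram_mat Q (insert j I) w) *\<^sub>v w j =
      (1 / (1 + leverage Q I w j)) \<cdot>\<^sub>v (inverse_mat (gram_mat Q I w) *\<^sub>v w j)"
proof -
  let ?S = "gram_mat Q (insert j I) w" and ?S1 = "gram_mat Q I w" and ?q = "leverage Q I w j"
  let ?K = "inverse_mat ?S" and ?K1 = "inverse_mat ?S1"
  have S: "pos_def_mat d ?S" and S1: "pos_def_mat d ?S1" using Q w by (auto intro!: pos_def_gram_mat)
  note cs = pos_def_matD(1)[OF Q]
  have wj: "w j \<in> carrier_vec d" using w by simp
  have K1w: "?K1 *\<^sub>v w j \<in> carrier_vec d"
    using wj cs by (intro mult_mat_vec_carrier[of _ d d]) auto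
  have q: "0 \<le> ?q" by (rule leverage_nonneg[OF Q]) (use w in auto)
  have "?S *\<^sub>v (?K1 *\<^sub>v w j) = ?S1 *\<^sub>v (?K1 *\<^sub>v w j) + outer_prod (w j) (w j) *\<^sub>v (?K1 *\<^sub>v w j)"
    unfolding gram_mat_insert[where w=w, OF cs wj I]
    by (rule add_mult_distrib_mat_vec[of _ d d]) (use wj K1w cs in auto)
  also have "\<dots> = w j + ?q \<cdot>\<^sub>v w j"
    using pos_def_mat_inverse(3)[OF S1 wj] wj K1w cs by (simp add: outer_prod_mult_vec[of _ d _ d])
  also have "\<dots> = (1 + ?q) \<cdot>\<^sub>v w j"
    using wj by (intro eq_vecI) (auto simp: algebra_simps)
  finally have eq: "?S *\<^sub>v (?K1 *\<^sub>v w j) = (1 + ?q) \<cdot>\<^sub>v w j" .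
  have "?K *\<^sub>v (?S *\<^sub>v (?K1 *\<^sub>v w j)) = (1 + ?q) \<cdot>\<^sub>v (?K *\<^sub>v w j)"
    unfolding eq by (rule mult_mat_vec[of _ d d]) (use wj cs in auto)
  then have "?K1 *\<^sub>v w j = (1 + ?q) \<cdot>\<^sub>v (?K *\<^sub>v w j)"
    using pos_def_mat_inverse(4)[OF S, of "?K1 *\<^sub>v w j"] K1w by simp
  then show 2: "?K *\<^sub>v w j = (1 / (1 + ?q)) \<cdot>\<^sub>v (?K1 *\<^sub>v w j)"
  proof -
    assume eq: "?K1 *\<^sub>v w j = (1 + ?q) \<cdot>\<^sub>v (?K *\<^sub>v w j)"
    have "(1 / (1 + ?q)) \<cdot>\<^sub>v (?K1 *\<^sub>v w j) = (1 / (1 + ?q)) \<cdot>\<^sub>v ((1 + ?q) \<cdot>\<^sub>v (?K *\<^sub>v w j))"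
      using arg_cong[OF eq, of "\<lambda>v. (1 / (1 + ?q)) \<cdot>\<^sub>v v"] .
    also have "\<dots> = ?K *\<^sub>v w j"
      using q by (simp only: smult_smult_assoc) simp
    finally show ?thesis ..
  qed
  show "leverage Q (insert j I) w j = ?q / (1 + ?q)"
    unfolding 2 using wj K1w by simp
qed

lemma pos_def_inverse_sandwich:
  assumes "pos_def_mat d S" "v \<in> carrier_vec d"
  shows "(inverse_mat S *\<^sub>v v) \<bullet> (S *\<^sub>v (inverse_mat S *\<^sub>v v)) = v \<bullet> (inverse_mat S *\<^sub>v v)"
  unfolding pos_def_mat_inverse(3)[OF assms]
  using assms pos_def_matD(1)[OF assms(1)]
  by (intro comm_scalar_prod[of _ d] mult_mat_vec_carrier[of _ d d]) auto

lemma smult_mat_scalar_prod: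
  fixes Q :: "real mat"
  assumes "Q \<in> carrier_mat n d" "u \<in> carrier_vec n" "v \<in> carrier_vec d"
  shows "u \<bullet> ((c \<cdot>\<^sub>m Q) *\<^sub>v v) = c * (u \<bullet> (Q *\<^sub>v v))"
  using assms by (simp add: scalar_prod_mult_mat_vec[of _ n d] sum_distrib_left mult_ac)

text \<open>The rank one update \<open>K1 - K = K1 w w' K\<close> changes the trace by at most \<open>1 / \<gamma>\<close>, as \<open>\<gamma> \<Omega> \<le> K1\<^sup>-\<^sup>1\<close>.\<close>
lemma trace_ridge_insert:
  assumes \<Omega>: "pos_def_mat d \<Omega>" and \<gamma>: "0 < \<gamma>"
    and w: "\<And>i. i \<in> insert j I \<Longrightarrow> w i \<in> carrier_vec d" and I: "finite I" "j \<notin> I"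
  defines "K1 \<equiv> inverse_mat (gram_mat (\<gamma> \<cdot>\<^sub>m \<Omega>) I w)"
    and "K \<equiv> inverse_mat (gram_mat (\<gamma> \<cdot>\<^sub>m \<Omega>) (insert j I) w)"
  shows "mat_trace (K * \<Omega>) \<le> mat_trace (K1 * \<Omega>)"
    and "mat_trace (K1 * \<Omega>) \<le> mat_trace (K * \<Omega>) + 1 / \<gamma>"
proof -
  let ?Q = "\<gamma> \<cdot>\<^sub>m \<Omega>"
  let ?S = "gram_mat ?Q (insert j I) w" and ?S1 = "gram_mat ?Q I w"
  let ?q = "leverage ?Q I w j"
  have Q: "pos_def_mat d ?Q" by (rule pos_def_smult[OF \<Omega> \<gamma>])
  have S: "pos_def_mat d ?S" and S1: "pos_def_mat d ?S1" using Q w by (auto intro!: pos_def_gram_mat)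
  note [simp] = pos_def_matD(1)[OF S] pos_def_matD(1)[OF S1] pos_def_matD(1)[OF \<Omega>]
  have K[simp]: "K \<in> carrier_mat d d" and K1[simp]: "K1 \<in> carrier_mat d d" unfolding K_def K1_def by simp_all
  have wj[simp]: "w j \<in> carrier_vec d" using w by simp
  have K1w[simp]: "K1 *\<^sub>v w j \<in> carrier_vec d" by (rule mult_mat_vec_carrier[OF K1 wj])
  have q: "0 \<le> ?q" by (rule leverage_nonneg[OF Q]) (use w in auto)
  \<comment> \<open>\<open>r / (1 + q)\<close> will be the change of the trace. Testing
    \<open>\<gamma> \<Omega> \<le> S1\<close> at \<open>S1\<^sup>-\<^sup>1 w j\<close> gives
    \<open>\<gamma> r \<le> q\<close>.\<close>
  define r where "r = (K1 *\<^sub>v w j) \<bullet> (\<Omega> *\<^sub>v (K1 *\<^sub>v w j))"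
  have r0: "0 \<le> r" unfolding r_def by (rule pos_def_matD(3)[OF \<Omega> K1w])
  have "\<gamma> * r \<le> (K1 *\<^sub>v w j) \<bullet> (?S1 *\<^sub>v (K1 *\<^sub>v w j))"
    unfolding r_def using w
    by (subst scalar_prod_gram_mat[where d = d]) (auto simp: smult_mat_scalar_prod[of _ d d] intro!: sum_nonneg)
  also have "\<dots> = ?q"
    unfolding K1_def by (rule pos_def_inverse_sandwich[OF S1 wj])
  finally have rq: "\<gamma> * r \<le> ?q" .
  \<comment> \<open>Resolvent identity \<open>K1 (S - S1) K = K1 - K\<close>, in which
    \<open>S - S1\<close> has rank one; the cyclic property of the trace then reduces the difference
    to a scalar.\<close>
  have "K1 * outer_prod (w j) (w j) = K1 * (?S - ?S1)"
    unfolding gram_mat_insert[where w=w, OF pos_def_matD(1)[OF Q] wj I]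
  proof -
    have "B = (A + B) - A" if "A \<in> carrier_mat d d" "B \<in> carrier_mat d d" for A B :: "real mat"
      using that by (intro eq_matI) auto
    from this[of ?S1 "outer_prod (w j) (w j)"]
    show "K1 * outer_prod (w j) (w j) = K1 * (?S1 + outer_prod (w j) (w j) - ?S1)" by simp
  qed
  also have "\<dots> = K1 * ?S - K1 * ?S1"
    by (rule mult_minus_distrib_mat[of _ d d _ d]) auto
  also have "\<dots> = K1 * ?S - 1\<^sub>m d"
    using pos_def_mat_inverse(2)[OF S1] by (simp add: K1_def)
  finally have "K1 * outer_prod (w j) (w j) * K = (K1 * ?S - 1\<^sub>m d) * K" by simp
  also have "\<dots> = K1 * ?S * K - 1\<^sub>m d * K"
    by (rule minus_mult_distrib_mat[of _ d d _ _ d]) auto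
  also have "\<dots> = K1 - K"
    using pos_def_mat_inverse(1)[OF S]
    by (simp add: K_def[symmetric] assoc_mult_mat[of _ d d _ d _ d]
        right_mult_one_mat[of _ d d] left_mult_one_mat[of _ d d])
  finally have diff: "K1 - K = K1 * outer_prod (w j) (w j) * K" ..
  have "mat_trace (K1 * \<Omega>) - mat_trace (K * \<Omega>) = mat_trace ((K1 - K) * \<Omega>)"
    by (subst minus_mult_distrib_mat[of _ d d _ _ d]) (auto simp: mat_trace_minus[of _ d])
  also have "\<dots> = mat_trace (K1 * (outer_prod (w j) (w j) * (K * \<Omega>)))"
    unfolding diff by (simp add: assoc_mult_mat[of _ d d _ d _ d])
  also have "\<dots> = mat_trace (outer_prod (w j) (w j) * (K * \<Omega>) * K1)"
    by (rule mat_trace_mult_comm[of _ d d]) auto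
  also have "\<dots> = mat_trace (outer_prod (w j) (w j) * (K * \<Omega> * K1))"
    by (simp add: assoc_mult_mat[of _ d d _ d _ d])
  also have "\<dots> = mat_trace ((K * \<Omega> * K1) * outer_prod (w j) (w j))"
    by (rule mat_trace_mult_comm[of _ d d]) auto
  also have "\<dots> = w j \<bullet> ((K * \<Omega> * K1) *\<^sub>v w j)"
    by (rule mat_trace_mult_outer_prod[of _ d d]) auto
  also have "\<dots> = w j \<bullet> (K *\<^sub>v (\<Omega> *\<^sub>v (K1 *\<^sub>v w j)))"
    by (simp add: assoc_mult_mat_vec[of _ d d _ d])
  also have "\<dots> = (\<Omega> *\<^sub>v (K1 *\<^sub>v w j)) \<bullet> (K *\<^sub>v w j)"
    by (rule symmetric_mat_scalar_prod[of _ d])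
      (auto simp: K_def intro!: pos_def_matD(2)[OF pos_def_mat_inverse(5)[OF S]] mult_mat_vec_carrier[of _ d d])
  also have "K *\<^sub>v w j = (1 / (1 + ?q)) \<cdot>\<^sub>v (K1 *\<^sub>v w j)"
    unfolding K_def K1_def by (rule leverage_loo(2)[OF Q w I])
  also have "(\<Omega> *\<^sub>v (K1 *\<^sub>v w j)) \<bullet> ((1 / (1 + ?q)) \<cdot>\<^sub>v (K1 *\<^sub>v w j)) = r / (1 + ?q)"
    unfolding r_def using comm_scalar_prod[of "K1 *\<^sub>v w j" d "\<Omega> *\<^sub>v (K1 *\<^sub>v w j)"]
    by (simp add: scalar_prod_smult_distrib[of _ d])
  finally have eq: "mat_trace (K1 * \<Omega>) = mat_trace (K * \<Omega>) + r / (1 + ?q)" by simp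
  show "mat_trace (K * \<Omega>) \<le> mat_trace (K1 * \<Omega>)" using r0 q unfolding eq by simp
  have "\<gamma> * r \<le> 1 + ?q" using rq by simp
  then have "r / (1 + ?q) \<le> 1 / \<gamma>" using \<gamma> q by (simp add: field_simps)
  then show "mat_trace (K1 * \<Omega>) \<le> mat_trace (K * \<Omega>) + 1 / \<gamma>" unfolding eq by simp
qed

text \<open>The bounds that hold for every outcome. The second follows from the first because
  leverages are nonnegative. For the third,
  \<open>trace (K \<Omega> K S) = trace (K \<Omega>)\<close>; expanding \<open>S\<close> on the left
  leaves \<open>\<gamma> trace ((K \<Omega>)\<^sup>2)\<close> plus the nonnegative terms
  \<open>(K w i)' \<Omega> (K w i)\<close>.\<close>

lemma trace_ridge_bounds:
  assumes \<Omega>: "pos_def_mat d \<Omega>" and \<gamma>: "0 < \<gamma>" and w: "\<And>i. i \<in> I \<Longrightarrow> w i \<in> carrier_vec d"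
  defines "K \<equiv> inverse_mat (gram_mat (\<gamma> \<cdot>\<^sub>m \<Omega>) I w)"
  shows "(\<Sum>i\<in>I. leverage (\<gamma> \<cdot>\<^sub>m \<Omega>) I w i) = real d - \<gamma> * mat_trace (K * \<Omega>)"
    and "\<gamma> * mat_trace (K * \<Omega>) \<le> real d"
    and "\<gamma> * mat_trace (K * \<Omega> * K * \<Omega>) \<le> mat_trace (K * \<Omega>)"
proof -
  let ?Q = "\<gamma> \<cdot>\<^sub>m \<Omega>"
  let ?S = "gram_mat ?Q I w"
  have Q: "pos_def_mat d ?Q" by (rule pos_def_smult[OF \<Omega> \<gamma>])
  have S: "pos_def_mat d ?S" using Q w by (auto intro!: pos_def_gram_mat)
  note [simp] = pos_def_matD(1)[OF S] pos_def_matD(1)[OF \<Omega>]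
  have K[simp]: "K \<in> carrier_mat d d" unfolding K_def by simp_all
  have KS: "pos_def_mat d K" unfolding K_def by (rule pos_def_mat_inverse(5)[OF S])
  have sm: "mat_trace (A * ?Q) = \<gamma> * mat_trace (A * \<Omega>)" if "A \<in> carrier_mat d d" for A
    using that by (simp add: mult_smult_distrib[of _ d d _ d] mat_trace_smult[of _ d])
  show 1: "(\<Sum>i\<in>I. leverage ?Q I w i) = real d - \<gamma> * mat_trace (K * \<Omega>)"
    using sum_leverage[OF Q w] sm[OF K] by (simp add: K_def)
  have "0 \<le> (\<Sum>i\<in>I. leverage ?Q I w i)"
    by (intro sum_nonneg leverage_nonneg[OF Q]) (use w in auto)
  then show "\<gamma> * mat_trace (K * \<Omega>) \<le> real d" unfolding 1 by simp
  have "mat_trace (K * \<Omega> * K * ?S) = \<gamma> * mat_trace (K * \<Omega> * K * \<Omega>) + (\<Sum>i\<in>I. w i \<bullet> ((K * \<Omega> * K) *\<^sub>v w i))"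
    by (subst mat_trace_mult_gram_mat[where d = d]) (auto simp: w sm[OF mult_carrier_mat[OF mult_carrier_mat[OF K] K]] intro!: mult_carrier_mat[of _ d d])
  also have "mat_trace (K * \<Omega> * K * ?S) = mat_trace (K * \<Omega>)"
  proof -
    have "K * \<Omega> * K * ?S = K * \<Omega> * (K * ?S)" by (rule assoc_mult_mat[of _ d d _ d _ d]) auto
    also have "\<dots> = K * \<Omega>" using pos_def_mat_inverse(2)[OF S] right_mult_one_mat[of "K * \<Omega>" d d]
      by (simp flip: K_def)
    finally show "mat_trace (K * \<Omega> * K * ?S) = mat_trace (K * \<Omega>)" by simp
  qed
  moreover have "0 \<le> w i \<bullet> ((K * \<Omega> * K) *\<^sub>v w i)" if "i \<in> I" for i
  proof -
    have Kw: "K *\<^sub>v w i \<in> carrier_vec d" by (rule mult_mat_vec_carrier[OF K w[OF that]])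
    have "w i \<bullet> ((K * \<Omega> * K) *\<^sub>v w i) = w i \<bullet> (K *\<^sub>v (\<Omega> *\<^sub>v (K *\<^sub>v w i)))"
      using w[OF that] Kw by (simp add: assoc_mult_mat_vec[of _ d d _ d])
    also have "\<dots> = (\<Omega> *\<^sub>v (K *\<^sub>v w i)) \<bullet> (K *\<^sub>v w i)"
      by (rule symmetric_mat_scalar_prod[of _ d])
        (use w[OF that] Kw in \<open>auto intro!: pos_def_matD(2)[OF KS] mult_mat_vec_carrier[of _ d d]\<close>)
    also have "\<dots> = (K *\<^sub>v w i) \<bullet> (\<Omega> *\<^sub>v (K *\<^sub>v w i))"
      by (rule comm_scalar_prod[of _ d]) (use Kw in \<open>auto intro!: mult_mat_vec_carrier[of _ d d]\<close>)
    finally show ?thesis using pos_def_matD(3)[OF \<Omega> Kw] by simp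
  qed
  ultimately show "\<gamma> * mat_trace (K * \<Omega> * K * \<Omega>) \<le> mat_trace (K * \<Omega>)"
    by (smt (verit) sum_nonneg)
qed

text \<open>\<open>W\<close> may be rank deficient, so the solution is built by Gram-Schmidt on its columns: \<open>V j\<close> are the
  coefficient vectors that use the first \<open>j\<close> columns only.\<close>
lemma normal_equations_solvable:
  fixes W :: "real mat"
  assumes W: "W \<in> carrier_mat n k" and b: "b \<in> carrier_vec n"
  obtains y where "y \<in> carrier_vec k" "\<And>x. x \<in> carrier_vec k \<Longrightarrow> (W *\<^sub>v x) \<bullet> (b - W *\<^sub>v y) = 0"
proof -
  define V where "V j = {x \<in> carrier_vec k. \<forall>i<k. j \<le> i \<longrightarrow> x $ i = (0::real)}" for j
  have V: "x \<in> carrier_vec k" if "x \<in> V j" for x j using that by (auto simp: V_def)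
  have Wc: "W *\<^sub>v x \<in> carrier_vec n" if "x \<in> carrier_vec k" for x
    by (rule mult_mat_vec_carrier[OF W that])
  have "\<exists>y\<in>V j. \<forall>x\<in>V j. (W *\<^sub>v x) \<bullet> (b - W *\<^sub>v y) = 0" if "j \<le> k" "b \<in> carrier_vec n" for j b
    using that
  proof (induction j arbitrary: b)
    case 0
    have "V 0 = {0\<^sub>v k}" by (auto simp: V_def intro!: eq_vecI)
    moreover have "W *\<^sub>v 0\<^sub>v k = 0\<^sub>v n" using W by (intro eq_vecI) auto
    ultimately show ?case using 0 W by auto
  next
    case (Suc j)
    then have j: "j < k" by simp
    have e: "unit_vec k j \<in> carrier_vec k" by simp
    obtain q where q: "q \<in> V j" "\<forall>x\<in>V j. (W *\<^sub>v x) \<bullet> (W *\<^sub>v unit_vec k j - W *\<^sub>v q) = 0"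
      using Suc.IH[of "W *\<^sub>v unit_vec k j"] j Wc[OF e] by auto
    obtain y where y: "y \<in> V j" "\<forall>x\<in>V j. (W *\<^sub>v x) \<bullet> (b - W *\<^sub>v y) = 0"
      using Suc.IH[of b] Suc.prems by auto
    \<comment> \<open>The coefficients of the Gram-Schmidt residual \<open>\<rho>\<close> of column
      \<open>j\<close>; \<open>\<rho>\<close> vanishes when the column depends on the earlier
      ones.\<close>
    define r where "r = unit_vec k j - q"
    have r: "r \<in> carrier_vec k" "r $ j = 1" using q(1) j by (auto simp: r_def V_def)
    have rV: "r \<in> V (Suc j)" using q(1) j by (auto simp: r_def V_def unit_vec_def)
    have Wr: "W *\<^sub>v r = W *\<^sub>v unit_vec k j - W *\<^sub>v q"
      unfolding r_def by (rule mult_minus_distrib_mat_vec[OF W e V[OF q(1)]])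
    define \<rho> where "\<rho> = W *\<^sub>v r"
    have \<rho>: "\<rho> \<in> carrier_vec n" unfolding \<rho>_def by (rule Wc[OF r(1)])
    have orth: "(W *\<^sub>v x) \<bullet> \<rho> = 0" if "x \<in> V j" for x using q(2) that by (auto simp: \<rho>_def Wr)
    define s where "s = (\<rho> \<bullet> b) / (\<rho> \<bullet> \<rho>)"
    define y' where "y' = y + s \<cdot>\<^sub>v r"
    have y': "y' \<in> V (Suc j)" using y(1) rV by (auto simp: y'_def V_def)
    have Wy': "W *\<^sub>v y' = W *\<^sub>v y + s \<cdot>\<^sub>v \<rho>"
      unfolding y'_def \<rho>_def using mult_add_distrib_mat_vec[OF W V[OF y(1)], of "s \<cdot>\<^sub>v r"] r
      by (simp add: mult_mat_vec[OF W r(1)])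
    have split: "u \<bullet> (b - W *\<^sub>v y') = u \<bullet> (b - W *\<^sub>v y) - s * (u \<bullet> \<rho>)" if "u \<in> carrier_vec n" for u
      unfolding Wy' using that \<rho> Wc[OF V[OF y(1)]] Suc.prems carrier_matD[OF W]
      by (simp add: scalar_prod_lessThan[of _ n] algebra_simps sum.distrib sum_subtractf sum_distrib_left
          del: index_mult_mat_vec)
    have r_orth: "\<rho> \<bullet> (b - W *\<^sub>v y') = 0"
    proof -
      have "\<rho> \<bullet> (b - W *\<^sub>v y) = \<rho> \<bullet> b"
        using orth[OF y(1)] \<rho> Suc.prems Wc[OF V[OF y(1)]] comm_scalar_prod[of \<rho> n "W *\<^sub>v y"]
        by (simp add: scalar_prod_minus_distrib[of _ n])
      \<comment> \<open>For a dependent column \<open>s = 0\<close>, as division by zero gives zero,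
        and both sides vanish.\<close>
      moreover have "s * (\<rho> \<bullet> \<rho>) = \<rho> \<bullet> b"
      proof (cases "\<rho> \<bullet> \<rho> = 0")
        case True
        then have "\<rho> $ i = 0" if "i < n" for i
          using \<rho> that by (simp add: scalar_prod_lessThan[of _ n] sum_nonneg_eq_0_iff)
        then have "\<rho> \<bullet> b = 0" using \<rho> Suc.prems by (simp add: scalar_prod_lessThan[of _ n])
        with True show ?thesis by simp
      qed (simp add: s_def)
      ultimately show ?thesis unfolding split[OF \<rho>] by simp
    qed
    have "(W *\<^sub>v x) \<bullet> (b - W *\<^sub>v y') = 0" if x: "x \<in> V (Suc j)" for x
    proof -
      \<comment> \<open>As \<open>r $ j = 1\<close>, coordinate \<open>j\<close> is cancelled and
        \<open>x'\<close> uses the earlier columns only.\<close>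
      define x' where "x' = x - (x $ j) \<cdot>\<^sub>v r"
      have x'V: "x' \<in> V j"
      proof -
        have "x' $ l = 0" if "l < k" "j \<le> l" for l
          using x rV r that by (cases "l = j") (auto simp: V_def x'_def)
        moreover have "x' \<in> carrier_vec k" using V[OF x] r(1) by (simp add: x'_def)
        ultimately show ?thesis by (simp add: V_def)
      qed
      have "W *\<^sub>v x = W *\<^sub>v (x' + (x $ j) \<cdot>\<^sub>v r)"
        by (rule arg_cong[of _ _ "(*\<^sub>v) W"], rule eq_vecI) (use V[OF x] r in \<open>auto simp: x'_def\<close>)
      also have "\<dots> = W *\<^sub>v x' + (x $ j) \<cdot>\<^sub>v \<rho>"
        unfolding \<rho>_def using mult_add_distrib_mat_vec[OF W V[OF x'V], of "(x $ j) \<cdot>\<^sub>v r"] r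
        by (simp add: mult_mat_vec[OF W r(1)])
      finally have Wx: "W *\<^sub>v x = W *\<^sub>v x' + (x $ j) \<cdot>\<^sub>v \<rho>" .
      have c: "b - W *\<^sub>v y' \<in> carrier_vec n" using Suc.prems Wc[OF V[OF y']] by simp
      have "(W *\<^sub>v x) \<bullet> (b - W *\<^sub>v y') = (W *\<^sub>v x') \<bullet> (b - W *\<^sub>v y') + x $ j * (\<rho> \<bullet> (b - W *\<^sub>v y'))"
        unfolding Wx using c \<rho> Wc[OF V[OF x'V]]
        by (simp add: add_scalar_prod_distrib[of _ n])
      also have "\<dots> = 0"
        using r_orth y(2) x'V orth[OF x'V] unfolding split[OF Wc[OF V[OF x'V]]] by simp
      finally show ?thesis .
    qed
    with y' show ?case by auto
  qed
  from this[of k b] b obtain y where "y \<in> V k" "\<forall>x\<in>V k. (W *\<^sub>v x) \<bullet> (b - W *\<^sub>v y) = 0" by auto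
  moreover have "V k = carrier_vec k" by (auto simp: V_def)
  ultimately show ?thesis using that by auto
qed

section \<open>The projection onto the column span and its relation to ridge leverages\<close>

lemma col_space_mult_mat_vec:
  fixes W :: "real mat"
  assumes "W \<in> carrier_mat n k"
  shows "vec_space.col_space n W = (\<lambda>x. W *\<^sub>v x) ` carrier_vec k"
proof -
  interpret vec_space "TYPE(real)" n .
  show ?thesis using col_space_eq[OF assms] assms by (auto intro: mult_mat_vec_carrier)
qed

text \<open>Existence and uniqueness justify the \<open>THE\<close> in \<open>proj_mat\<close>; a
  rank deficient \<open>W\<close> offers no closed form \<open>W (W' W)\<^sup>-\<^sup>1 W'\<close>
  to start from.\<close>

lemma proj_mat_props:
  assumes W: "W \<in> carrier_mat n k"
  shows "proj_mat W \<in> carrier_mat n n"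
    and "v \<in> carrier_vec n \<Longrightarrow> \<exists>y\<in>carrier_vec k. proj_mat W *\<^sub>v v = W *\<^sub>v y \<and>
           (\<forall>x\<in>carrier_vec k. (W *\<^sub>v x) \<bullet> (v - W *\<^sub>v y) = 0)"
proof -
  define is_proj where "is_proj P \<longleftrightarrow> P \<in> carrier_mat n n \<and>
     (\<forall>v\<in>carrier_vec n. P *\<^sub>v v \<in> vec_space.col_space n W \<and>
        (\<forall>w\<in>vec_space.col_space n W. w \<bullet> (v - P *\<^sub>v v) = 0))" for P
  note cs = col_space_mult_mat_vec[OF W]
  have Wc: "W *\<^sub>v x \<in> carrier_vec n" if "x \<in> carrier_vec k" for x
    by (rule mult_mat_vec_carrier[OF W that])
  have "\<forall>b\<in>carrier_vec n. \<exists>y. y \<in> carrier_vec k \<and> (\<forall>x\<in>carrier_vec k. (W *\<^sub>v x) \<bullet> (b - W *\<^sub>v y) = 0)"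
    by (metis normal_equations_solvable[OF W])
  then obtain f where f: "\<And>b. b \<in> carrier_vec n \<Longrightarrow> f b \<in> carrier_vec k"
    "\<And>b x. b \<in> carrier_vec n \<Longrightarrow> x \<in> carrier_vec k \<Longrightarrow> (W *\<^sub>v x) \<bullet> (b - W *\<^sub>v f b) = 0"
    by metis
  \<comment> \<open>The choice \<open>f\<close> of solutions need not be linear, so only its values
    at the unit vectors are kept, as the columns of \<open>Y\<close>. Orthogonality at other vectors
    then follows from the linearity of \<open>W * Y\<close>.\<close>
  define Y where "Y = Matrix.mat k n (\<lambda>(i, j). f (unit_vec n j) $ i)"
  have Y: "Y \<in> carrier_mat k n" by (simp add: Y_def)
  have P: "W * Y \<in> carrier_mat n n" using W Y by simp
  have orth: "(W *\<^sub>v x) \<bullet> (v - (W * Y) *\<^sub>v v) = 0" if x: "x \<in> carrier_vec k" and v: "v \<in> carrier_vec n" for x v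
  proof -
    let ?u = "W *\<^sub>v x"
    have u: "?u \<in> carrier_vec n" by (rule Wc[OF x])
    have col: "(W * Y) $$ (i, j) = (W *\<^sub>v f (unit_vec n j)) $ i" if "i < n" "j < n" for i j
      using that W f(1)[of "unit_vec n j"] by (auto simp: Y_def scalar_prod_def intro!: sum.cong)
    have 0: "(\<Sum>i<n. ?u $ i * (W * Y) $$ (i, j)) = ?u $ j" if j: "j < n" for j
    proof -
      have c: "W *\<^sub>v f (unit_vec n j) \<in> carrier_vec n" using Wc[OF f(1)[of "unit_vec n j"]] by simp
      have "0 = ?u \<bullet> (unit_vec n j - W *\<^sub>v f (unit_vec n j))"
        using f(2)[of "unit_vec n j" x] x by simp
      also have "\<dots> = ?u \<bullet> unit_vec n j - ?u \<bullet> (W *\<^sub>v f (unit_vec n j))"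
        by (rule scalar_prod_minus_distrib[OF u _ c]) simp
      also have "\<dots> = ?u $ j - (\<Sum>i<n. ?u $ i * (W * Y) $$ (i, j))"
        unfolding scalar_prod_lessThan[OF u c] using u j by (simp add: col)
      finally show ?thesis by simp
    qed
    have "?u \<bullet> ((W * Y) *\<^sub>v v) = (\<Sum>j<n. (\<Sum>i<n. ?u $ i * (W * Y) $$ (i, j)) * v $ j)"
      unfolding scalar_prod_mult_mat_vec[OF P u v] by (subst sum.swap) (simp add: sum_distrib_right)
    also have "\<dots> = ?u \<bullet> v" using u v by (simp add: 0 scalar_prod_lessThan[of _ n])
    finally show ?thesis
      using u v P by (simp add: scalar_prod_minus_distrib[of _ n] mult_mat_vec_carrier[OF P])
  qed
  have ex: "is_proj (W * Y)"
    unfolding is_proj_def cs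
  proof (intro conjI ballI P)
    fix v :: "real vec" assume v: "v \<in> carrier_vec n"
    show "(W * Y) *\<^sub>v v \<in> (\<lambda>x. W *\<^sub>v x) ` carrier_vec k"
      using assoc_mult_mat_vec[OF W Y v] mult_mat_vec_carrier[OF Y v] by auto
    show "w \<bullet> (v - (W * Y) *\<^sub>v v) = 0" if "w \<in> (\<lambda>x. W *\<^sub>v x) ` carrier_vec k" for w
      using that orth[OF _ v] by auto
  qed
  have uniq: "P' = P''" if "is_proj P'" "is_proj P''" for P' P''
  proof -
    have vec: "P' *\<^sub>v v = P'' *\<^sub>v v" if v: "v \<in> carrier_vec n" for v
    proof -
      from \<open>is_proj P'\<close> v obtain y where y: "y \<in> carrier_vec k" "P' *\<^sub>v v = W *\<^sub>v y"
        "\<forall>x\<in>carrier_vec k. (W *\<^sub>v x) \<bullet> (v - W *\<^sub>v y) = 0" unfolding is_proj_def cs by force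
      from \<open>is_proj P''\<close> v obtain z where z: "z \<in> carrier_vec k" "P'' *\<^sub>v v = W *\<^sub>v z"
        "\<forall>x\<in>carrier_vec k. (W *\<^sub>v x) \<bullet> (v - W *\<^sub>v z) = 0" unfolding is_proj_def cs by force
      \<comment> \<open>The difference of the two projections of \<open>v\<close> lies in the column
        span and is orthogonal to it, hence to itself.\<close>
      define \<delta> where "\<delta> = W *\<^sub>v (y - z)"
      have \<delta>: "\<delta> = W *\<^sub>v y - W *\<^sub>v z" unfolding \<delta>_def by (rule mult_minus_distrib_mat_vec[OF W y(1) z(1)])
      note c = Wc[OF y(1)] Wc[OF z(1)]
      have "\<delta> \<bullet> (v - W *\<^sub>v y) = 0" "\<delta> \<bullet> (v - W *\<^sub>v z) = 0"
        using y(1,3) z(1,3) unfolding \<delta>_def by auto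
      then have "\<delta> \<bullet> \<delta> = 0"
      proof -
        assume 0: "\<delta> \<bullet> (v - W *\<^sub>v y) = 0" "\<delta> \<bullet> (v - W *\<^sub>v z) = 0"
        have d: "\<delta> \<in> carrier_vec n" using c by (simp add: \<delta>)
        have "\<delta> = (v - W *\<^sub>v z) - (v - W *\<^sub>v y)" using c v W by (intro eq_vecI) (auto simp: \<delta>)
        then have "\<delta> \<bullet> \<delta> = \<delta> \<bullet> ((v - W *\<^sub>v z) - (v - W *\<^sub>v y))" by (rule arg_cong)
        also have "\<dots> = \<delta> \<bullet> (v - W *\<^sub>v z) - \<delta> \<bullet> (v - W *\<^sub>v y)"
          by (rule scalar_prod_minus_distrib[OF d]) (use c v in auto)
        finally show ?thesis using 0 by simp
      qed
      then have "\<delta> $ i = 0" if "i < n" for i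
        using c that by (simp add: \<delta> scalar_prod_lessThan[of _ n] sum_nonneg_eq_0_iff
            del: index_mult_mat_vec dim_mult_mat_vec)
      then show ?thesis unfolding y z using c W by (intro eq_vecI) (auto simp: \<delta>)
    qed
    have "P' $$ (i, j) = P'' $$ (i, j)" if "i < n" "j < n" for i j
      using arg_cong[OF vec[of "unit_vec n j"], of "\<lambda>v. v $ i"] that \<open>is_proj P'\<close> \<open>is_proj P''\<close>
      by (auto simp: is_proj_def)
    with that show ?thesis by (intro eq_matI) (auto simp: is_proj_def)
  qed
  have "proj_mat W = (THE P. is_proj P)"
    using W by (simp add: proj_mat_def is_proj_def)
  then have "is_proj (proj_mat W)"
    using theI[of is_proj, OF ex] uniq ex by metis
  then show "proj_mat W \<in> carrier_mat n n"
    "v \<in> carrier_vec n \<Longrightarrow> \<exists>y\<in>carrier_vec k. proj_mat W *\<^sub>v v = W *\<^sub>v y \<and>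
           (\<forall>x\<in>carrier_vec k. (W *\<^sub>v x) \<bullet> (v - W *\<^sub>v y) = 0)"
    unfolding is_proj_def cs by force+
qed

text \<open>\<open>v\<close> holds the coefficients of the projected unit vector \<open>e_i\<close>,
  and the second conjunct is the normal equations. It takes the place of
  \<open>(W' W)\<^sup>-\<^sup>1 w i\<close> when \<open>W' W\<close> is singular.\<close>

lemma proj_mat_diag:
  assumes W: "W \<in> carrier_mat n k" and i: "i < n"
  shows "\<exists>v\<in>carrier_vec k. proj_mat W $$ (i, i) = row W i \<bullet> v \<and>
    (\<forall>x\<in>carrier_vec k. row W i \<bullet> x = (\<Sum>a<n. (row W a \<bullet> x) * (row W a \<bullet> v)))"
proof -
  note P = proj_mat_props(1)[OF W]
  obtain y where y: "y \<in> carrier_vec k" "proj_mat W *\<^sub>v unit_vec n i = W *\<^sub>v y"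
    "\<forall>x\<in>carrier_vec k. (W *\<^sub>v x) \<bullet> (unit_vec n i - W *\<^sub>v y) = 0"
    using proj_mat_props(2)[OF W, of "unit_vec n i"] by auto
  have "proj_mat W $$ (i, i) = row W i \<bullet> y"
    using arg_cong[OF y(2), of "\<lambda>v. v $ i"] i W P by simp
  moreover have "row W i \<bullet> x = (\<Sum>a<n. (row W a \<bullet> x) * (row W a \<bullet> y))" if x: "x \<in> carrier_vec k" for x
  proof -
    have c: "W *\<^sub>v x \<in> carrier_vec n" "W *\<^sub>v y \<in> carrier_vec n"
      using mult_mat_vec_carrier[OF W x] mult_mat_vec_carrier[OF W y(1)] .
    have "0 = (W *\<^sub>v x) \<bullet> (unit_vec n i - W *\<^sub>v y)" using y(3) x by simp
    also have "\<dots> = (W *\<^sub>v x) \<bullet> unit_vec n i - (W *\<^sub>v x) \<bullet> (W *\<^sub>v y)"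
      by (rule scalar_prod_minus_distrib[OF c(1) _ c(2)]) simp
    also have "(W *\<^sub>v x) \<bullet> unit_vec n i = (W *\<^sub>v x) $ i" using c i by (simp del: index_mult_mat_vec)
    also have "(W *\<^sub>v x) \<bullet> (W *\<^sub>v y) = (\<Sum>a<n. (row W a \<bullet> x) * (row W a \<bullet> y))"
      unfolding scalar_prod_lessThan[OF c] using W by simp
    finally show ?thesis using W i by simp
  qed
  ultimately show ?thesis using y(1) by blast
qed

text \<open>With \<open>y = S\<^sup>-\<^sup>1 w i\<close> and \<open>v\<close> from
  \<open>proj_mat_diag\<close>, the ridge leverage equals both \<open>y' Q y + |W y|\<^sup>2\<close>
  and the inner product of \<open>W y\<close> and \<open>W v\<close>, while the projection leverage
  is \<open>|W v|\<^sup>2\<close>. The first bound is \<open>|W y - W v|\<^sup>2 \<ge> 0\<close>. In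
  the second, \<open>C\<close> is independent of \<open>\<epsilon>\<close>, so ridge leverages
  converge as the regularisation vanishes.\<close>

lemma leverage_le_proj:
  assumes Q: "pos_def_mat k Q" and W: "W \<in> carrier_mat n k" and i: "i < n"
  shows "leverage Q {..<n} (row W) i \<le> proj_mat W $$ (i, i)"
    and "\<exists>C. \<forall>\<epsilon>>0. proj_mat W $$ (i, i) - \<epsilon> * C \<le> leverage (\<epsilon> \<cdot>\<^sub>m Q) {..<n} (row W) i"
proof -
  note Qc = pos_def_matD(1)[OF Q]
  have w: "row W a \<in> carrier_vec k" for a using W by auto
  obtain v where v: "v \<in> carrier_vec k" "proj_mat W $$ (i, i) = row W i \<bullet> v"
    and vx: "\<forall>x\<in>carrier_vec k. row W i \<bullet> x = (\<Sum>a<n. (row W a \<bullet> x) * (row W a \<bullet> v))"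
    using proj_mat_diag[OF W i] by (elim bexE conjE) (rule that)
  note v = v bspec[OF vx]
  have expand: "leverage Q {..<n} (row W) i =
      y \<bullet> (Q *\<^sub>v y) + (\<Sum>a<n. (row W a \<bullet> y)\<^sup>2)"
    and y: "y \<in> carrier_vec k"
    and norm: "\<And>x. x \<in> carrier_vec k \<Longrightarrow> x \<bullet> (Q *\<^sub>v y) + (\<Sum>a<n. (row W a \<bullet> x) * (row W a \<bullet> y)) = row W i \<bullet> x"
    if Q: "pos_def_mat k Q" and y_def: "y = inverse_mat (gram_mat Q {..<n} (row W)) *\<^sub>v row W i" for Q y
  proof -
    let ?S = "gram_mat Q {..<n} (row W)"
    note Qc = pos_def_matD(1)[OF Q]
    have S: "pos_def_mat k ?S" by (rule pos_def_gram_mat[OF Q w])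
    show y: "y \<in> carrier_vec k" unfolding y_def
      using pos_def_matD(1)[OF S] w by (intro mult_mat_vec_carrier[of _ k k]) auto
    have Sy: "?S *\<^sub>v y = row W i" unfolding y_def by (rule pos_def_mat_inverse(3)[OF S w])
    show norm: "x \<bullet> (Q *\<^sub>v y) + (\<Sum>a<n. (row W a \<bullet> x) * (row W a \<bullet> y)) = row W i \<bullet> x"
      if "x \<in> carrier_vec k" for x
      using scalar_prod_gram_mat[where w = "row W" and I = "{..<n}", OF Qc w that y] comm_scalar_prod[OF that w, of i]
      unfolding Sy by simp
    have "row W i \<bullet> y = y \<bullet> (Q *\<^sub>v y) + (\<Sum>a<n. (row W a \<bullet> y) * (row W a \<bullet> y))"
      by (rule norm[OF y, symmetric])
    then show "leverage Q {..<n} (row W) i = y \<bullet> (Q *\<^sub>v y) + (\<Sum>a<n. (row W a \<bullet> y)\<^sup>2)"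
      by (simp add: y_def power2_eq_square)
  qed
  have proj_sq: "proj_mat W $$ (i, i) = (\<Sum>a<n. (row W a \<bullet> v)\<^sup>2)"
    unfolding v(2) v(3)[OF v(1)] by (simp add: power2_eq_square)
  show "leverage Q {..<n} (row W) i \<le> proj_mat W $$ (i, i)"
  proof -
    define y where "y = inverse_mat (gram_mat Q {..<n} (row W)) *\<^sub>v row W i"
    note y = y[OF Q y_def] and ex = expand[OF Q y_def]
    have h: "leverage Q {..<n} (row W) i = (\<Sum>a<n. (row W a \<bullet> y) * (row W a \<bullet> v))"
      unfolding y_def[symmetric] by (rule v(3)[OF y])
    have "0 \<le> (\<Sum>a<n. (row W a \<bullet> y - row W a \<bullet> v)\<^sup>2)" by (intro sum_nonneg) auto
    also have "\<dots> = (\<Sum>a<n. (row W a \<bullet> y)\<^sup>2) + proj_mat W $$ (i, i) - 2 * leverage Q {..<n} (row W) i"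
      unfolding proj_sq h
      by (simp add: power2_diff sum.distrib sum_subtractf sum_distrib_left algebra_simps)
    finally show ?thesis using ex pos_def_matD(3)[OF Q y] by linarith
  qed
  show "\<exists>C. \<forall>\<epsilon>>0. proj_mat W $$ (i, i) - \<epsilon> * C \<le> leverage (\<epsilon> \<cdot>\<^sub>m Q) {..<n} (row W) i"
  proof (intro exI allI impI)
    fix \<epsilon> :: real assume \<epsilon>: "\<epsilon> > 0"
    let ?Q = "\<epsilon> \<cdot>\<^sub>m Q"
    have Q': "pos_def_mat k ?Q" by (rule pos_def_smult[OF Q \<epsilon>])
    define y where "y = inverse_mat (gram_mat ?Q {..<n} (row W)) *\<^sub>v row W i"
    note y = y[OF Q' y_def]
    have h: "leverage ?Q {..<n} (row W) i = (\<Sum>a<n. (row W a \<bullet> y) * (row W a \<bullet> v))"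
      unfolding y_def[symmetric] by (rule v(3)[OF y])
    have A: "v \<bullet> (?Q *\<^sub>v y) + leverage ?Q {..<n} (row W) i = proj_mat W $$ (i, i)"
      using norm[OF Q' y_def v(1)] unfolding v(2) h by (simp add: mult.commute)
    moreover have B: "v \<bullet> (?Q *\<^sub>v y) = \<epsilon> * (v \<bullet> (Q *\<^sub>v y))" by (rule smult_mat_scalar_prod[OF Qc v(1) y])
    \<comment> \<open>The gap is \<open>\<epsilon> v' Q y\<close>, but \<open>y\<close> depends on
      \<open>\<epsilon>\<close> and has to be eliminated; this makes \<open>v' Q v\<close> the
      witness for \<open>C\<close>. From \<open>|W y - W v|\<^sup>2 \<ge> 0\<close> follows
      \<open>y' Q y \<le> v' Q y\<close>, and \<open>(v - y)' Q (v - y) \<ge> 0\<close> does the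
      rest.\<close>
    moreover have "v \<bullet> (Q *\<^sub>v y) \<le> v \<bullet> (Q *\<^sub>v v)"
    proof -
      have 1: "leverage ?Q {..<n} (row W) i = \<epsilon> * (y \<bullet> (Q *\<^sub>v y)) + (\<Sum>a<n. (row W a \<bullet> y)\<^sup>2)"
        using expand[OF Q' y_def] smult_mat_scalar_prod[OF Qc y y, of \<epsilon>] by simp
      have "0 \<le> (\<Sum>a<n. (row W a \<bullet> y - row W a \<bullet> v)\<^sup>2)" by (intro sum_nonneg) auto
      also have "\<dots> = (\<Sum>a<n. (row W a \<bullet> y)\<^sup>2) + proj_mat W $$ (i, i) - 2 * leverage ?Q {..<n} (row W) i"
        unfolding proj_sq h
        by (simp add: power2_diff sum.distrib sum_subtractf sum_distrib_left algebra_simps)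
      finally have "\<epsilon> * (y \<bullet> (Q *\<^sub>v y)) \<le> \<epsilon> * (v \<bullet> (Q *\<^sub>v y))"
        using 1 A B by linarith
      then have 2: "y \<bullet> (Q *\<^sub>v y) \<le> v \<bullet> (Q *\<^sub>v y)" using \<epsilon> by simp
      have "0 \<le> (v - y) \<bullet> (Q *\<^sub>v (v - y))" using pos_def_matD(3)[OF Q, of "v - y"] v(1) y by simp
      also have "\<dots> = v \<bullet> (Q *\<^sub>v v) - v \<bullet> (Q *\<^sub>v y) - (y \<bullet> (Q *\<^sub>v v) - y \<bullet> (Q *\<^sub>v y))"
        using v(1) y Qc by (simp add: mult_minus_distrib_mat_vec[of _ k k]
          minus_scalar_prod_distrib[of _ k] scalar_prod_minus_distrib[of _ k] mult_mat_vec_carrier[of _ k k])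
      also have "y \<bullet> (Q *\<^sub>v v) = v \<bullet> (Q *\<^sub>v y)"
        by (rule symmetric_mat_scalar_prod[OF Qc pos_def_matD(2)[OF Q] y v(1)])
      finally show ?thesis using 2 by linarith
    qed
    ultimately show "proj_mat W $$ (i, i) - \<epsilon> * (v \<bullet> (Q *\<^sub>v v)) \<le> leverage ?Q {..<n} (row W) i"
      using \<epsilon> by (smt (verit) mult_left_mono)
  qed
qed

section \<open>Regressors and their second moment matrix\<close>

text \<open>The rank is the size of a maximal independent subset of the set of columns. Hence rank
  \<open>k\<close> first forces the \<open>k\<close> columns to be pairwise distinct, and only then
  yields their independence.\<close>

lemma full_column_rank_inj:
  fixes R :: "real mat"
  assumes R: "R \<in> carrier_mat n k" "vec_space.rank n R = k"
    and v: "v \<in> carrier_vec k" "R *\<^sub>v v = 0\<^sub>v n"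
  shows "v = 0\<^sub>v k"
proof (rule ccontr)
  interpret vec_space "TYPE(real)" n .
  assume "v \<noteq> 0\<^sub>v k"
  obtain S where S: "maximal S (\<lambda>T. T \<subseteq> set (cols R) \<and> lin_indpt T)"
    using maximal_exists[of "(\<lambda>T. T \<subseteq> set (cols R) \<and> lin_indpt T)" "card (set (cols R))" "{}"]
    by (meson List.finite_set card_mono empty_iff empty_subsetI finite_lin_indpt2 rev_finite_subset)
  then have "k = card S" using rank_card_indpt[OF R(1) S] R(2) by simp
  also have "\<dots> \<le> card (set (cols R))" using S by (simp add: card_mono maximal_def)
  finally have "length (cols R) \<le> card (set (cols R))" using R(1) by simp
  then have dist: "distinct (cols R)" using card_length[of "cols R"] by (intro card_distinct) simp
  have "lin_dep (set (cols R))" by (rule lin_depI[OF R(1) v(1) \<open>v \<noteq> _\<close> v(2) dist])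
  with full_rank_lin_indpt[OF R dist] show False by simp
qed

lemma (in vec_space) rank_le_dim:
  assumes "A \<in> carrier_mat n nc" shows "rank A \<le> n"
proof -
  obtain S where S: "maximal S (\<lambda>T. T \<subseteq> set (cols A) \<and> lin_indpt T)"
    using maximal_exists[of "(\<lambda>T. T \<subseteq> set (cols A) \<and> lin_indpt T)" "card (set (cols A))" "{}"]
    by (meson List.finite_set card_mono empty_iff empty_subsetI finite_lin_indpt2 rev_finite_subset)
  then have "rank A = card S" "lin_indpt S" "S \<subseteq> carrier_vec n"
    using rank_card_indpt[OF assms S] assms cols_dim[of A] by (auto simp: maximal_def)
  then show ?thesis using li_le_dim(2)[OF fin_dim] dim_is_n by simp
qed

section \<open>Rows of the design as affine images of the noise\<close>

definition regressor :: "real mat \<Rightarrow> real vec \<Rightarrow> real vec" where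
  "regressor R x = R\<^sup>T *\<^sub>v vCons 1 x"

lemma regressor_carrier [simp]: "R \<in> carrier_mat (Suc p) k \<Longrightarrow> regressor R x \<in> carrier_vec k"
  unfolding regressor_def by (intro carrier_vecI) auto

lemma row_aug_data_mat:
  assumes R: "R \<in> carrier_mat (Suc p) k" and x: "\<And>i. i < n \<Longrightarrow> x i \<in> carrier_vec p" and i: "i < n"
  shows "row (aug_data_mat n p x * R) i = regressor R (x i)"
proof -
  have "row (aug_data_mat n p x) i = vCons 1 (x i)"
    using x[OF i] i by (intro eq_vecI) (auto simp: aug_data_mat_def mat_of_rows_def vec_index_vCons split: nat.split)
  then show ?thesis
    using R x[OF i] i by (intro eq_vecI)
      (auto simp: regressor_def aug_data_mat_def intro!: comm_scalar_prod[of _ "Suc p"])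
qed

lemma aug_data_mat_carrier [simp]: "aug_data_mat n p x \<in> carrier_mat n (Suc p)"
  by (simp add: aug_data_mat_def)

text \<open>\<open>\<Gamma>\<close> with a zero row on top: the intercept coordinate of
  \<open>(1, \<mu> + \<Gamma> z)\<close> carries no noise.\<close>

definition lift_mat :: "real mat \<Rightarrow> real mat" where
  "lift_mat \<Gamma> = Matrix.mat (Suc (dim_row \<Gamma>)) (dim_col \<Gamma>) (\<lambda>(i, j). case i of 0 \<Rightarrow> 0 | Suc l \<Rightarrow> \<Gamma> $$ (l, j))"

lemma lift_mat_carrier [simp]: "\<Gamma> \<in> carrier_mat p m \<Longrightarrow> lift_mat \<Gamma> \<in> carrier_mat (Suc p) m"
  by (simp add: lift_mat_def)

lemma lift_mat_mult_vec:
  assumes "\<Gamma> \<in> carrier_mat p m" "z \<in> carrier_vec m"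
  shows "lift_mat \<Gamma> *\<^sub>v z = vCons 0 (\<Gamma> *\<^sub>v z)"
proof (rule eq_vecI)
  fix i assume "i < dim_vec (vCons 0 (\<Gamma> *\<^sub>v z))"
  then show "(lift_mat \<Gamma> *\<^sub>v z) $ i = vCons 0 (\<Gamma> *\<^sub>v z) $ i"
    using assms by (cases i) (auto simp: lift_mat_def scalar_prod_def)
qed (use assms in \<open>auto simp: lift_mat_def\<close>)

lemma transpose_lift_mat_mult_vec:
  assumes "\<Gamma> \<in> carrier_mat p m" "u \<in> carrier_vec p"
  shows "(lift_mat \<Gamma>)\<^sup>T *\<^sub>v vCons c u = \<Gamma>\<^sup>T *\<^sub>v u"
  using assms by (intro eq_vecI)
    (auto simp: lift_mat_def scalar_prod_def atLeast0LessThan sum.lessThan_Suc_shift simp del: sum.lessThan_Suc)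

lemma regressor_affine:
  assumes R: "R \<in> carrier_mat (Suc p) k" and \<Gamma>: "\<Gamma> \<in> carrier_mat p m"
    and \<mu>: "\<mu> \<in> carrier_vec p" and z: "z \<in> carrier_vec m"
  shows "regressor R (\<mu> + \<Gamma> *\<^sub>v z) = regressor R \<mu> + (R\<^sup>T * lift_mat \<Gamma>) *\<^sub>v z"
proof -
  note L = lift_mat_carrier[OF \<Gamma>]
  have Rt: "R\<^sup>T \<in> carrier_mat k (Suc p)" using R by simp
  have "vCons 1 (\<mu> + \<Gamma> *\<^sub>v z) = vCons 1 \<mu> + lift_mat \<Gamma> *\<^sub>v z"
    unfolding lift_mat_mult_vec[OF \<Gamma> z] using \<mu> \<Gamma> by (intro eq_vecI) (auto simp: vec_index_vCons)
  then have "regressor R (\<mu> + \<Gamma> *\<^sub>v z) = R\<^sup>T *\<^sub>v (vCons 1 \<mu> + lift_mat \<Gamma> *\<^sub>v z)"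
    by (simp add: regressor_def)
  also have "\<dots> = R\<^sup>T *\<^sub>v vCons 1 \<mu> + R\<^sup>T *\<^sub>v (lift_mat \<Gamma> *\<^sub>v z)"
    by (rule mult_add_distrib_mat_vec[OF Rt _ mult_mat_vec_carrier[OF L z]]) (use \<mu> in simp)
  also have "R\<^sup>T *\<^sub>v (lift_mat \<Gamma> *\<^sub>v z) = (R\<^sup>T * lift_mat \<Gamma>) *\<^sub>v z"
    by (rule assoc_mult_mat_vec[OF Rt L z, symmetric])
  finally show ?thesis by (simp add: regressor_def)
qed

text \<open>\<open>E w w'\<close> for \<open>w = a + B z\<close> with \<open>E z = 0\<close> and \<open>E z z' = I\<close>.\<close>
definition second_moment_mat :: "real vec \<Rightarrow> real mat \<Rightarrow> real mat" where
  "second_moment_mat a B = outer_prod a a + B * B\<^sup>T"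

lemma second_moment_mat_carrier [simp]:
  "a \<in> carrier_vec k \<Longrightarrow> B \<in> carrier_mat k m \<Longrightarrow> second_moment_mat a B \<in> carrier_mat k k"
  by (auto simp: second_moment_mat_def)

lemma second_moment_quadratic:
  assumes a: "a \<in> carrier_vec k" and B: "B \<in> carrier_mat k m" and u: "u \<in> carrier_vec k" and v: "v \<in> carrier_vec k"
  shows "u \<bullet> (second_moment_mat a B *\<^sub>v v) = (a \<bullet> u) * (a \<bullet> v) + (B\<^sup>T *\<^sub>v u) \<bullet> (B\<^sup>T *\<^sub>v v)"
proof -
  have Bt: "B\<^sup>T \<in> carrier_mat m k" using B by simp
  have c: "B\<^sup>T *\<^sub>v v \<in> carrier_vec m" by (rule mult_mat_vec_carrier[OF Bt v])
  have "second_moment_mat a B *\<^sub>v v = outer_prod a a *\<^sub>v v + (B * B\<^sup>T) *\<^sub>v v"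
    unfolding second_moment_mat_def by (rule add_mult_distrib_mat_vec[of _ k k]) (use a B v in auto)
  also have "\<dots> = (a \<bullet> v) \<cdot>\<^sub>v a + B *\<^sub>v (B\<^sup>T *\<^sub>v v)"
    using outer_prod_mult_vec[OF a a v] assoc_mult_mat_vec[OF B Bt v] by simp
  also have "u \<bullet> \<dots> = u \<bullet> ((a \<bullet> v) \<cdot>\<^sub>v a) + u \<bullet> (B *\<^sub>v (B\<^sup>T *\<^sub>v v))"
    by (rule scalar_prod_add_distrib[of _ k]) (use a u mult_mat_vec_carrier[OF B c] in auto)
  also have "u \<bullet> ((a \<bullet> v) \<cdot>\<^sub>v a) = (a \<bullet> u) * (a \<bullet> v)"
    using a u comm_scalar_prod[OF u a] by (simp add: scalar_prod_smult_distrib[of _ k])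
  also have "u \<bullet> (B *\<^sub>v (B\<^sup>T *\<^sub>v v)) = (B\<^sup>T *\<^sub>v u) \<bullet> (B\<^sup>T *\<^sub>v v)"
    using transpose_vec_mult_scalar[OF B c u] by simp
  finally show ?thesis .
qed

text \<open>With \<open>R v = (c, u)\<close> the quadratic form at \<open>v\<close> is
  \<open>(c + \<mu>' u)\<^sup>2 + u' \<Gamma> \<Gamma>' u\<close>. If \<open>u \<noteq> 0\<close>,
  the covariance makes it positive; if \<open>u = 0\<close>, injectivity of \<open>R\<close> gives
  \<open>c \<noteq> 0\<close>. The summand \<open>a a'\<close> matters: \<open>B B'\<close> alone is
  singular as soon as the range of \<open>R\<close> contains the intercept direction.\<close>

lemma pos_def_second_moment:
  assumes R: "R \<in> carrier_mat (Suc p) k" and \<Gamma>: "\<Gamma> \<in> carrier_mat p m" and \<mu>: "\<mu> \<in> carrier_vec p"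
    and rank: "vec_space.rank (Suc p) R = k" and pd: "pos_def_mat p (\<Gamma> * \<Gamma>\<^sup>T)"
  shows "pos_def_mat k (second_moment_mat (regressor R \<mu>) (R\<^sup>T * lift_mat \<Gamma>))" (is "pos_def_mat k (second_moment_mat ?a ?B)")
  unfolding pos_def_mat_def
proof (intro conjI ballI impI)
  have Rt: "R\<^sup>T \<in> carrier_mat k (Suc p)" using R by simp
  have a: "?a \<in> carrier_vec k" and B: "?B \<in> carrier_mat k m"
    using R mult_carrier_mat[OF Rt lift_mat_carrier[OF \<Gamma>]] by auto
  show "second_moment_mat ?a ?B \<in> carrier_mat k k" using a B by simp
  have "(?B * ?B\<^sup>T)\<^sup>T = ?B * ?B\<^sup>T" using B by (subst transpose_mult[of _ k m _ k]) auto
  moreover have "(outer_prod ?a ?a)\<^sup>T = outer_prod ?a ?a" by (auto simp: outer_prod_def)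
  moreover have "(outer_prod ?a ?a + ?B * ?B\<^sup>T)\<^sup>T = (outer_prod ?a ?a)\<^sup>T + (?B * ?B\<^sup>T)\<^sup>T"
    by (rule transpose_add[of _ k k]) (use a B in auto)
  ultimately show "(second_moment_mat ?a ?B)\<^sup>T = second_moment_mat ?a ?B"
    unfolding second_moment_mat_def by simp
  fix v :: "real vec" assume v: "v \<in> carrier_vec k" "v \<noteq> 0\<^sub>v k"
  have q: "v \<bullet> (second_moment_mat ?a ?B *\<^sub>v v) = (?a \<bullet> v)\<^sup>2 + (?B\<^sup>T *\<^sub>v v) \<bullet> (?B\<^sup>T *\<^sub>v v)"
    unfolding second_moment_quadratic[OF a B v(1) v(1)] by (simp add: power2_eq_square)
  have Rv: "R *\<^sub>v v \<in> carrier_vec (Suc p)" by (rule mult_mat_vec_carrier[OF R v(1)])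
  define c where "c = (R *\<^sub>v v) $ 0"
  define u where "u = vec p (\<lambda>i. (R *\<^sub>v v) $ Suc i)"
  have u: "u \<in> carrier_vec p" by (simp add: u_def)
  have cu: "R *\<^sub>v v = vCons c u"
    using carrier_vecD[OF Rv] by (intro eq_vecI)
      (auto simp: c_def u_def vec_index_vCons simp del: dim_mult_mat_vec index_mult_mat_vec)
  have "?B\<^sup>T *\<^sub>v v = (lift_mat \<Gamma>)\<^sup>T *\<^sub>v (R *\<^sub>v v)"
    using R \<Gamma> v lift_mat_carrier[OF \<Gamma>]
    by (simp add: transpose_mult[OF Rt lift_mat_carrier[OF \<Gamma>]] assoc_mult_mat_vec[of _ m "Suc p" _ k])
  also have "\<dots> = \<Gamma>\<^sup>T *\<^sub>v u" unfolding cu by (rule transpose_lift_mat_mult_vec[OF \<Gamma> u])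
  finally have Bv: "?B\<^sup>T *\<^sub>v v = \<Gamma>\<^sup>T *\<^sub>v u" .
  have \<Gamma>t: "\<Gamma>\<^sup>T \<in> carrier_mat m p" using \<Gamma> by simp
  have "u \<bullet> ((\<Gamma> * \<Gamma>\<^sup>T) *\<^sub>v u) = (\<Gamma>\<^sup>T *\<^sub>v u) \<bullet> (\<Gamma>\<^sup>T *\<^sub>v u)"
    using transpose_vec_mult_scalar[OF \<Gamma> mult_mat_vec_carrier[OF \<Gamma>t u] u] assoc_mult_mat_vec[OF \<Gamma> \<Gamma>t u] by simp
  then have Bq: "(?B\<^sup>T *\<^sub>v v) \<bullet> (?B\<^sup>T *\<^sub>v v) = u \<bullet> ((\<Gamma> * \<Gamma>\<^sup>T) *\<^sub>v u)" unfolding Bv by simp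
  have av: "?a \<bullet> v = c + \<mu> \<bullet> u"
    unfolding regressor_def using transpose_vec_mult_scalar[OF R v(1), of "vCons 1 \<mu>"] \<mu> by (simp add: cu)
  show "0 < v \<bullet> (second_moment_mat ?a ?B *\<^sub>v v)"
  proof (cases "u = 0\<^sub>v p")
    case True
    have "c \<noteq> 0"
    proof
      assume "c = 0"
      then have "R *\<^sub>v v = 0\<^sub>v (Suc p)" using cu True by (simp add: zero_vec_Suc)
      from full_column_rank_inj[OF R rank v(1) this] v(2) show False by simp
    qed
    then show ?thesis unfolding q Bq av using True \<mu> pos_def_matD(3)[OF pd u] by (simp add: add_pos_nonneg)
  next
    case False
    then show ?thesis unfolding q Bq using pos_def_matD(4)[OF pd u False] by (simp add: add_nonneg_pos)
  qed
qed

text \<open>Subtracting the mean cancels \<open>a' K a\<close>. What remains is a linear form in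
  \<open>z\<close>, governed by second moments, and the centred quadratic form in \<open>z\<close>,
  to which the variance condition applies.\<close>

lemma quadratic_form_affine:
  assumes a: "a \<in> carrier_vec k" and B: "B \<in> carrier_mat k m" and K: "pos_def_mat k K" and z: "z \<in> carrier_vec m"
  shows "(a + B *\<^sub>v z) \<bullet> (K *\<^sub>v (a + B *\<^sub>v z)) - mat_trace (K * second_moment_mat a B) =
     2 * ((B\<^sup>T *\<^sub>v (K *\<^sub>v a)) \<bullet> z) + (z \<bullet> ((B\<^sup>T * K * B) *\<^sub>v z) - mat_trace (B\<^sup>T * K * B))"
proof -
  note Kc = pos_def_matD(1)[OF K] and Ks = pos_def_matD(2)[OF K]
  have Bt: "B\<^sup>T \<in> carrier_mat m k" using B by simp
  define y where "y = B *\<^sub>v z"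
  have y: "y \<in> carrier_vec k" unfolding y_def by (rule mult_mat_vec_carrier[OF B z])
  have Ka: "K *\<^sub>v a \<in> carrier_vec k" and Ky: "K *\<^sub>v y \<in> carrier_vec k" using Kc a y by auto
  have "(a + y) \<bullet> (K *\<^sub>v (a + y)) = (a + y) \<bullet> (K *\<^sub>v a) + (a + y) \<bullet> (K *\<^sub>v y)"
    using mult_add_distrib_mat_vec[OF Kc a y] scalar_prod_add_distrib[OF _ Ka Ky, of "a + y"] a y by simp
  also have "\<dots> = a \<bullet> (K *\<^sub>v a) + y \<bullet> (K *\<^sub>v a) + (a \<bullet> (K *\<^sub>v y) + y \<bullet> (K *\<^sub>v y))"
    using add_scalar_prod_distrib[OF a y Ka] add_scalar_prod_distrib[OF a y Ky] by simp
  also have "a \<bullet> (K *\<^sub>v y) = y \<bullet> (K *\<^sub>v a)" by (rule symmetric_mat_scalar_prod[OF Kc Ks a y])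
  also have "y \<bullet> (K *\<^sub>v a) = (B\<^sup>T *\<^sub>v (K *\<^sub>v a)) \<bullet> z"
    using transpose_vec_mult_scalar[OF B z Ka] comm_scalar_prod[OF y Ka] by (simp add: y_def)
  also have "y \<bullet> (K *\<^sub>v y) = z \<bullet> ((B\<^sup>T * K * B) *\<^sub>v z)"
  proof -
    have "(B\<^sup>T * K * B) *\<^sub>v z = B\<^sup>T *\<^sub>v (K *\<^sub>v y)"
      unfolding y_def using assoc_mult_mat_vec[OF mult_carrier_mat[OF Bt Kc] B z]
        assoc_mult_mat_vec[OF Bt Kc mult_mat_vec_carrier[OF B z]] by (rule trans)
    moreover have "(B\<^sup>T *\<^sub>v (K *\<^sub>v y)) \<bullet> z = (K *\<^sub>v y) \<bullet> y"
      unfolding y_def[symmetric] using transpose_vec_mult_scalar[OF B z Ky] by (simp add: y_def)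
    ultimately show ?thesis
      using comm_scalar_prod[OF y Ky] comm_scalar_prod[OF z mult_mat_vec_carrier[OF Bt Ky]] by simp
  qed
  finally have 1: "(a + y) \<bullet> (K *\<^sub>v (a + y)) =
     a \<bullet> (K *\<^sub>v a) + 2 * ((B\<^sup>T *\<^sub>v (K *\<^sub>v a)) \<bullet> z) + z \<bullet> ((B\<^sup>T * K * B) *\<^sub>v z)" by simp
  have "K * second_moment_mat a B = K * outer_prod a a + K * (B * B\<^sup>T)"
    unfolding second_moment_mat_def by (rule mult_add_distrib_mat[of _ k k _ k]) (use Kc a B in auto)
  then have "mat_trace (K * second_moment_mat a B) = a \<bullet> (K *\<^sub>v a) + mat_trace (K * (B * B\<^sup>T))"
    using mat_trace_add[of "K * outer_prod a a" k "K * (B * B\<^sup>T)"] mat_trace_mult_outer_prod[OF Kc a a] Kc a B by simp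
  also have "mat_trace (K * (B * B\<^sup>T)) = mat_trace (B\<^sup>T * K * B)"
    using mat_trace_mult_comm[of "K * B" k m "B\<^sup>T"] Kc B Bt by (simp add: assoc_mult_mat[of _ _ k])
  finally show ?thesis using 1 unfolding y_def by simp
qed

text \<open>With \<open>A = a a'\<close> and \<open>C = B B'\<close>, the trace of
  \<open>(K \<Omega>)\<^sup>2\<close> splits into \<open>(a' K a)\<^sup>2\<close>, twice
  \<open>|B' K a|\<^sup>2\<close> and the trace of \<open>(B' K B)\<^sup>2\<close>. All are
  nonnegative, so each is bounded by the total. Likewise
  \<open>trace (K \<Omega>) = a' K a + trace (B' K B)\<close>.\<close>

lemma quadratic_form_traces:
  assumes a: "a \<in> carrier_vec k" and B: "B \<in> carrier_mat k m" and K: "pos_def_mat k K"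
  defines "\<Omega> \<equiv> second_moment_mat a B"
  shows "(B\<^sup>T *\<^sub>v (K *\<^sub>v a)) \<bullet> (B\<^sup>T *\<^sub>v (K *\<^sub>v a)) \<le> mat_trace (K * \<Omega> * K * \<Omega>)"
    and "mat_trace ((B\<^sup>T * K * B) * (B\<^sup>T * K * B)) \<le> mat_trace (K * \<Omega> * K * \<Omega>)"
    and "0 \<le> mat_trace (B\<^sup>T * K * B)" and "mat_trace (B\<^sup>T * K * B) \<le> mat_trace (K * \<Omega>)"
    and "B\<^sup>T * K * B \<in> carrier_mat m m" and "(B\<^sup>T * K * B)\<^sup>T = B\<^sup>T * K * B"
proof -
  note Kc = pos_def_matD(1)[OF K] and Ks = pos_def_matD(2)[OF K]
  have Bt: "B\<^sup>T \<in> carrier_mat m k" using B by simp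
  define A where "A = outer_prod a a"
  define C where "C = B * B\<^sup>T"
  have Ac[simp]: "A \<in> carrier_mat k k" and Cc[simp]: "C \<in> carrier_mat k k" using a B by (auto simp: A_def C_def)
  note [simp] = Kc
  show T: "B\<^sup>T * K * B \<in> carrier_mat m m" using Bt Kc B by auto
  show "(B\<^sup>T * K * B)\<^sup>T = B\<^sup>T * K * B"
    unfolding transpose_mult[OF mult_carrier_mat[OF Bt Kc] B] transpose_mult[OF Bt Kc] Ks
    using assoc_mult_mat[OF Bt Kc B] by simp
  have trT: "mat_trace (B\<^sup>T * K * B) = mat_trace (K * C)"
    using mat_trace_mult_comm[of "K * B" k m "B\<^sup>T"] Kc B Bt assoc_mult_mat[OF Bt Kc B]
    by (simp add: C_def assoc_mult_mat[of _ _ k])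
  have \<Omega>: "\<Omega> = A + C" by (simp add: \<Omega>_def second_moment_mat_def A_def C_def)
  have aKa: "0 \<le> a \<bullet> (K *\<^sub>v a)" by (rule pos_def_matD(3)[OF K a])
  have trKA: "mat_trace (K * A) = a \<bullet> (K *\<^sub>v a)" unfolding A_def by (rule mat_trace_mult_outer_prod[OF Kc a a])
  have "K * \<Omega> = K * A + K * C" unfolding \<Omega> by (rule mult_add_distrib_mat[of _ k k _ k]) auto
  then have "mat_trace (K * \<Omega>) = mat_trace (K * A) + mat_trace (K * C)"
    using mat_trace_add[of "K * A" k "K * C"] by simp
  then show "mat_trace (B\<^sup>T * K * B) \<le> mat_trace (K * \<Omega>)" unfolding trT trKA using aKa by simp
  show "0 \<le> mat_trace (B\<^sup>T * K * B)"
    unfolding mat_trace_def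
  proof (rule sum_nonneg)
    fix i assume "i \<in> {..<dim_row (B\<^sup>T * K * B)}"
    then have i: "i < m" using B by simp
    have e: "unit_vec m i \<in> carrier_vec m" by simp
    have Be: "B *\<^sub>v unit_vec m i \<in> carrier_vec k" by (rule mult_mat_vec_carrier[OF B e])
    have "(B\<^sup>T * K * B) $$ (i, i) = unit_vec m i \<bullet> ((B\<^sup>T * K * B) *\<^sub>v unit_vec m i)"
    proof -
      have "Y $$ (i, i) = unit_vec m i \<bullet> (Y *\<^sub>v unit_vec m i)" if "Y \<in> carrier_mat m m" for Y :: "real mat"
        using that i by simp
      from this[OF T] show ?thesis .
    qed
    also have "(B\<^sup>T * K * B) *\<^sub>v unit_vec m i = B\<^sup>T *\<^sub>v (K *\<^sub>v (B *\<^sub>v unit_vec m i))"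
      using assoc_mult_mat_vec[OF mult_carrier_mat[OF Bt Kc] B e]
        assoc_mult_mat_vec[OF Bt Kc mult_mat_vec_carrier[OF B e]] by (rule trans)
    also have "unit_vec m i \<bullet> \<dots> = (B *\<^sub>v unit_vec m i) \<bullet> (K *\<^sub>v (B *\<^sub>v unit_vec m i))"
      using transpose_vec_mult_scalar[OF Bt, of "K *\<^sub>v (B *\<^sub>v unit_vec m i)" "unit_vec m i"] Be Kc by simp
    finally show "0 \<le> (B\<^sup>T * K * B) $$ (i, i)" using pos_def_matD(3)[OF K Be] by simp
  qed
  have KO: "K * \<Omega> * K * \<Omega> = (K * A * K * A + K * A * K * C) + (K * C * K * A + K * C * K * C)"
  proof -
    have 1: "K * \<Omega> * K = K * A * K + K * C * K"
      unfolding \<Omega> by (simp add: mult_add_distrib_mat[of _ k k _ k] add_mult_distrib_mat[of _ k k _ _ k])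
    have "K * \<Omega> * K * \<Omega> = K * A * K * \<Omega> + K * C * K * \<Omega>"
      unfolding 1 by (rule add_mult_distrib_mat[of _ k k _ _ k]) (auto simp: \<Omega>)
    also have "K * A * K * \<Omega> = K * A * K * A + K * A * K * C"
      unfolding \<Omega> by (rule mult_add_distrib_mat[of _ k k _ k]) auto
    also have "K * C * K * \<Omega> = K * C * K * A + K * C * K * C"
      unfolding \<Omega> by (rule mult_add_distrib_mat[of _ k k _ k]) auto
    finally show ?thesis .
  qed
  have tr: "mat_trace (K * \<Omega> * K * \<Omega>) = mat_trace (K * A * K * A) + mat_trace (K * A * K * C)
      + (mat_trace (K * C * K * A) + mat_trace (K * C * K * C))"
    unfolding KO by (simp add: mat_trace_add[of _ k])
  have swap: "mat_trace (K * A * K * C) = mat_trace (K * C * K * A)"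
    using mat_trace_mult_comm[of "K * A" k k "K * C"] by (simp add: assoc_mult_mat[of _ k k _ k _ k])
  have Ka: "K *\<^sub>v a \<in> carrier_vec k" using a by simp
  have "mat_trace (K * C * K * A) = a \<bullet> ((K * C * K) *\<^sub>v a)"
    unfolding A_def by (rule mat_trace_mult_outer_prod[OF _ a a]) auto
  also have "(K * C * K) *\<^sub>v a = K *\<^sub>v (C *\<^sub>v (K *\<^sub>v a))"
    using assoc_mult_mat_vec[OF mult_carrier_mat[OF Kc Cc] Kc a] assoc_mult_mat_vec[OF Kc Cc Ka]
    by (rule trans)
  also have "a \<bullet> \<dots> = (C *\<^sub>v (K *\<^sub>v a)) \<bullet> (K *\<^sub>v a)"
    by (rule symmetric_mat_scalar_prod[OF Kc Ks a]) (use Ka in simp)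
  also have "C *\<^sub>v (K *\<^sub>v a) = B *\<^sub>v (B\<^sup>T *\<^sub>v (K *\<^sub>v a))"
    unfolding C_def by (rule assoc_mult_mat_vec[OF B Bt Ka])
  also have "(B *\<^sub>v (B\<^sup>T *\<^sub>v (K *\<^sub>v a))) \<bullet> (K *\<^sub>v a) = (B\<^sup>T *\<^sub>v (K *\<^sub>v a)) \<bullet> (B\<^sup>T *\<^sub>v (K *\<^sub>v a))"
    using transpose_vec_mult_scalar[OF Bt Ka mult_mat_vec_carrier[OF Bt Ka]] by simp
  finally have trCA: "mat_trace (K * C * K * A) = (B\<^sup>T *\<^sub>v (K *\<^sub>v a)) \<bullet> (B\<^sup>T *\<^sub>v (K *\<^sub>v a))" .
  have pos: "0 \<le> (B\<^sup>T *\<^sub>v (K *\<^sub>v a)) \<bullet> (B\<^sup>T *\<^sub>v (K *\<^sub>v a))"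
    using mult_mat_vec_carrier[OF Bt Ka] by (auto simp: scalar_prod_def intro!: sum_nonneg)
  have trAA: "0 \<le> mat_trace (K * A * K * A)"
  proof -
    have "mat_trace (K * A * K * A) = a \<bullet> ((K * A * K) *\<^sub>v a)"
      unfolding A_def by (rule mat_trace_mult_outer_prod[OF _ a a]) (auto simp: A_def[symmetric])
    also have "(K * A * K) *\<^sub>v a = K *\<^sub>v (A *\<^sub>v (K *\<^sub>v a))"
      using assoc_mult_mat_vec[OF mult_carrier_mat[OF Kc Ac] Kc a] assoc_mult_mat_vec[OF Kc Ac Ka]
      by (rule trans)
    also have "\<dots> = (a \<bullet> (K *\<^sub>v a)) \<cdot>\<^sub>v (K *\<^sub>v a)"
      unfolding A_def outer_prod_mult_vec[OF a a Ka] by (rule mult_mat_vec[OF Kc a])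
    also have "a \<bullet> \<dots> = (a \<bullet> (K *\<^sub>v a)) * (a \<bullet> (K *\<^sub>v a))" using a Ka by (simp add: scalar_prod_smult_distrib[of _ k])
    finally show ?thesis by simp
  qed
  have trCC: "mat_trace (K * C * K * C) = mat_trace ((B\<^sup>T * K * B) * (B\<^sup>T * K * B))"
  proof -
    have KB: "K * B \<in> carrier_mat k m" and BK: "B\<^sup>T * K \<in> carrier_mat m k"
      using mult_carrier_mat[OF Kc B] mult_carrier_mat[OF Bt Kc] .
    have "K * C * K * C = (K * B) * ((B\<^sup>T * K * B) * B\<^sup>T)"
    proof -
      have KC: "K * C = (K * B) * B\<^sup>T" unfolding C_def by (rule assoc_mult_mat[OF Kc B Bt, symmetric])
      have "K * C * K * C = (K * C) * (K * C)"
        by (rule assoc_mult_mat[OF mult_carrier_mat[OF Kc Cc] Kc Cc])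
      also have "\<dots> = (K * B) * (B\<^sup>T * ((K * B) * B\<^sup>T))"
        unfolding KC by (rule assoc_mult_mat[OF KB Bt mult_carrier_mat[OF KB Bt]])
      also have "B\<^sup>T * ((K * B) * B\<^sup>T) = (B\<^sup>T * K * B) * B\<^sup>T"
        unfolding assoc_mult_mat[OF Bt Kc B] by (rule assoc_mult_mat[OF Bt KB Bt, symmetric])
      finally show ?thesis .
    qed
    then have "mat_trace (K * C * K * C) = mat_trace (((B\<^sup>T * K * B) * B\<^sup>T) * (K * B))"
      using mat_trace_mult_comm[OF KB mult_carrier_mat[OF T Bt]] by simp
    also have "((B\<^sup>T * K * B) * B\<^sup>T) * (K * B) = (B\<^sup>T * K * B) * (B\<^sup>T * K * B)"
      using assoc_mult_mat[OF T Bt KB] assoc_mult_mat[OF Bt Kc B] by simp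
    finally show ?thesis .
  qed
  have CC0: "0 \<le> mat_trace (K * C * K * C)"
    unfolding trCC
    by (rule mat_trace_symmetric_square_nonneg[OF T \<open>(B\<^sup>T * K * B)\<^sup>T = B\<^sup>T * K * B\<close>])
  show "(B\<^sup>T *\<^sub>v (K *\<^sub>v a)) \<bullet> (B\<^sup>T *\<^sub>v (K *\<^sub>v a)) \<le> mat_trace (K * \<Omega> * K * \<Omega>)"
    unfolding tr swap trCA using trAA CC0 pos by simp
  show "mat_trace ((B\<^sup>T * K * B) * (B\<^sup>T * K * B)) \<le> mat_trace (K * \<Omega> * K * \<Omega>)"
    unfolding tr swap trCA trCC using trAA pos by simp
qed

section \<open>Measurability and permutation of i.i.d. samples\<close>

lemma space_vec_borel [simp]: "space (vec_borel d) = carrier_vec d"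
  by (simp add: vec_borel_def)

lemma measurable_vec_index:
  assumes "i < d" shows "(\<lambda>v. v $ i) \<in> borel_measurable (vec_borel d)"
proof -
  have "(\<lambda>v. \<lambda>k\<in>{..<d}. v $ k) \<in> measurable (vec_borel d) (Pi\<^sub>M {..<d} (\<lambda>_. borel))"
    unfolding vec_borel_def by (rule measurable_vimage_algebra1) (auto simp: space_PiM)
  from measurable_compose[OF this measurable_component_singleton[of i]] assms
  show ?thesis by simp
qed

lemma borel_measurable_det:
  fixes F :: "'s \<Rightarrow> real mat"
  assumes c: "\<And>s. s \<in> space N \<Longrightarrow> F s \<in> carrier_mat d d"
    and m: "\<And>i j. i < d \<Longrightarrow> j < d \<Longrightarrow> (\<lambda>s. F s $$ (i, j)) \<in> borel_measurable N"
  shows "(\<lambda>s. det (F s)) \<in> borel_measurable N"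
proof -
  have "(\<lambda>s. \<Sum>p | p permutes {0..<d}. signof p * (\<Prod>i = 0..<d. F s $$ (i, p i))) \<in> borel_measurable N"
    by (intro borel_measurable_sum borel_measurable_times borel_measurable_prod borel_measurable_const m)
      (auto dest: permutes_in_image)
  then show ?thesis by (rule measurable_cong[THEN iffD1, rotated]) (simp add: det_def'[OF c])
qed

lemma borel_measurable_inverse_mat:
  fixes F :: "'s \<Rightarrow> real mat"
  assumes c: "\<And>s. s \<in> space N \<Longrightarrow> F s \<in> carrier_mat d d"
    and m: "\<And>i j. i < d \<Longrightarrow> j < d \<Longrightarrow> (\<lambda>s. F s $$ (i, j)) \<in> borel_measurable N"
    and ij: "i < d" "j < d"
  shows "(\<lambda>s. inverse_mat (F s) $$ (i, j)) \<in> borel_measurable N"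
proof -
  have "(\<lambda>s. det (mat_delete (F s) j i)) \<in> borel_measurable N"
  proof (rule borel_measurable_det)
    show "mat_delete (F s) j i \<in> carrier_mat (d - 1) (d - 1)" if "s \<in> space N" for s
      using c[OF that] by (auto simp: mat_delete_def)
    fix a b assume ab: "a < d - 1" "b < d - 1"
    have "(\<lambda>s. F s $$ (if a < j then a else Suc a, if b < i then b else Suc b)) \<in> borel_measurable N"
      by (rule m) (use ab in auto)
    then show "(\<lambda>s. mat_delete (F s) j i $$ (a, b)) \<in> borel_measurable N"
      by (rule measurable_cong[THEN iffD1, rotated]) (use carrier_matD[OF c] ab in \<open>simp add: mat_delete_def\<close>)
  qed
  then have "(\<lambda>s. 1 / det (F s) * ((-1) ^ (j + i) * det (mat_delete (F s) j i))) \<in> borel_measurable N"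
    using borel_measurable_det[OF c m] by measurable
  moreover have "inverse_mat (F s) $$ (i, j) = 1 / det (F s) * ((-1) ^ (j + i) * det (mat_delete (F s) j i))"
    if "s \<in> space N" for s
    using c[OF that] ij by (simp add: inverse_mat_def adj_mat_def cofactor_def)
  ultimately show ?thesis using measurable_cong[where M = N] by (metis (no_types, lifting))
qed

context
  fixes N :: "'s measure" and w :: "'s \<Rightarrow> nat \<Rightarrow> real vec" and Q :: "real mat" and I d
  assumes Q: "Q \<in> carrier_mat d d"
    and w: "\<And>i s. i \<in> I \<Longrightarrow> s \<in> space N \<Longrightarrow> w s i \<in> carrier_vec d"
    and m: "\<And>i j. i \<in> I \<Longrightarrow> j < d \<Longrightarrow> (\<lambda>s. w s i $ j) \<in> borel_measurable N"
begin

lemma borel_measurable_ridge_inverse: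
  assumes "i < d" "j < d"
  shows "(\<lambda>s. inverse_mat (gram_mat Q I (w s)) $$ (i, j)) \<in> borel_measurable N"
proof (rule borel_measurable_inverse_mat[where d = d])
  fix a b assume ab: "a < d" "b < d"
  have "(\<lambda>s. Q $$ (a, b) + (\<Sum>i\<in>I. w s i $ a * w s i $ b)) \<in> borel_measurable N"
    using m ab by (intro borel_measurable_add borel_measurable_sum borel_measurable_times) auto
  then show "(\<lambda>s. gram_mat Q I (w s) $$ (a, b)) \<in> borel_measurable N"
    using ab Q by (simp add: gram_mat_def)
qed (use Q assms in auto)

lemma borel_measurable_leverage:
  assumes "i \<in> I"
  shows "(\<lambda>s. leverage Q I (w s) i) \<in> borel_measurable N"
proof -
  have "(\<lambda>s. \<Sum>a<d. \<Sum>b<d. w s i $ a * inverse_mat (gram_mat Q I (w s)) $$ (a, b) * w s i $ b) \<in> borel_measurable N"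
    using m[OF assms] borel_measurable_ridge_inverse
    by (intro borel_measurable_sum borel_measurable_times) auto
  then show ?thesis
    by (rule measurable_cong[THEN iffD1, rotated])
      (use assms w Q in \<open>simp add: scalar_prod_mult_mat_vec[of _ d d]\<close>)
qed

lemma borel_measurable_ridge_trace:
  assumes "\<Omega> \<in> carrier_mat d d"
  shows "(\<lambda>s. mat_trace (inverse_mat (gram_mat Q I (w s)) * \<Omega>)) \<in> borel_measurable N"
proof -
  have "(\<lambda>s. \<Sum>a<d. \<Sum>b<d. inverse_mat (gram_mat Q I (w s)) $$ (a, b) * \<Omega> $$ (b, a)) \<in> borel_measurable N"
    using borel_measurable_ridge_inverse
    by (intro borel_measurable_sum borel_measurable_times) auto
  then show ?thesis
    by (rule measurable_cong[THEN iffD1, rotated]) (use assms Q in \<open>simp add: mat_trace_mult[of _ d d]\<close>)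
qed

end

lemma measurable_regressor:
  assumes R: "R \<in> carrier_mat (Suc p) k" and j: "j < k"
  shows "(\<lambda>x. regressor R x $ j) \<in> borel_measurable (vec_borel p)"
proof -
  have "(\<lambda>x. R $$ (0, j) + (\<Sum>l<p. R $$ (Suc l, j) * x $ l)) \<in> borel_measurable (vec_borel p)"
    by (intro borel_measurable_add borel_measurable_sum borel_measurable_times measurable_vec_index) auto
  moreover have "regressor R x $ j = R $$ (0, j) + (\<Sum>l<p. R $$ (Suc l, j) * x $ l)"
    if "x \<in> space (vec_borel p)" for x
    using R j that
    by (simp add: regressor_def scalar_prod_def atLeast0LessThan sum.lessThan_Suc_shift del: sum.lessThan_Suc)
  ultimately show ?thesis using measurable_cong[where M = "vec_borel p"] by (metis (no_types, lifting))
qed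

lemma gram_mat_cong: "(\<And>i. i \<in> I \<Longrightarrow> w i = w' i) \<Longrightarrow> gram_mat Q I w = gram_mat Q I w'"
  by (simp add: gram_mat_def)

lemma gram_mat_permute:
  assumes "\<pi> permutes I" shows "gram_mat Q I (\<lambda>i. w (\<pi> i)) = gram_mat Q I w"
  using sum.permute[OF assms, of "\<lambda>i. w i $ a * w i $ b" for a b] by (simp add: gram_mat_def o_def)

section \<open>Symmetry and conditioning for i.i.d. samples\<close>

context prob_space
begin

lemma iid_distr_PiM:
  assumes I: "finite I" "l \<in> I" and indep: "indep_vars (\<lambda>_. N) X I"
    and id: "\<And>i j. i \<in> I \<Longrightarrow> j \<in> I \<Longrightarrow> distr M N (X i) = distr M N (X j)"
  shows "distr M (Pi\<^sub>M I (\<lambda>_. N)) (\<lambda>\<omega>. \<lambda>i\<in>I. X i \<omega>) = Pi\<^sub>M I (\<lambda>_. distr M N (X l))"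
proof -
  have rv: "random_variable N (X i)" if "i \<in> I" for i using indep that by (auto simp: indep_vars_def)
  have "distr M (Pi\<^sub>M I (\<lambda>_. N)) (\<lambda>\<omega>. \<lambda>i\<in>I. X i \<omega>) = Pi\<^sub>M I (\<lambda>i. distr M N (X i))"
    using indep_vars_iff_distr_eq_PiM'[where I = I and M' = "\<lambda>_. N" and X = X] I indep rv by auto
  also have "\<dots> = Pi\<^sub>M I (\<lambda>_. distr M N (X l))"
    by (intro PiM_cong refl id I)
  finally show ?thesis .
qed

text \<open>The joint law is a power of a single law, and such a power is invariant under
  reindexing. An empty \<open>I\<close> is treated apart because it offers no index \<open>l\<close>
  to name that law.\<close>

lemma iid_permute:
  assumes I: "finite I" and indep: "indep_vars (\<lambda>_. N) X I"
    and id: "\<And>i j. i \<in> I \<Longrightarrow> j \<in> I \<Longrightarrow> distr M N (X i) = distr M N (X j)"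
    and \<pi>: "\<pi> permutes I" and f: "f \<in> measurable (Pi\<^sub>M I (\<lambda>_. N)) L"
  shows "distr M L (\<lambda>\<omega>. f (\<lambda>i\<in>I. X (\<pi> i) \<omega>)) = distr M L (\<lambda>\<omega>. f (\<lambda>i\<in>I. X i \<omega>))"
proof (cases "I = {}")
  case False
  then obtain l where l: "l \<in> I" by auto
  have rv: "random_variable N (X i)" if "i \<in> I" for i using indep that by (auto simp: indep_vars_def)
  define D where "D = distr M N (X l)"
  let ?X = "\<lambda>\<omega>. \<lambda>i\<in>I. X i \<omega>" and ?P = "Pi\<^sub>M I (\<lambda>_. N)"
  let ?t = "\<lambda>Y. \<lambda>i\<in>I. Y (\<pi> i)"
  have D: "prob_space D" unfolding D_def by (rule prob_space_distr[OF rv[OF l]])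
  have sD: "sets D = sets N" by (simp add: D_def)
  have PD: "distr M ?P ?X = Pi\<^sub>M I (\<lambda>_. D)"
    unfolding D_def by (rule iid_distr_PiM[OF I l indep id])
  have X: "?X \<in> measurable M ?P" using rv by (intro measurable_restrict) auto
  have \<pi>I: "\<pi> i \<in> I" if "i \<in> I" for i using permutes_in_image[OF \<pi>] that by simp
  have t: "?t \<in> measurable ?P ?P"
    by (intro measurable_restrict measurable_component_singleton \<pi>I)
  have "distr M L (\<lambda>\<omega>. f (\<lambda>i\<in>I. X (\<pi> i) \<omega>)) = distr M L (f \<circ> (?t \<circ> ?X))"
    using \<pi>I by (intro distr_cong refl) (auto simp: o_def intro!: arg_cong[of _ _ f])
  also have "\<dots> = distr (distr (distr M ?P ?X) ?P ?t) L f"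
    using X t f by (simp add: distr_distr o_assoc)
  also have "distr (distr M ?P ?X) ?P ?t = distr (Pi\<^sub>M I (\<lambda>_. D)) (Pi\<^sub>M I (\<lambda>_. D)) ?t"
    unfolding PD using sD by (intro distr_cong refl sets_PiM_cong) auto
  also have "\<dots> = Pi\<^sub>M I (\<lambda>_. D)"
    using distr_PiM_reindex[of I "\<lambda>_. D" \<pi> I] D permutes_inj_on[OF \<pi>] \<pi>I by auto
  also have "distr \<dots> L f = distr M L (\<lambda>\<omega>. f (\<lambda>i\<in>I. X i \<omega>))"
    unfolding PD[symmetric] using X f by (simp add: distr_distr o_def)
  finally show ?thesis .
qed (auto intro!: distr_cong arg_cong[of _ _ f])

text \<open>Fubini in place of conditional expectations: observation \<open>l\<close> is integrated
  first with the others frozen at \<open>Y\<close>, and a bound valid for every \<open>Y\<close>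
  survives the outer integral of total mass 1. Nonnegative integrals keep integrability out of the
  statement.\<close>

lemma iid_nn_integral_le:
  assumes I: "finite I" "l \<in> I" and indep: "indep_vars (\<lambda>_. N) X I"
    and id: "\<And>i j. i \<in> I \<Longrightarrow> j \<in> I \<Longrightarrow> distr M N (X i) = distr M N (X j)"
    and G: "G \<in> borel_measurable (Pi\<^sub>M I (\<lambda>_. N))"
    and le: "\<And>Y. Y \<in> space (Pi\<^sub>M (I - {l}) (\<lambda>_. N)) \<Longrightarrow> (\<integral>\<^sup>+\<omega>. G (Y(l := X l \<omega>)) \<partial>M) \<le> C"
  shows "(\<integral>\<^sup>+\<omega>. G (\<lambda>i\<in>I. X i \<omega>) \<partial>M) \<le> C"
proof -
  have rv: "random_variable N (X i)" if "i \<in> I" for i using indep that by (auto simp: indep_vars_def)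
  define D where "D = distr M N (X l)"
  interpret D: prob_space D unfolding D_def by (rule prob_space_distr[OF rv[OF I(2)]])
  interpret P: product_sigma_finite "\<lambda>_. D" ..
  have sets_P: "sets (Pi\<^sub>M J (\<lambda>_. D)) = sets (Pi\<^sub>M J (\<lambda>_. N))" for J :: "'b set"
    by (intro sets_PiM_cong refl) (simp add: D_def)
  interpret Q: prob_space "Pi\<^sub>M (I - {l}) (\<lambda>_. D)" by (intro prob_space_PiM D.prob_space_axioms)
  have X: "(\<lambda>\<omega>. \<lambda>i\<in>I. X i \<omega>) \<in> measurable M (Pi\<^sub>M I (\<lambda>_. N))" using rv by (intro measurable_restrict) auto
  have GD: "G \<in> borel_measurable (Pi\<^sub>M (insert l (I - {l})) (\<lambda>_. D))"
    using G I(2) by (simp add: measurable_cong_sets[OF sets_P refl] insert_absorb)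
  have "(\<integral>\<^sup>+\<omega>. G (\<lambda>i\<in>I. X i \<omega>) \<partial>M) = (\<integral>\<^sup>+Y. G Y \<partial>distr M (Pi\<^sub>M I (\<lambda>_. N)) (\<lambda>\<omega>. \<lambda>i\<in>I. X i \<omega>))"
    by (rule nn_integral_distr[symmetric, OF X]) (use G in simp)
  also have "\<dots> = (\<integral>\<^sup>+Y. G Y \<partial>Pi\<^sub>M (insert l (I - {l})) (\<lambda>_. D))"
    using I(2) iid_distr_PiM[OF I indep id] by (simp add: insert_absorb D_def)
  also have "\<dots> = (\<integral>\<^sup>+Y. (\<integral>\<^sup>+y. G (Y(l := y)) \<partial>D) \<partial>Pi\<^sub>M (I - {l}) (\<lambda>_. D))"
    by (rule P.product_nn_integral_insert[OF _ _ GD]) (use I in auto)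
  also have "\<dots> \<le> (\<integral>\<^sup>+Y. C \<partial>Pi\<^sub>M (I - {l}) (\<lambda>_. D))"
  proof (rule nn_integral_mono)
    fix Y assume Y: "Y \<in> space (Pi\<^sub>M (I - {l}) (\<lambda>_. D))"
    then have Y': "Y \<in> space (Pi\<^sub>M (I - {l}) (\<lambda>_. N))"
      using sets_eq_imp_space_eq[OF sets_P] by simp
    have "(\<lambda>y. Y(l := y)) \<in> measurable N (Pi\<^sub>M (insert l (I - {l})) (\<lambda>_. N))"
      by (rule measurable_fun_upd[where J = "I - {l}"]) (use Y' in auto)
    then have "(\<lambda>y. G (Y(l := y))) \<in> borel_measurable N"
      using G I(2) by (auto intro: measurable_compose simp: insert_absorb)
    then have "(\<integral>\<^sup>+y. G (Y(l := y)) \<partial>D) = (\<integral>\<^sup>+\<omega>. G (Y(l := X l \<omega>)) \<partial>M)"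
      unfolding D_def using rv[OF I(2)] by (simp add: nn_integral_distr)
    also have "\<dots> \<le> C" by (rule le[OF Y'])
    finally show "(\<integral>\<^sup>+y. G (Y(l := y)) \<partial>D) \<le> C" .
  qed
  also have "\<dots> = C" by (simp add: Q.emeasure_space_1)
  finally show ?thesis .
qed

lemma abs_expectation_le_sqrt:
  assumes "integrable M (\<lambda>\<omega>. (Y \<omega>)\<^sup>2)" "random_variable borel Y"
  shows "integrable M Y" "expectation (\<lambda>\<omega>. \<bar>Y \<omega>\<bar>) \<le> sqrt (expectation (\<lambda>\<omega>. (Y \<omega>)\<^sup>2))"
proof -
  show Y: "integrable M Y" by (rule square_integrable_imp_integrable[OF assms(2,1)])
  have "0 \<le> variance (\<lambda>\<omega>. \<bar>Y \<omega>\<bar>)" by simp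
  also have "\<dots> = expectation (\<lambda>\<omega>. (Y \<omega>)\<^sup>2) - (expectation (\<lambda>\<omega>. \<bar>Y \<omega>\<bar>))\<^sup>2"
    using variance_eq[of "\<lambda>\<omega>. \<bar>Y \<omega>\<bar>"] Y assms by simp
  finally show "expectation (\<lambda>\<omega>. \<bar>Y \<omega>\<bar>) \<le> sqrt (expectation (\<lambda>\<omega>. (Y \<omega>)\<^sup>2))"
    by (intro real_le_rsqrt) simp
qed

end

section \<open>Concentration of quadratic forms\<close>

context prob_space
begin

lemma expectation_quadratic_form:
  assumes second: "has_mean_mat M (\<lambda>\<omega>. outer_prod (z \<omega>) (z \<omega>)) (1\<^sub>m m)"
    and z: "\<And>\<omega>. \<omega> \<in> space M \<Longrightarrow> z \<omega> \<in> carrier_vec m" and A: "A \<in> carrier_mat m m"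
  shows "has_bochner_integral M (\<lambda>\<omega>. z \<omega> \<bullet> (A *\<^sub>v z \<omega>)) (mat_trace A)"
proof -
  have "has_bochner_integral M (\<lambda>\<omega>. \<Sum>i<m. \<Sum>j<m. A $$ (i, j) * outer_prod (z \<omega>) (z \<omega>) $$ (i, j))
    (\<Sum>i<m. \<Sum>j<m. A $$ (i, j) * 1\<^sub>m m $$ (i, j))"
    using second unfolding has_mean_mat_def
    by (intro has_bochner_integral_sum has_bochner_integral_mult_right) auto
  moreover have "(\<Sum>i<m. \<Sum>j<m. A $$ (i, j) * 1\<^sub>m m $$ (i, j)) = mat_trace A"
    using A by (simp add: mat_trace_def if_distrib cong: if_cong)
  moreover have "(\<Sum>i<m. \<Sum>j<m. A $$ (i, j) * outer_prod (z \<omega>) (z \<omega>) $$ (i, j)) = z \<omega> \<bullet> (A *\<^sub>v z \<omega>)"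
    if "\<omega> \<in> space M" for \<omega>
    using z[OF that] by (simp add: scalar_prod_mult_mat_vec[OF A] outer_prod_def mult_ac)
  ultimately show ?thesis
    using has_bochner_integral_cong[OF refl, of M] by (metis (no_types, lifting))
qed

text \<open>The quadratic form with the rank one matrix \<open>b b'\<close>.\<close>

lemma expectation_linear_form_squared:
  assumes second: "has_mean_mat M (\<lambda>\<omega>. outer_prod (z \<omega>) (z \<omega>)) (1\<^sub>m m)"
    and z: "\<And>\<omega>. \<omega> \<in> space M \<Longrightarrow> z \<omega> \<in> carrier_vec m" and b: "b \<in> carrier_vec m"
  shows "has_bochner_integral M (\<lambda>\<omega>. (b \<bullet> z \<omega>)\<^sup>2) (b \<bullet> b)"
proof -
  have "mat_trace (outer_prod b b) = b \<bullet> b"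
    using b by (simp add: mat_trace_def outer_prod_def scalar_prod_lessThan[of _ m])
  moreover have "z \<omega> \<bullet> (outer_prod b b *\<^sub>v z \<omega>) = (b \<bullet> z \<omega>)\<^sup>2" if "\<omega> \<in> space M" for \<omega>
    using z[OF that] b comm_scalar_prod[OF z[OF that] b]
    by (simp add: outer_prod_mult_vec[OF b b] scalar_prod_smult_distrib[of _ m] power2_eq_square)
  ultimately show ?thesis
    using expectation_quadratic_form[OF second z outer_prod_carrier[OF b b]] has_bochner_integral_cong[OF refl, of M]
    by (metis (no_types, lifting))
qed

text \<open>Both parts of \<open>quadratic_form_affine\<close> are estimated in mean square: the
  linear form has second moment \<open>|B' K a|\<^sup>2 \<le> s\<close>, the centred quadratic form
  has variance at most \<open>v\<close>. The constant \<open>c\<close> makes room for the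
  leave-one-out error \<open>1 / \<gamma>\<close>.\<close>

lemma quadratic_form_concentration:
  assumes second: "has_mean_mat M (\<lambda>\<omega>. outer_prod (z \<omega>) (z \<omega>)) (1\<^sub>m m)"
    and z: "random_variable (vec_borel m) z"
    and a: "a \<in> carrier_vec k" and B: "B \<in> carrier_mat k m" and K: "pos_def_mat k K"
    and s: "mat_trace (K * second_moment_mat a B * K * second_moment_mat a B) \<le> s"
    and int: "integrable M (\<lambda>\<omega>. (z \<omega> \<bullet> ((B\<^sup>T * K * B) *\<^sub>v z \<omega>))\<^sup>2)"
    and var: "variance (\<lambda>\<omega>. z \<omega> \<bullet> ((B\<^sup>T * K * B) *\<^sub>v z \<omega>)) \<le> v" and c: "0 \<le> c"
  shows "(\<integral>\<^sup>+\<omega>. ennreal (\<bar>(a + B *\<^sub>v z \<omega>) \<bullet> (K *\<^sub>v (a + B *\<^sub>v z \<omega>)) - mat_trace (K * second_moment_mat a B)\<bar> + c) \<partial>M)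
    \<le> ennreal (2 * sqrt s + sqrt v + c)"
proof -
  define T where "T = B\<^sup>T * K * B"
  define b where "b = B\<^sup>T *\<^sub>v (K *\<^sub>v a)"
  have zc: "z \<omega> \<in> carrier_vec m" if "\<omega> \<in> space M" for \<omega>
    using measurable_space[OF z that] by simp
  have T: "T \<in> carrier_mat m m" unfolding T_def by (rule quadratic_form_traces(5)[OF a B K])
  have bm: "b \<in> carrier_vec m"
    unfolding b_def by (rule mult_mat_vec_carrier[of _ m k]) (use B a pos_def_matD(1)[OF K] in auto)
  note quad = expectation_quadratic_form[OF second zc T]
  note lin = expectation_linear_form_squared[OF second zc bm]
  let ?Z = "\<lambda>\<omega>. z \<omega> \<bullet> (T *\<^sub>v z \<omega>) - mat_trace T"
  have zi: "(\<lambda>\<omega>. z \<omega> $ i) \<in> borel_measurable M" if "i < m" for i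
    using measurable_compose[OF z measurable_vec_index[OF that]] .
  have mlin: "(\<lambda>\<omega>. b \<bullet> z \<omega>) \<in> borel_measurable M"
  proof -
    have "(\<lambda>\<omega>. \<Sum>i<m. b $ i * z \<omega> $ i) \<in> borel_measurable M"
      using zi by (intro borel_measurable_sum borel_measurable_times) auto
    then show ?thesis by (rule measurable_cong[THEN iffD1, rotated]) (simp add: scalar_prod_lessThan[OF bm zc])
  qed
  have mZ: "?Z \<in> borel_measurable M" using has_bochner_integral_integrable quad
    by (auto simp: has_bochner_integral_iff)
  have EZ: "expectation (\<lambda>\<omega>. z \<omega> \<bullet> (T *\<^sub>v z \<omega>)) = mat_trace T" and iT: "integrable M (\<lambda>\<omega>. z \<omega> \<bullet> (T *\<^sub>v z \<omega>))"
    using quad by (simp_all add: has_bochner_integral_iff)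
  have iZ2: "integrable M (\<lambda>\<omega>. (?Z \<omega>)\<^sup>2)"
  proof -
    have "integrable M (\<lambda>\<omega>. (z \<omega> \<bullet> (T *\<^sub>v z \<omega>))\<^sup>2 + (mat_trace T)\<^sup>2 - 2 * (z \<omega> \<bullet> (T *\<^sub>v z \<omega>)) * mat_trace T)"
      using int iT unfolding T_def[symmetric] by auto
    then show ?thesis by (simp add: power2_diff)
  qed
  have EZ2: "expectation (\<lambda>\<omega>. (?Z \<omega>)\<^sup>2) \<le> v" using var unfolding T_def[symmetric] EZ .
  have il2: "integrable M (\<lambda>\<omega>. (b \<bullet> z \<omega>)\<^sup>2)" and El2: "expectation (\<lambda>\<omega>. (b \<bullet> z \<omega>)\<^sup>2) \<le> s"
    using lin quadratic_form_traces(1)[OF a B K] s by (auto simp: has_bochner_integral_iff b_def)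
  note 1 = abs_expectation_le_sqrt[OF il2 mlin] and 2 = abs_expectation_le_sqrt[OF iZ2 mZ]
  have "(\<integral>\<^sup>+\<omega>. ennreal (\<bar>(a + B *\<^sub>v z \<omega>) \<bullet> (K *\<^sub>v (a + B *\<^sub>v z \<omega>)) - mat_trace (K * second_moment_mat a B)\<bar> + c) \<partial>M)
      = (\<integral>\<^sup>+\<omega>. ennreal (\<bar>2 * (b \<bullet> z \<omega>) + ?Z \<omega>\<bar> + c) \<partial>M)"
    by (intro nn_integral_cong) (simp add: quadratic_form_affine[OF a B K zc] b_def T_def)
  also have "\<dots> \<le> (\<integral>\<^sup>+\<omega>. ennreal (2 * \<bar>b \<bullet> z \<omega>\<bar> + \<bar>?Z \<omega>\<bar> + c) \<partial>M)"
    by (intro nn_integral_mono ennreal_leI) linarith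
  also have "\<dots> = ennreal (expectation (\<lambda>\<omega>. 2 * \<bar>b \<bullet> z \<omega>\<bar> + \<bar>?Z \<omega>\<bar> + c))"
    using 1(1) 2(1) c by (intro nn_integral_eq_integral) auto
  also have "expectation (\<lambda>\<omega>. 2 * \<bar>b \<bullet> z \<omega>\<bar> + \<bar>?Z \<omega>\<bar> + c) =
      2 * expectation (\<lambda>\<omega>. \<bar>b \<bullet> z \<omega>\<bar>) + expectation (\<lambda>\<omega>. \<bar>?Z \<omega>\<bar>) + c"
    using 1(1) 2(1) by (simp add: prob_space)
  also have "\<dots> \<le> 2 * sqrt s + sqrt v + c"
    using order_trans[OF 1(2) real_sqrt_le_mono[OF El2]] order_trans[OF 2(2) real_sqrt_le_mono[OF EZ2]] by simp
  finally show ?thesis by (simp add: ennreal_leI)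
qed

end

text \<open>The leverage is \<open>1 - 1 / (1 + q)\<close>. Replace \<open>q\<close> by its mean
  \<open>t1 = trace (K1 \<Omega>)\<close>, then \<open>t1\<close> by the trace \<open>t\<close> with
  all observations; \<open>u \<mapsto> 1 / (1 + u)\<close> is 1-Lipschitz for
  \<open>u \<ge> 0\<close>, and the second replacement costs at most
  \<open>1 / \<gamma>\<close>.\<close>

lemma leverage_near_trace:
  assumes a: "a \<in> carrier_vec d" and B: "B \<in> carrier_mat d m"
  defines "\<Omega> \<equiv> second_moment_mat a B"
  assumes \<Omega>: "pos_def_mat d \<Omega>" and \<gamma>: "0 < \<gamma>"
    and w: "\<And>i. i \<in> insert j I \<Longrightarrow> w i \<in> carrier_vec d" and I: "finite I" "j \<notin> I"
  defines "K1 \<equiv> inverse_mat (gram_mat (\<gamma> \<cdot>\<^sub>m \<Omega>) I w)"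
    and "K \<equiv> inverse_mat (gram_mat (\<gamma> \<cdot>\<^sub>m \<Omega>) (insert j I) w)"
  shows "\<bar>leverage (\<gamma> \<cdot>\<^sub>m \<Omega>) (insert j I) w j - 1 + 1 / (1 + mat_trace (K * \<Omega>))\<bar>
    \<le> \<bar>w j \<bullet> (K1 *\<^sub>v w j) - mat_trace (K1 * \<Omega>)\<bar> + 1 / \<gamma>"
proof -
  note Q = pos_def_smult[OF \<Omega> \<gamma>]
  have KP: "pos_def_mat d K" unfolding K_def
    by (intro pos_def_mat_inverse(5) pos_def_gram_mat[OF Q]) (use w in auto)
  define q where "q = w j \<bullet> (K1 *\<^sub>v w j)"
  define t where "t = mat_trace (K * \<Omega>)"
  define t1 where "t1 = mat_trace (K1 * \<Omega>)"
  have q: "0 \<le> q" unfolding q_def K1_def by (rule leverage_nonneg[OF Q]) (use w in auto)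
  have t: "0 \<le> t" using quadratic_form_traces(3,4)[OF a B KP] by (simp add: t_def \<Omega>_def)
  have tt: "t \<le> t1" "t1 \<le> t + 1 / \<gamma>"
    using trace_ridge_insert[OF \<Omega> \<gamma> w I] by (simp_all add: t_def t1_def K_def K1_def)
  have lip: "\<bar>1 / (1 + u) - 1 / (1 + v)\<bar> \<le> \<bar>u - v\<bar>" if "0 \<le> u" "0 \<le> v" for u v :: real
  proof -
    have "1 / (1 + u) - 1 / (1 + v) = (v - u) / ((1 + u) * (1 + v))" using that by (simp add: field_simps)
    moreover have "1 \<le> (1 + u) * (1 + v)" using that mult_mono[of 1 "1 + u" 1 "1 + v"] by simp
    ultimately show ?thesis
      by (simp add: abs_mult abs_minus_commute divide_le_eq mult_left_le that)
        (smt (verit) mult_left_mono mult_cancel_left1 that)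
  qed
  have "leverage (\<gamma> \<cdot>\<^sub>m \<Omega>) (insert j I) w j = q / (1 + q)"
    using leverage_loo(1)[OF Q w I] by (simp add: q_def K1_def)
  also have "\<dots> = 1 - 1 / (1 + q)" using q by (simp add: field_simps)
  finally have "leverage (\<gamma> \<cdot>\<^sub>m \<Omega>) (insert j I) w j - 1 + 1 / (1 + t) =
      (1 / (1 + t1) - 1 / (1 + q)) + (1 / (1 + t) - 1 / (1 + t1))" by simp
  then have "\<bar>leverage (\<gamma> \<cdot>\<^sub>m \<Omega>) (insert j I) w j - 1 + 1 / (1 + t)\<bar> \<le> \<bar>t1 - q\<bar> + \<bar>t - t1\<bar>"
    using lip[of t1 q] lip[of t t1] t tt q by linarith
  then show ?thesis using tt unfolding t_def[symmetric] t1_def[symmetric] q_def[symmetric] by linarith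
qed

text \<open>The constants in the variance condition depend on the sequence of matrices; applying it to a sequence
  of counterexamples makes the bound uniform.\<close>
lemma uniform_variance_bound:
  fixes M :: "nat \<Rightarrow> 'w measure" and m :: "nat \<Rightarrow> nat" and z :: "nat \<Rightarrow> 'w \<Rightarrow> real vec"
  assumes var_cond: "\<And>A :: nat \<Rightarrow> real mat.
          (\<And>n. A n \<in> carrier_mat (m n) (m n) \<and> (A n)\<^sup>T = A n) \<Longrightarrow>
          \<exists>a b. a \<in> O(\<lambda>n. mat_trace (A n * A n)) \<and> b \<in> o(\<lambda>_. 1) \<and>
            (\<forall>\<^sub>F n in sequentially.
               integrable (M n) (\<lambda>\<omega>. (z n \<omega> \<bullet> (A n *\<^sub>v z n \<omega>))\<^sup>2) \<and>
               prob_space.variance (M n) (\<lambda>\<omega>. z n \<omega> \<bullet> (A n *\<^sub>v z n \<omega>)) =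
                 a n + (mat_trace (A n))\<^sup>2 * b n)"
    and L: "0 \<le> L" and \<delta>: "0 < \<delta>"
  shows "\<forall>\<^sub>F n in sequentially. \<forall>A\<in>carrier_mat (m n) (m n). A\<^sup>T = A \<longrightarrow>
     mat_trace (A * A) \<le> L / real n \<longrightarrow> \<bar>mat_trace A\<bar> \<le> L \<longrightarrow>
     integrable (M n) (\<lambda>\<omega>. (z n \<omega> \<bullet> (A *\<^sub>v z n \<omega>))\<^sup>2) \<and>
     prob_space.variance (M n) (\<lambda>\<omega>. z n \<omega> \<bullet> (A *\<^sub>v z n \<omega>)) \<le> \<delta>"
proof -
  define adm where "adm n A \<longleftrightarrow> A \<in> carrier_mat (m n) (m n) \<and> A\<^sup>T = A \<and>
    mat_trace (A * A) \<le> L / real n \<and> \<bar>mat_trace A\<bar> \<le> L" for n A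
  define good where "good n A \<longleftrightarrow> integrable (M n) (\<lambda>\<omega>. (z n \<omega> \<bullet> (A *\<^sub>v z n \<omega>))\<^sup>2) \<and>
     prob_space.variance (M n) (\<lambda>\<omega>. z n \<omega> \<bullet> (A *\<^sub>v z n \<omega>)) \<le> \<delta>" for n A
  \<comment> \<open>Where no counterexample exists, the zero matrix fills the gap; it is admissible
    since its traces vanish and \<open>L \<ge> 0\<close>.\<close>
  define A where "A n = (if \<exists>A. adm n A \<and> \<not> good n A then SOME A. adm n A \<and> \<not> good n A else 0\<^sub>m (m n) (m n))" for n
  have bad: "adm n (A n) \<and> \<not> good n (A n)" if "\<exists>A. adm n A \<and> \<not> good n A" for n
    using someI_ex[OF that] that by (simp add: A_def)
  have "mat_trace (0\<^sub>m d d) = 0" for d by (simp add: mat_trace_def)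
  then have adm: "adm n (A n)" for n
    using bad[of n] L by (cases "\<exists>A. adm n A \<and> \<not> good n A") (auto simp: A_def adm_def)
  have "A n \<in> carrier_mat (m n) (m n) \<and> (A n)\<^sup>T = A n" for n using adm[of n] by (simp add: adm_def)
  from var_cond[of A, OF this] obtain a b where ab: "a \<in> O(\<lambda>n. mat_trace (A n * A n))" "b \<in> o(\<lambda>_. 1)"
    "\<forall>\<^sub>F n in sequentially. integrable (M n) (\<lambda>\<omega>. (z n \<omega> \<bullet> (A n *\<^sub>v z n \<omega>))\<^sup>2) \<and>
       prob_space.variance (M n) (\<lambda>\<omega>. z n \<omega> \<bullet> (A n *\<^sub>v z n \<omega>)) = a n + (mat_trace (A n))\<^sup>2 * b n" by blast
  from ab(1) obtain C where C: "0 < C" "\<forall>\<^sub>F n in sequentially. norm (a n) \<le> C * norm (mat_trace (A n * A n))"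
    by (elim landau_o.bigE)
  \<comment> \<open>Each of the two terms of the variance gets \<open>\<delta> / 2\<close>. The
    squared trace is at most \<open>L\<^sup>2\<close>; the added 1 keeps the denominator positive
    for \<open>L = 0\<close>.\<close>
  define c where "c = \<delta> / (2 * (L\<^sup>2 + 1))"
  have c: "0 < c" using \<delta> by (simp add: c_def add_nonneg_pos)
  from landau_o.smallD[OF ab(2) c] have b: "\<forall>\<^sub>F n in sequentially. norm (b n) \<le> c" by simp
  have "(\<lambda>n. C * L / real n) \<longlonglongrightarrow> 0" by (rule lim_const_over_n)
  then have n: "\<forall>\<^sub>F n in sequentially. C * L / real n < \<delta> / 2"
    by (rule order_tendstoD) (use \<delta> in simp)
  have sq: "0 \<le> mat_trace (A n * A n)" for n
    using adm[of n] by (intro mat_trace_symmetric_square_nonneg[of _ "m n"]) (auto simp: adm_def)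
  from ab(3) C(2) b n have "\<forall>\<^sub>F n in sequentially. good n (A n)"
  proof eventually_elim
    case (elim n)
    have "mat_trace (A n * A n) \<le> L / real n" using adm[of n] by (simp add: adm_def)
    then have "C * mat_trace (A n * A n) \<le> C * L / real n" using C(1) mult_left_mono[of _ _ C] by fastforce
    moreover have "a n \<le> C * mat_trace (A n * A n)" using elim(2) sq[of n] by simp
    ultimately have 1: "a n \<le> \<delta> / 2" using elim(4) by linarith
    have "(mat_trace (A n))\<^sup>2 \<le> L\<^sup>2" using adm[of n] L by (simp add: adm_def abs_le_square_iff[symmetric])
    then have "(mat_trace (A n))\<^sup>2 * c \<le> (L\<^sup>2 + 1) * c" using c by (intro mult_right_mono) auto
    moreover have "(mat_trace (A n))\<^sup>2 * b n \<le> (mat_trace (A n))\<^sup>2 * c"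
      using elim(3) by (intro mult_left_mono) auto
    ultimately have "(mat_trace (A n))\<^sup>2 * b n \<le> (L\<^sup>2 + 1) * c" by linarith
    also have "(L\<^sup>2 + 1) * c = \<delta> / 2" by (simp add: c_def field_simps add_nonneg_eq_0_iff)
    finally show "good n (A n)" using 1 elim by (simp add: good_def)
  qed
  \<comment> \<open>Any counterexample at \<open>n\<close> would have made \<open>A n\<close> a
    counterexample as well.\<close>
  then show ?thesis
  proof eventually_elim
    case (elim n)
    with bad[of n] show ?case unfolding adm_def good_def by blast
  qed
qed

section \<open>Leverages of a random sample\<close>

text \<open>Points of a product space are restricted functions; the data matrix reads only the first
  \<open>n\<close> observations.\<close>

lemma aug_data_mat_restrict: "aug_data_mat n p (\<lambda>i\<in>{..<n}. x i) = aug_data_mat n p x"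
  by (rule arg_cong[of "map (\<lambda>i\<in>{..<n}. x i) [0..<n]" "map x [0..<n]" "\<lambda>xs. Matrix.mat n (Suc p)
     (\<lambda>(i, j). case j of 0 \<Rightarrow> 1 | Suc l \<Rightarrow> mat_of_rows p xs $$ (i, l))", folded aug_data_mat_def]) simp

text \<open>One fixed \<open>n\<close>, and only statements about a single configuration
  \<open>Y\<close> of observations. Leverages are functions on the product space rather than on the
  probability space, so that permutations and Fubini can act on them.\<close>

locale regression_design =
  fixes n p m k :: nat and R \<Gamma> :: "real mat" and \<mu> :: "real vec"
  assumes R: "R \<in> carrier_mat (Suc p) k" and R_rank: "vec_space.rank (Suc p) R = k"
    and \<Gamma>: "\<Gamma> \<in> carrier_mat p m" and \<Gamma>_pd: "pos_def_mat p (\<Gamma> * \<Gamma>\<^sup>T)" and \<mu>: "\<mu> \<in> carrier_vec p"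
begin

abbreviation "config_space \<equiv> Pi\<^sub>M {..<n} (\<lambda>_. vec_borel p)"

definition "shift_vec = regressor R \<mu>"
definition "slope_mat = R\<^sup>T * lift_mat \<Gamma>"
definition "\<Omega> = second_moment_mat shift_vec slope_mat"

lemma shift_vec: "shift_vec \<in> carrier_vec k" and slope_mat: "slope_mat \<in> carrier_mat k m"
  using R mult_carrier_mat[OF _ lift_mat_carrier[OF \<Gamma>], of "R\<^sup>T" k] by (auto simp: shift_vec_def slope_mat_def)

lemma \<Omega>: "pos_def_mat k \<Omega>"
  unfolding \<Omega>_def shift_vec_def slope_mat_def by (rule pos_def_second_moment[OF R \<Gamma> \<mu> R_rank \<Gamma>_pd])

definition "proj_lev Y i = proj_mat (aug_data_mat n p Y * R) $$ (i, i)"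
definition "ridge_lev \<gamma> Y i = leverage (\<gamma> \<cdot>\<^sub>m \<Omega>) {..<n} (\<lambda>i. regressor R (Y i)) i"
definition "ridge_trace \<gamma> Y = mat_trace (inverse_mat (gram_mat (\<gamma> \<cdot>\<^sub>m \<Omega>) {..<n} (\<lambda>i. regressor R (Y i))) * \<Omega>)"

lemma regressor: "regressor R v \<in> carrier_vec k" using R by simp

lemma config_carrier: "Y \<in> space config_space \<Longrightarrow> i < n \<Longrightarrow> Y i \<in> carrier_vec p"
  by (auto simp: space_PiM)

lemma ridge_lev_row:
  assumes "Y \<in> space config_space" "i < n"
  shows "leverage (\<gamma> \<cdot>\<^sub>m \<Omega>) {..<n} (row (aug_data_mat n p Y * R)) i = ridge_lev \<gamma> Y i"
proof -
  have r: "row (aug_data_mat n p Y * R) i = regressor R (Y i)" if "i < n" for i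
    by (rule row_aug_data_mat[OF R config_carrier[OF assms(1)] that])
  show ?thesis unfolding ridge_lev_def r[OF assms(2)]
    by (subst gram_mat_cong[of _ "row (aug_data_mat n p Y * R)" "\<lambda>i. regressor R (Y i)"]) (auto simp: r)
qed

lemma design_carrier: "aug_data_mat n p Y * R \<in> carrier_mat n k"
  by (rule mult_carrier_mat[OF aug_data_mat_carrier R])

lemma
  assumes Y: "Y \<in> space config_space" and i: "i < n"
  shows ridge_lev_le: "0 < \<gamma> \<Longrightarrow> ridge_lev \<gamma> Y i \<le> proj_lev Y i"
    and ridge_lev_ge: "\<exists>C. \<forall>\<gamma>>0. proj_lev Y i - \<gamma> * C \<le> ridge_lev \<gamma> Y i"
  using leverage_le_proj(1)[OF pos_def_smult[OF \<Omega>] design_carrier i, of \<gamma> Y]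
    leverage_le_proj(2)[OF \<Omega> design_carrier i, of Y] ridge_lev_row[OF Y i]
  by (auto simp: proj_lev_def)

lemma
  assumes \<gamma>: "0 < \<gamma>"
  shows ridge_lev_nonneg: "0 \<le> ridge_lev \<gamma> Y i"
    and sum_ridge_lev: "(\<Sum>i<n. ridge_lev \<gamma> Y i) = real k - \<gamma> * ridge_trace \<gamma> Y"
    and ridge_trace_le: "\<gamma> * ridge_trace \<gamma> Y \<le> real k"
    and ridge_trace_nonneg: "0 \<le> ridge_trace \<gamma> Y"
proof -
  note Q = pos_def_smult[OF \<Omega> \<gamma>]
  show "0 \<le> ridge_lev \<gamma> Y i" unfolding ridge_lev_def
    by (rule leverage_nonneg[OF Q regressor regressor])
  show "(\<Sum>i<n. ridge_lev \<gamma> Y i) = real k - \<gamma> * ridge_trace \<gamma> Y" "\<gamma> * ridge_trace \<gamma> Y \<le> real k"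
    unfolding ridge_lev_def ridge_trace_def using trace_ridge_bounds(1,2)[OF \<Omega> \<gamma> regressor] by auto
  have "pos_def_mat k (inverse_mat (gram_mat (\<gamma> \<cdot>\<^sub>m \<Omega>) {..<n} (\<lambda>i. regressor R (Y i))))"
    by (intro pos_def_mat_inverse(5) pos_def_gram_mat Q regressor)
  from quadratic_form_traces(3,4)[OF shift_vec slope_mat this] show "0 \<le> ridge_trace \<gamma> Y"
    unfolding ridge_trace_def \<Omega>_def by linarith
qed

text \<open>This holds for rank deficient designs too, so the leverages inherit measurability and permutation
  equivariance from the ridge leverages without an exceptional null set.\<close>
lemma ridge_lev_tendsto:
  assumes Y: "Y \<in> space config_space" and i: "i < n"
  shows "(\<lambda>j. ridge_lev (1 / real (Suc j)) Y i) \<longlonglongrightarrow> proj_lev Y i"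
proof -
  obtain C where C: "\<forall>\<gamma>>0. proj_lev Y i - \<gamma> * C \<le> ridge_lev \<gamma> Y i" using ridge_lev_ge[OF Y i] ..
  have "(\<lambda>j. 1 / real (Suc j)) \<longlonglongrightarrow> 0" using LIMSEQ_inverse_real_of_nat by (simp add: inverse_eq_divide)
  then have lim: "(\<lambda>j. proj_lev Y i - 1 / real (Suc j) * C) \<longlonglongrightarrow> proj_lev Y i - 0 * C"
    by (intro tendsto_intros)
  have lower: "proj_lev Y i - 1 / real (Suc j) * C \<le> ridge_lev (1 / real (Suc j)) Y i" for j
    using C[rule_format, of "1 / real (Suc j)"] by simp
  have upper: "ridge_lev (1 / real (Suc j)) Y i \<le> proj_lev Y i" for j
    by (rule ridge_lev_le[OF Y i]) simp
  show ?thesis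
    using tendsto_sandwich[OF always_eventually[OF allI[OF lower]] always_eventually[OF allI[OF upper]] lim]
    by simp
qed

text \<open>A limit of the ridge sums \<open>k - \<gamma> t \<le> k\<close>, in place of an argument
  that the trace of a projection is its rank.\<close>

lemma sum_proj_lev_le:
  assumes Y: "Y \<in> space config_space" shows "(\<Sum>i<n. proj_lev Y i) \<le> real k"
proof (rule LIMSEQ_le_const2)
  show "(\<lambda>j. \<Sum>i<n. ridge_lev (1 / real (Suc j)) Y i) \<longlonglongrightarrow> (\<Sum>i<n. proj_lev Y i)"
    by (intro tendsto_sum ridge_lev_tendsto Y) simp
  show "\<exists>N. \<forall>j\<ge>N. (\<Sum>i<n. ridge_lev (1 / real (Suc j)) Y i) \<le> real k"
    using sum_ridge_lev ridge_trace_nonneg by auto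
qed

lemma regressor_measurable:
  assumes "i < n" "j < k" shows "(\<lambda>Y. regressor R (Y i) $ j) \<in> borel_measurable config_space"
proof -
  have "(\<lambda>Y. Y i) \<in> measurable config_space (vec_borel p)"
    by (rule measurable_component_singleton) (use assms in simp)
  from measurable_compose[OF this measurable_regressor[OF R assms(2)]] show ?thesis .
qed

lemma
  assumes "i < n"
  shows ridge_lev_measurable: "(\<lambda>Y. ridge_lev \<gamma> Y i) \<in> borel_measurable config_space"
    and ridge_trace_measurable: "ridge_trace \<gamma> \<in> borel_measurable config_space"
    and proj_lev_measurable: "(\<lambda>Y. proj_lev Y i) \<in> borel_measurable config_space"
proof -
  have c: "\<gamma> \<cdot>\<^sub>m \<Omega> \<in> carrier_mat k k" for \<gamma> using pos_def_matD(1)[OF \<Omega>] by simp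
  show 1: "(\<lambda>Y. ridge_lev \<gamma> Y i) \<in> borel_measurable config_space" for \<gamma>
    unfolding ridge_lev_def
    by (rule borel_measurable_leverage[OF c regressor regressor_measurable]) (use assms in auto)
  show "ridge_trace \<gamma> \<in> borel_measurable config_space"
    unfolding ridge_trace_def[abs_def]
    by (rule borel_measurable_ridge_trace[OF c regressor regressor_measurable pos_def_matD(1)[OF \<Omega>]]) auto
  show "(\<lambda>Y. proj_lev Y i) \<in> borel_measurable config_space"
    by (rule borel_measurable_LIMSEQ_real[OF ridge_lev_tendsto[OF _ assms] 1])
qed

lemma
  assumes \<pi>: "\<pi> permutes {..<n}"
  shows ridge_lev_permute: "i < n \<Longrightarrow> ridge_lev \<gamma> (\<lambda>i\<in>{..<n}. Y (\<pi> i)) i = ridge_lev \<gamma> Y (\<pi> i)"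
    and ridge_trace_permute: "ridge_trace \<gamma> (\<lambda>i\<in>{..<n}. Y (\<pi> i)) = ridge_trace \<gamma> Y"
proof -
  have "gram_mat Q {..<n} (\<lambda>i. regressor R ((\<lambda>i\<in>{..<n}. Y (\<pi> i)) i)) = gram_mat Q {..<n} (\<lambda>i. regressor R (Y i))" for Q
    using gram_mat_permute[OF \<pi>, of Q "\<lambda>i. regressor R (Y i)"]
    by (subst gram_mat_cong[of "{..<n}" _ "\<lambda>i. regressor R (Y (\<pi> i))"]) auto
  then show "i < n \<Longrightarrow> ridge_lev \<gamma> (\<lambda>i\<in>{..<n}. Y (\<pi> i)) i = ridge_lev \<gamma> Y (\<pi> i)"
    "ridge_trace \<gamma> (\<lambda>i\<in>{..<n}. Y (\<pi> i)) = ridge_trace \<gamma> Y"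
    by (auto simp: ridge_lev_def ridge_trace_def)
qed

lemma proj_lev_permute:
  assumes \<pi>: "\<pi> permutes {..<n}" and i: "i < n" and Y: "Y \<in> space config_space"
  shows "proj_lev (\<lambda>i\<in>{..<n}. Y (\<pi> i)) i = proj_lev Y (\<pi> i)"
proof -
  have \<pi>i: "\<pi> j < n" if "j < n" for j using permutes_in_image[OF \<pi>, of j] that by simp
  have "(\<lambda>i\<in>{..<n}. Y (\<pi> i)) \<in> space config_space"
    using Y \<pi>i by (auto simp: space_PiM PiE_iff)
  from LIMSEQ_unique[OF ridge_lev_tendsto[OF this i]] ridge_lev_tendsto[OF Y \<pi>i[OF i]]
  show ?thesis unfolding ridge_lev_permute[OF \<pi> i] by blast
qed

end

section \<open>Random samples: exchangeability and the expectation bound\<close>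

locale regression_sample = regression_design n p m k R \<Gamma> \<mu> + prob_space M
  for n p m k :: nat and R \<Gamma> :: "real mat" and \<mu> :: "real vec" and M :: "'w measure" +
  fixes x :: "nat \<Rightarrow> 'w \<Rightarrow> real vec"
  assumes iid: "iid_vecs M p n x"
begin

definition "sample \<omega> = (\<lambda>i\<in>{..<n}. x i \<omega>)"

lemma indep: "indep_vars (\<lambda>_. vec_borel p) x {..<n}"
  and identical: "i \<in> {..<n} \<Longrightarrow> j \<in> {..<n} \<Longrightarrow> distr M (vec_borel p) (x i) = distr M (vec_borel p) (x j)"
  using iid unfolding iid_vecs_def lessThan_iff by blast+

lemma sample_measurable: "sample \<in> measurable M config_space"
  unfolding sample_def using indep by (intro measurable_restrict) (auto simp: indep_vars_def)

text \<open>Permuting the leverages amounts to permuting the observations, which leaves the law of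
  the sample unchanged.\<close>

lemma exchangeable_proj_lev: "exchangeable M n (\<lambda>i \<omega>. proj_lev (sample \<omega>) i)"
  unfolding exchangeable_def
proof (intro conjI allI impI)
  note s = sample_measurable
  show "(\<lambda>\<omega>. proj_lev (sample \<omega>) i) \<in> borel_measurable M" if "i < n" for i
    using measurable_compose[OF s proj_lev_measurable[OF that]] .
  fix \<pi> :: "nat \<Rightarrow> nat" assume \<pi>: "\<pi> permutes {..<n}"
  let ?F = "\<lambda>Y. \<lambda>i\<in>{..<n}. proj_lev Y i"
  have F: "?F \<in> measurable config_space (Pi\<^sub>M {..<n} (\<lambda>_. borel))"
    by (intro measurable_restrict proj_lev_measurable) simp
  have "distr M (Pi\<^sub>M {..<n} (\<lambda>_. borel)) (\<lambda>\<omega>. ?F (\<lambda>i\<in>{..<n}. x (\<pi> i) \<omega>)) =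
        distr M (Pi\<^sub>M {..<n} (\<lambda>_. borel)) (\<lambda>\<omega>. ?F (\<lambda>i\<in>{..<n}. x i \<omega>))"
    by (rule iid_permute[OF _ indep identical \<pi> F]) simp
  moreover have "?F (\<lambda>i\<in>{..<n}. x (\<pi> i) \<omega>) = (\<lambda>i\<in>{..<n}. proj_lev (sample \<omega>) (\<pi> i))" if "\<omega> \<in> space M" for \<omega>
  proof -
    have \<pi>i: "\<pi> j < n" if "j < n" for j using permutes_in_image[OF \<pi>, of j] that by simp
    have "(\<lambda>i\<in>{..<n}. x (\<pi> i) \<omega>) = (\<lambda>i\<in>{..<n}. sample \<omega> (\<pi> i))" using \<pi>i by (auto simp: sample_def)
    then show ?thesis
      using proj_lev_permute[OF \<pi> _ measurable_space[OF s that]] by (auto intro!: restrict_ext)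
  qed
  ultimately show "distr M (Pi\<^sub>M {..<n} (\<lambda>_. borel)) (\<lambda>\<omega>. \<lambda>i\<in>{..<n}. proj_lev (sample \<omega>) (\<pi> i)) =
      distr M (Pi\<^sub>M {..<n} (\<lambda>_. borel)) (\<lambda>\<omega>. \<lambda>i\<in>{..<n}. proj_lev (sample \<omega>) i)"
    using distr_cong[OF refl refl, of M "\<lambda>\<omega>. ?F (\<lambda>i\<in>{..<n}. x (\<pi> i) \<omega>)" "\<lambda>\<omega>. \<lambda>i\<in>{..<n}. proj_lev (sample \<omega>) (\<pi> i)"]
    by (simp add: sample_def)
qed

lemma expectation_permute:
  fixes f :: "(nat \<Rightarrow> real vec) \<Rightarrow> real"
  assumes f: "f \<in> borel_measurable config_space" and \<pi>: "\<pi> permutes {..<n}"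
  shows "expectation (\<lambda>\<omega>. f (\<lambda>i\<in>{..<n}. sample \<omega> (\<pi> i))) = expectation (\<lambda>\<omega>. f (sample \<omega>))"
proof -
  have \<pi>i: "\<pi> j < n" if "j < n" for j using permutes_in_image[OF \<pi>, of j] that by simp
  have "(\<lambda>i\<in>{..<n}. sample \<omega> (\<pi> i)) = (\<lambda>i\<in>{..<n}. x (\<pi> i) \<omega>)" for \<omega>
    using \<pi>i by (auto simp: sample_def)
  then have "expectation (\<lambda>\<omega>. f (\<lambda>i\<in>{..<n}. sample \<omega> (\<pi> i))) = expectation (\<lambda>\<omega>. f (\<lambda>i\<in>{..<n}. x (\<pi> i) \<omega>))" by simp
  also have "\<dots> = integral\<^sup>L (distr M borel (\<lambda>\<omega>. f (\<lambda>i\<in>{..<n}. x (\<pi> i) \<omega>))) (\<lambda>r. r)"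
  proof (rule integral_distr[symmetric])
    have "(\<lambda>\<omega>. \<lambda>i\<in>{..<n}. x (\<pi> i) \<omega>) \<in> measurable M config_space"
      using indep \<pi>i by (intro measurable_restrict) (auto simp: indep_vars_def)
    from measurable_compose[OF this f] show "random_variable borel (\<lambda>\<omega>. f (\<lambda>i\<in>{..<n}. x (\<pi> i) \<omega>))" .
  qed measurable
  also have "distr M borel (\<lambda>\<omega>. f (\<lambda>i\<in>{..<n}. x (\<pi> i) \<omega>)) = distr M borel (\<lambda>\<omega>. f (\<lambda>i\<in>{..<n}. x i \<omega>))"
    by (rule iid_permute[OF _ indep identical \<pi> f]) simp
  also have "integral\<^sup>L \<dots> (\<lambda>r. r) = expectation (\<lambda>\<omega>. f (sample \<omega>))"
    unfolding sample_def[symmetric]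
    by (rule integral_distr) (use measurable_compose[OF sample_measurable f] in simp_all)
  finally show ?thesis .
qed

text \<open>Carries expectations from observation \<open>0\<close> to observation \<open>i\<close>
  through the transposition of the two, for any \<open>f\<close> that is equivariant at coordinate
  \<open>0\<close>.\<close>

lemma expectation_exchange:
  fixes f :: "(nat \<Rightarrow> real vec) \<Rightarrow> nat \<Rightarrow> real"
  assumes f: "(\<lambda>Y. f Y 0) \<in> borel_measurable config_space" and i: "i < n"
    and sym: "\<And>\<pi> Y. \<pi> permutes {..<n} \<Longrightarrow> Y \<in> space config_space \<Longrightarrow> f (\<lambda>i\<in>{..<n}. Y (\<pi> i)) 0 = f Y (\<pi> 0)"
  shows "expectation (\<lambda>\<omega>. f (sample \<omega>) i) = expectation (\<lambda>\<omega>. f (sample \<omega>) 0)"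
proof -
  have \<pi>: "Transposition.transpose 0 i permutes {..<n}" using i by (intro permutes_swap_id) auto
  have "expectation (\<lambda>\<omega>. f (sample \<omega>) i) = expectation (\<lambda>\<omega>. f (\<lambda>j\<in>{..<n}. sample \<omega> (Transposition.transpose 0 i j)) 0)"
    using sym[OF \<pi> measurable_space[OF sample_measurable]] by (intro Bochner_Integration.integral_cong refl) simp
  also have "\<dots> = expectation (\<lambda>\<omega>. f (sample \<omega>) 0)" by (rule expectation_permute[OF f \<pi>])
  finally show ?thesis .
qed

text \<open>\<open>\<delta>\<close> is the concentration error of one ridge leverage. Observation
  \<open>0\<close> suffices in the hypothesis, because exchangeability spreads the bound to every
  \<open>i\<close> before averaging.\<close>

lemma expectation_abs_proj_lev:
  fixes \<eta> \<delta> :: real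
  assumes n: "0 < n" "k \<le> n" and \<eta>: "0 < \<eta>" and \<delta>: "0 \<le> \<delta>"
    and ridge: "(\<integral>\<^sup>+\<omega>. ennreal \<bar>ridge_lev (\<eta> * real n) (sample \<omega>) 0 - 1 + 1 / (1 + ridge_trace (\<eta> * real n) (sample \<omega>))\<bar> \<partial>M) \<le> ennreal \<delta>"
  shows "integrable M (\<lambda>\<omega>. \<bar>proj_lev (sample \<omega>) 0 - real k / real n\<bar>)"
    and "expectation (\<lambda>\<omega>. \<bar>proj_lev (sample \<omega>) 0 - real k / real n\<bar>) \<le> 2 * sqrt \<eta> + 4 * \<delta>"
proof -
  define \<gamma> where "\<gamma> = \<eta> * real n"
  have \<gamma>: "0 < \<gamma>" using n \<eta> by (simp add: \<gamma>_def)
  define c where "c = real k / real n"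
  have c: "0 \<le> c" "c \<le> 1" using n by (auto simp: c_def)
  define t where "t Y = ridge_trace \<gamma> Y" for Y
  \<comment> \<open>Three errors: \<open>g\<close> belongs to a single leverage, \<open>e\<close> to
    the averaged equation, \<open>u\<close> to the regularisation.\<close>
  define g where "g Y i = \<bar>ridge_lev \<gamma> Y i - 1 + 1 / (1 + t Y)\<bar>" for Y i
  define e where "e Y = \<bar>1 - c + \<eta> * t Y - 1 / (1 + t Y)\<bar>" for Y
  define u where "u Y i = proj_lev Y i - ridge_lev \<gamma> Y i" for Y i
  have t0: "0 \<le> t Y" for Y unfolding t_def by (rule ridge_trace_nonneg[OF \<gamma>])
  have tk: "t Y \<le> real k / \<gamma>" for Y using ridge_trace_le[OF \<gamma>, of Y] \<gamma> by (simp add: t_def field_simps)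
  have inv: "0 \<le> 1 / (1 + t Y)" "1 / (1 + t Y) \<le> 1" for Y using t0[of Y] by auto
  have lev: "0 \<le> ridge_lev \<gamma> Y i" for Y i by (rule ridge_lev_nonneg[OF \<gamma>])
  have pl: "ridge_lev \<gamma> Y i \<le> proj_lev Y i" "proj_lev Y i \<le> real k" if "Y \<in> space config_space" "i < n" for Y i
  proof -
    have le: "ridge_lev \<gamma> Y i \<le> proj_lev Y i" if "i < n" for i using ridge_lev_le[OF \<open>Y \<in> _\<close> that \<gamma>] .
    show "ridge_lev \<gamma> Y i \<le> proj_lev Y i" by (rule le[OF \<open>i < n\<close>])
    have "proj_lev Y i \<le> (\<Sum>i<n. proj_lev Y i)"
    proof (rule member_le_sum)
      show "0 \<le> proj_lev Y j" if "j \<in> {..<n} - {i}" for j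
        using order_trans[OF lev le[of j]] that by simp
    qed (use that in simp_all)
    then show "proj_lev Y i \<le> real k" using sum_proj_lev_le[OF \<open>Y \<in> _\<close>] by simp
  qed
  have mt: "t \<in> borel_measurable config_space" unfolding t_def[abs_def] by (rule ridge_trace_measurable[OF n(1)])
  have ml: "(\<lambda>Y. ridge_lev \<gamma> Y i) \<in> borel_measurable config_space" if "i < n" for i by (rule ridge_lev_measurable[OF that])
  have mp: "(\<lambda>Y. proj_lev Y i) \<in> borel_measurable config_space" if "i < n" for i by (rule proj_lev_measurable[OF that])
  have mg: "(\<lambda>Y. g Y i) \<in> borel_measurable config_space" if "i < n" for i
    unfolding g_def using ml[OF that] mt by measurable
  have me: "e \<in> borel_measurable config_space" unfolding e_def[abs_def] using mt by measurable
  have mu: "(\<lambda>Y. u Y i) \<in> borel_measurable config_space" if "i < n" for i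
    unfolding u_def using ml[OF that] mp[OF that] by measurable
  \<comment> \<open>Integrability comes from bounds uniform in \<open>Y\<close>: both kinds of
    leverage lie between 0 and \<open>k\<close>, and \<open>t \<le> k / \<gamma>\<close>.\<close>
  have bounded: "integrable M (\<lambda>\<omega>. f (sample \<omega>))"
    if "f \<in> borel_measurable config_space" "\<And>Y. Y \<in> space config_space \<Longrightarrow> \<bar>f Y\<bar> \<le> C" for f :: "(nat \<Rightarrow> real vec) \<Rightarrow> real" and C
    using measurable_compose[OF sample_measurable that(1)] that(2)[OF measurable_space[OF sample_measurable]]
    by (intro integrable_const_bound[where B = C]) auto
  have ig: "integrable M (\<lambda>\<omega>. g (sample \<omega>) i)" if "i < n" for i
  proof (rule bounded[OF mg[OF that], of "real k + 1"])
    fix Y assume "Y \<in> space config_space"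
    then show "\<bar>g Y i\<bar> \<le> real k + 1"
      using pl[OF _ that, of Y] lev[of Y i] inv[of Y] unfolding g_def by linarith
  qed
  have it: "integrable M (\<lambda>\<omega>. t (sample \<omega>))"
    by (rule bounded[OF mt, of "real k / \<gamma>"]) (use t0 tk in auto)
  have ie: "integrable M (\<lambda>\<omega>. e (sample \<omega>))"
  proof (rule bounded[OF me, of "2 + \<eta> * (real k / \<gamma>)"])
    fix Y
    have "0 \<le> \<eta> * t Y" "\<eta> * t Y \<le> \<eta> * (real k / \<gamma>)"
      using t0 \<eta> mult_left_mono[OF tk[of Y], of \<eta>] by auto
    then show "\<bar>e Y\<bar> \<le> 2 + \<eta> * (real k / \<gamma>)" using inv[of Y] c unfolding e_def by linarith
  qed
  have iu: "integrable M (\<lambda>\<omega>. u (sample \<omega>) i)" if "i < n" for i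
  proof (rule bounded[OF mu[OF that], of "real k"])
    fix Y assume "Y \<in> space config_space"
    then show "\<bar>u Y i\<bar> \<le> real k" using pl[OF _ that, of Y] lev[of Y i] unfolding u_def by linarith
  qed
  have ip: "integrable M (\<lambda>\<omega>. proj_lev (sample \<omega>) 0)"
  proof (rule bounded[OF mp[OF n(1)], of "real k"])
    fix Y assume "Y \<in> space config_space"
    then show "\<bar>proj_lev Y 0\<bar> \<le> real k" using pl[OF _ n(1), of Y] lev[of Y 0] by linarith
  qed
  then show "integrable M (\<lambda>\<omega>. \<bar>proj_lev (sample \<omega>) 0 - real k / real n\<bar>)" by simp
  have Eg0: "expectation (\<lambda>\<omega>. g (sample \<omega>) 0) \<le> \<delta>"
  proof -
    have "ennreal (expectation (\<lambda>\<omega>. g (sample \<omega>) 0)) = (\<integral>\<^sup>+\<omega>. ennreal (g (sample \<omega>) 0) \<partial>M)"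
      by (rule nn_integral_eq_integral[symmetric, OF ig[OF n(1)]]) (simp add: g_def)
    also have "\<dots> \<le> ennreal \<delta>" using ridge by (simp add: g_def t_def \<gamma>_def)
    finally show ?thesis using \<delta> by simp
  qed
  have Eg: "expectation (\<lambda>\<omega>. g (sample \<omega>) i) \<le> \<delta>" if "i < n" for i
    using Eg0 expectation_exchange[of g i, OF mg[OF n(1)] that] n(1)
    by (simp add: g_def t_def ridge_lev_permute ridge_trace_permute)
  have Eu: "expectation (\<lambda>\<omega>. u (sample \<omega>) i) = expectation (\<lambda>\<omega>. u (sample \<omega>) 0)" if "i < n" for i
    using n(1) expectation_exchange[of u i, OF mu[OF n(1)] that]
    by (simp add: u_def ridge_lev_permute proj_lev_permute)
  \<comment> \<open>The sum of \<open>l i - 1 + 1 / (1 + t)\<close> over \<open>i\<close> is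
    \<open>- n\<close> times the expression inside \<open>e\<close>, as
    \<open>\<gamma> = \<eta> n\<close>.\<close>
  have e_le: "real n * e Y \<le> (\<Sum>i<n. g Y i)" for Y
  proof -
    have "(\<Sum>i<n. ridge_lev \<gamma> Y i - 1 + 1 / (1 + t Y)) = real k - \<gamma> * t Y - real n + real n * (1 / (1 + t Y))"
      using sum_ridge_lev[OF \<gamma>, of Y] by (simp add: sum.distrib sum_subtractf t_def)
    also have "\<dots> = - (real n * (1 - c + \<eta> * t Y - 1 / (1 + t Y)))"
      using n(1) by (simp add: \<gamma>_def c_def algebra_simps)
    finally have "real n * e Y = \<bar>\<Sum>i<n. ridge_lev \<gamma> Y i - 1 + 1 / (1 + t Y)\<bar>"
      by (simp add: e_def abs_mult)
    also have "\<dots> \<le> (\<Sum>i<n. g Y i)" unfolding g_def by (rule sum_abs)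
    finally show ?thesis .
  qed
  have "real n * expectation (\<lambda>\<omega>. e (sample \<omega>)) = expectation (\<lambda>\<omega>. real n * e (sample \<omega>))" by simp
  also have "\<dots> \<le> expectation (\<lambda>\<omega>. \<Sum>i<n. g (sample \<omega>) i)"
    using ie ig e_le by (intro integral_mono) auto
  also have "\<dots> = (\<Sum>i<n. expectation (\<lambda>\<omega>. g (sample \<omega>) i))" using ig by (intro Bochner_Integration.integral_sum) auto
  also have "\<dots> \<le> (\<Sum>i<n. \<delta>)" using Eg by (intro sum_mono) auto
  finally have Ee: "expectation (\<lambda>\<omega>. e (sample \<omega>)) \<le> \<delta>" using n(1) by simp
  \<comment> \<open>either \<open>\<eta> t \<le> \<surd>\<eta>\<close>, or \<open>1 / (1 + t) \<le> \<surd>\<eta>\<close>\<close>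
  have t_le: "\<eta> * t Y \<le> sqrt \<eta> + e Y" for Y
  proof (cases "\<eta> * t Y \<le> sqrt \<eta>")
    case False
    have s: "sqrt \<eta> * sqrt \<eta> = \<eta>" "0 < sqrt \<eta>" using \<eta> by auto
    then have "sqrt \<eta> * 1 < sqrt \<eta> * (sqrt \<eta> * t Y)" using False by (simp add: mult.assoc[symmetric])
    then have "1 < sqrt \<eta> * t Y" using s(2) by (simp only: mult_less_cancel_left_pos)
    then have "1 \<le> sqrt \<eta> * (1 + t Y)" using less_imp_le[OF s(2)] unfolding distrib_left by linarith
    then have "1 / (1 + t Y) \<le> sqrt \<eta>" using t0[of Y] by (simp add: divide_le_eq)
    \<comment> \<open>Here \<open>c \<le> 1\<close>, that is \<open>k \<le> n\<close>, enters: the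
      term \<open>1 - c\<close> may be dropped.\<close>
    moreover have "\<eta> * t Y - 1 / (1 + t Y) \<le> e Y" using c(2) unfolding e_def by linarith
    ultimately show ?thesis by linarith
  qed (simp add: e_def)
  have Et: "expectation (\<lambda>\<omega>. \<eta> * t (sample \<omega>)) \<le> sqrt \<eta> + \<delta>"
  proof -
    have "expectation (\<lambda>\<omega>. \<eta> * t (sample \<omega>)) \<le> expectation (\<lambda>\<omega>. sqrt \<eta> + e (sample \<omega>))"
      using it ie t_le by (intro integral_mono) auto
    also have "\<dots> = sqrt \<eta> + expectation (\<lambda>\<omega>. e (sample \<omega>))" using ie by (simp add: prob_space)
    finally show ?thesis using Ee by simp
  qed
  have "real n * expectation (\<lambda>\<omega>. u (sample \<omega>) 0) = (\<Sum>i<n. expectation (\<lambda>\<omega>. u (sample \<omega>) i))"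
  proof -
    have "(\<Sum>i<n. expectation (\<lambda>\<omega>. u (sample \<omega>) i)) = (\<Sum>i<n. expectation (\<lambda>\<omega>. u (sample \<omega>) 0))"
      by (rule sum.cong[OF refl]) (rule Eu, simp)
    then show ?thesis by simp
  qed
  also have "\<dots> = expectation (\<lambda>\<omega>. \<Sum>i<n. u (sample \<omega>) i)"
    using iu by (intro Bochner_Integration.integral_sum[symmetric]) auto
  also have "\<dots> \<le> expectation (\<lambda>\<omega>. real n * (\<eta> * t (sample \<omega>)))"
  proof (rule integral_mono)
    fix \<omega> assume "\<omega> \<in> space M"
    then have "sample \<omega> \<in> space config_space" by (rule measurable_space[OF sample_measurable])
    from sum_proj_lev_le[OF this] show "(\<Sum>i<n. u (sample \<omega>) i) \<le> real n * (\<eta> * t (sample \<omega>))"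
      using sum_ridge_lev[OF \<gamma>, of "sample \<omega>"] by (simp add: u_def sum_subtractf t_def \<gamma>_def algebra_simps)
  qed (use iu it in auto)
  also have "\<dots> = real n * expectation (\<lambda>\<omega>. \<eta> * t (sample \<omega>))" by simp
  finally have Eu0: "expectation (\<lambda>\<omega>. u (sample \<omega>) 0) \<le> sqrt \<eta> + \<delta>"
    using n(1) Et by simp
  \<comment> \<open>Telescoping: \<open>h - c = u + (l - 1 + 1/(1+t)) + (1 - c + \<eta> t - 1/(1+t))
    - \<eta> t\<close>. The expected sizes are at most \<open>\<surd>\<eta> + \<delta>\<close>,
    \<open>\<delta>\<close>, \<open>\<delta>\<close> and \<open>\<surd>\<eta> + \<delta>\<close>,
    whence the constants 2 and 4.\<close>
  have "expectation (\<lambda>\<omega>. \<bar>proj_lev (sample \<omega>) 0 - c\<bar>) \<le>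
      expectation (\<lambda>\<omega>. u (sample \<omega>) 0 + g (sample \<omega>) 0 + e (sample \<omega>) + \<eta> * t (sample \<omega>))"
  proof (rule integral_mono)
    fix \<omega> assume "\<omega> \<in> space M"
    then have "sample \<omega> \<in> space config_space" by (rule measurable_space[OF sample_measurable])
    from pl(1)[OF this n(1)] have "0 \<le> u (sample \<omega>) 0" by (simp add: u_def)
    moreover have "0 \<le> \<eta> * t (sample \<omega>)" using \<eta> t0 by simp
    ultimately show "\<bar>proj_lev (sample \<omega>) 0 - c\<bar> \<le> u (sample \<omega>) 0 + g (sample \<omega>) 0 + e (sample \<omega>) + \<eta> * t (sample \<omega>)"
      unfolding u_def g_def e_def by linarith
  qed (use ip iu[OF n(1)] ig[OF n(1)] ie it in auto)
  also have "\<dots> = expectation (\<lambda>\<omega>. u (sample \<omega>) 0) + expectation (\<lambda>\<omega>. g (sample \<omega>) 0)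
      + expectation (\<lambda>\<omega>. e (sample \<omega>)) + expectation (\<lambda>\<omega>. \<eta> * t (sample \<omega>))"
    using iu[OF n(1)] ig[OF n(1)] ie it by simp
  finally show "expectation (\<lambda>\<omega>. \<bar>proj_lev (sample \<omega>) 0 - real k / real n\<bar>) \<le> 2 * sqrt \<eta> + 4 * \<delta>"
    using Eu0 Eg0 Ee Et unfolding c_def by linarith
qed

end

section \<open>Concentration of one ridge leverage given the other observations\<close>

context regression_sample
begin

text \<open>\<open>L\<close> dominates the trace bound \<open>1 / \<eta>\<close> and, after division
  by \<open>n\<close>, the bound \<open>1 / (\<eta>\<^sup>2 n)\<close> for the trace of the square.
  The three summands stem from the linear part, the quadratic part and the effect of one observation
  on the trace.\<close>

lemma ridge_lev_concentration:
  fixes \<eta> L v :: real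
  assumes n: "0 < n" "k \<le> n" and \<eta>: "0 < \<eta>" and L: "1 / \<eta> \<le> L" "1 / \<eta>\<^sup>2 \<le> L"
    and z: "random_variable (vec_borel m) z"
    and second: "has_mean_mat M (\<lambda>\<omega>. outer_prod (z \<omega>) (z \<omega>)) (1\<^sub>m m)"
    and x: "\<And>\<omega>. \<omega> \<in> space M \<Longrightarrow> x 0 \<omega> = \<mu> + \<Gamma> *\<^sub>v z \<omega>"
    and var: "\<forall>A\<in>carrier_mat m m. A\<^sup>T = A \<longrightarrow> mat_trace (A * A) \<le> L / real n \<longrightarrow> \<bar>mat_trace A\<bar> \<le> L \<longrightarrow>
      integrable M (\<lambda>\<omega>. (z \<omega> \<bullet> (A *\<^sub>v z \<omega>))\<^sup>2) \<and> variance (\<lambda>\<omega>. z \<omega> \<bullet> (A *\<^sub>v z \<omega>)) \<le> v"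
  shows "(\<integral>\<^sup>+\<omega>. ennreal \<bar>ridge_lev (\<eta> * real n) (sample \<omega>) 0 - 1 + 1 / (1 + ridge_trace (\<eta> * real n) (sample \<omega>))\<bar> \<partial>M)
    \<le> ennreal (2 * sqrt (L / real n) + sqrt v + 1 / (\<eta> * real n))"
  unfolding sample_def
proof (rule iid_nn_integral_le[OF _ _ indep identical, where l = 0 and
      G = "\<lambda>Y. ennreal \<bar>ridge_lev (\<eta> * real n) Y 0 - 1 + 1 / (1 + ridge_trace (\<eta> * real n) Y)\<bar>"])
  define \<gamma> where "\<gamma> = \<eta> * real n"
  have \<gamma>: "0 < \<gamma>" using n \<eta> by (simp add: \<gamma>_def)
  show "(\<lambda>Y. ennreal \<bar>ridge_lev (\<eta> * real n) Y 0 - 1 + 1 / (1 + ridge_trace (\<eta> * real n) Y)\<bar>) \<in> borel_measurable config_space"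
    using ridge_lev_measurable[OF n(1)] ridge_trace_measurable[OF n(1)] by measurable
  \<comment> \<open>The observations other than \<open>0\<close> are frozen from here on:
    \<open>K\<close> is a constant matrix and only \<open>z\<close> is random.\<close>
  fix Y
  define J where "J = {..<n} - {0}"
  have J: "finite J" "0 \<notin> J" "insert 0 J = {..<n}" using n by (auto simp: J_def)
  define K where "K = inverse_mat (gram_mat (\<gamma> \<cdot>\<^sub>m \<Omega>) J (\<lambda>i. regressor R (Y i)))"
  have K: "pos_def_mat k K" unfolding K_def
    by (intro pos_def_mat_inverse(5) pos_def_gram_mat pos_def_smult \<Omega> \<gamma> regressor)
  \<comment> \<open>\<open>k \<le> n\<close> turns \<open>k / \<gamma>\<close> into a bound free of
    \<open>n\<close>.\<close>
  have tK: "mat_trace (K * \<Omega>) \<le> 1 / \<eta>"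
  proof -
    have "\<gamma> * mat_trace (K * \<Omega>) \<le> real k"
      unfolding K_def by (rule trace_ridge_bounds(2)[OF \<Omega> \<gamma> regressor])
    also have "\<dots> \<le> real n" using n by simp
    finally show ?thesis using n(1) \<eta> by (simp add: \<gamma>_def field_simps)
  qed
  have tK2: "mat_trace (K * \<Omega> * K * \<Omega>) \<le> L / real n"
  proof -
    have "\<gamma> * mat_trace (K * \<Omega> * K * \<Omega>) \<le> mat_trace (K * \<Omega>)"
      unfolding K_def by (rule trace_ridge_bounds(3)[OF \<Omega> \<gamma> regressor])
    then have "\<gamma> * mat_trace (K * \<Omega> * K * \<Omega>) \<le> 1 / \<eta>" using tK by linarith
    then have "mat_trace (K * \<Omega> * K * \<Omega>) \<le> (1 / \<eta>\<^sup>2) / real n"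
      using n(1) \<eta> by (simp add: \<gamma>_def field_simps power2_eq_square)
    also have "\<dots> \<le> L / real n" using L(2) by (intro divide_right_mono) auto
    finally show ?thesis .
  qed
  define T where "T = slope_mat\<^sup>T * K * slope_mat"
  note tr = quadratic_form_traces[OF shift_vec slope_mat K, folded \<Omega>_def T_def]
  have "integrable M (\<lambda>\<omega>. (z \<omega> \<bullet> (T *\<^sub>v z \<omega>))\<^sup>2) \<and> variance (\<lambda>\<omega>. z \<omega> \<bullet> (T *\<^sub>v z \<omega>)) \<le> v"
    using var[rule_format, of T] tr tK tK2 L(1) by auto
  note Tvar = conjunct1[OF this] conjunct2[OF this]
  have near: "\<bar>ridge_lev \<gamma> (Y(0 := x 0 \<omega>)) 0 - 1 + 1 / (1 + ridge_trace \<gamma> (Y(0 := x 0 \<omega>)))\<bar> \<le>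
      \<bar>(shift_vec + slope_mat *\<^sub>v z \<omega>) \<bullet> (K *\<^sub>v (shift_vec + slope_mat *\<^sub>v z \<omega>)) - mat_trace (K * \<Omega>)\<bar> + 1 / \<gamma>"
    if \<omega>: "\<omega> \<in> space M" for \<omega>
  proof -
    let ?w = "\<lambda>i. regressor R ((Y(0 := x 0 \<omega>)) i)"
    \<comment> \<open>As \<open>0 \<notin> J\<close>, inserting the random observation
      \<open>0\<close> leaves \<open>K\<close> unchanged.\<close>
    have "gram_mat (\<gamma> \<cdot>\<^sub>m \<Omega>) J ?w = gram_mat (\<gamma> \<cdot>\<^sub>m \<Omega>) J (\<lambda>i. regressor R (Y i))"
      using J(2) by (intro gram_mat_cong) auto
    then have KJ: "inverse_mat (gram_mat (\<gamma> \<cdot>\<^sub>m \<Omega>) J ?w) = K" by (simp add: K_def)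
    have w0: "?w 0 = shift_vec + slope_mat *\<^sub>v z \<omega>"
      using regressor_affine[OF R \<Gamma> \<mu>] measurable_space[OF z \<omega>] x[OF \<omega>]
      by (simp add: shift_vec_def slope_mat_def)
    show ?thesis
      using leverage_near_trace[OF shift_vec slope_mat, folded \<Omega>_def, OF \<Omega> \<gamma> regressor J(1,2), of "Y(0 := x 0 \<omega>)"]
      unfolding J(3) KJ w0 ridge_lev_def ridge_trace_def .
  qed
  have "(\<integral>\<^sup>+\<omega>. ennreal \<bar>ridge_lev \<gamma> (Y(0 := x 0 \<omega>)) 0 - 1 + 1 / (1 + ridge_trace \<gamma> (Y(0 := x 0 \<omega>)))\<bar> \<partial>M) \<le>
      (\<integral>\<^sup>+\<omega>. ennreal (\<bar>(shift_vec + slope_mat *\<^sub>v z \<omega>) \<bullet> (K *\<^sub>v (shift_vec + slope_mat *\<^sub>v z \<omega>))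
        - mat_trace (K * \<Omega>)\<bar> + 1 / \<gamma>) \<partial>M)"
    by (intro nn_integral_mono ennreal_leI near)
  also have "\<dots> \<le> ennreal (2 * sqrt (L / real n) + sqrt v + 1 / \<gamma>)"
    using quadratic_form_concentration[OF second z shift_vec slope_mat K, folded \<Omega>_def T_def, OF tK2 Tvar] \<gamma> by simp
  finally show "(\<integral>\<^sup>+\<omega>. ennreal \<bar>ridge_lev (\<eta> * real n) (Y(0 := x 0 \<omega>)) 0 - 1
      + 1 / (1 + ridge_trace (\<eta> * real n) (Y(0 := x 0 \<omega>)))\<bar> \<partial>M)
    \<le> ennreal (2 * sqrt (L / real n) + sqrt v + 1 / (\<eta> * real n))"
    unfolding \<gamma>_def .
qed (use n in auto)

end

text \<open>The model is assumed from \<open>n0\<close> on because \<open>full_rank\<close> forces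
  \<open>n \<ge> p n + 2\<close>, which cannot hold for small \<open>n\<close>.\<close>

theorem lemma6p3:
  fixes M :: "nat \<Rightarrow> 'w measure"
    and n0 :: nat
    and p m k :: "nat \<Rightarrow> nat"
    and x z :: "nat \<Rightarrow> nat \<Rightarrow> 'w \<Rightarrow> real vec"
    and \<mu> :: "nat \<Rightarrow> real vec"
    and \<Sigma> \<Gamma> R :: "nat \<Rightarrow> real mat"
    and h :: "nat \<Rightarrow> nat \<Rightarrow> 'w \<Rightarrow> real"
  assumes prob: "\<And>n. n \<ge> n0 \<Longrightarrow> prob_space (M n)"
    and pos: "\<And>n. n \<ge> n0 \<Longrightarrow> p n > 0 \<and> m n > 0 \<and> k n > 0"
    and x_iid: "\<And>n. n \<ge> n0 \<Longrightarrow> iid_vecs (M n) (p n) n (x n)"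
    and mu_dim: "\<And>n. n \<ge> n0 \<Longrightarrow> \<mu> n \<in> carrier_vec (p n)"
    and Sigma_pd: "\<And>n. n \<ge> n0 \<Longrightarrow> pos_def_mat (p n) (\<Sigma> n)"
    and x_moments: "\<And>n i. n \<ge> n0 \<Longrightarrow> i < n \<Longrightarrow> has_mean_cov (M n) (x n i) (\<mu> n) (\<Sigma> n)"
    and Gamma_dim: "\<And>n. n \<ge> n0 \<Longrightarrow> \<Gamma> n \<in> carrier_mat (p n) (m n)"
    and m_ge_p: "\<And>n. n \<ge> n0 \<Longrightarrow> m n \<ge> p n"
    and Gamma_Sigma: "\<And>n. n \<ge> n0 \<Longrightarrow> \<Gamma> n * (\<Gamma> n)\<^sup>T = \<Sigma> n"
    and z_iid: "\<And>n. n \<ge> n0 \<Longrightarrow> iid_vecs (M n) (m n) n (z n)"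
    and z_mean: "\<And>n. n \<ge> n0 \<Longrightarrow> has_mean_vec (M n) (z n 0) (0\<^sub>v (m n))"
    and z_second: "\<And>n. n \<ge> n0 \<Longrightarrow>
          has_mean_mat (M n) (\<lambda>\<omega>. outer_prod (z n 0 \<omega>) (z n 0 \<omega>)) (1\<^sub>m (m n))"
    and x_rep: "\<And>n i \<omega>. n \<ge> n0 \<Longrightarrow> i < n \<Longrightarrow> \<omega> \<in> space (M n) \<Longrightarrow>
          x n i \<omega> = \<mu> n + \<Gamma> n *\<^sub>v z n i \<omega>"
    and full_rank: "\<And>n. n \<ge> n0 \<Longrightarrow> AE \<omega> in M n.
          vec_space.rank (n - 1) (drop_first_mat n * aug_data_mat n (p n) (\<lambda>i. x n i \<omega>)) = p n + 1"
    and var_cond: "\<And>A :: nat \<Rightarrow> real mat.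
          (\<And>n. A n \<in> carrier_mat (m n) (m n) \<and> (A n)\<^sup>T = A n) \<Longrightarrow>
          \<exists>a b. a \<in> O(\<lambda>n. mat_trace (A n * A n)) \<and> b \<in> o(\<lambda>_. 1) \<and>
            (\<forall>\<^sub>F n in sequentially.
               integrable (M n) (\<lambda>\<omega>. (z n 0 \<omega> \<bullet> (A n *\<^sub>v z n 0 \<omega>))\<^sup>2) \<and>
               prob_space.variance (M n) (\<lambda>\<omega>. z n 0 \<omega> \<bullet> (A n *\<^sub>v z n 0 \<omega>)) =
                 a n + (mat_trace (A n))\<^sup>2 * b n)"
    and R_dim: "\<And>n. n \<ge> n0 \<Longrightarrow> R n \<in> carrier_mat (p n + 1) (k n)"
    and R_rank: "\<And>n. n \<ge> n0 \<Longrightarrow> vec_space.rank (p n + 1) (R n) = k n"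
    and k_le: "\<And>n. n \<ge> n0 \<Longrightarrow> k n \<le> p n + 1"
    and h_eq: "\<And>n j \<omega>. h n j \<omega> =
          proj_mat (aug_data_mat n (p n) (\<lambda>i. x n i \<omega>) * R n) $$ (j, j)"
  shows "(\<forall>n\<ge>n0. exchangeable (M n) n (h n)) \<and>
         tendsto_0_in_prob M (\<lambda>n \<omega>. \<bar>h n 0 \<omega> - real (k n) / real n\<bar>)"
proof (intro conjI allI impI)
  have sample: "regression_sample n (p n) (m n) (k n) (R n) (\<Gamma> n) (\<mu> n) (M n) (x n)" if n: "n \<ge> n0" for n
  proof -
    interpret prob_space "M n" by (rule prob[OF n])
    show ?thesis
      using R_dim[OF n] R_rank[OF n] Gamma_dim[OF n] Sigma_pd[OF n] Gamma_Sigma[OF n] mu_dim[OF n] x_iid[OF n]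
      by unfold_locales simp_all
  qed
  have h: "h n j = (\<lambda>\<omega>. regression_design.proj_lev n (p n) (R n) (regression_sample.sample n (x n) \<omega>) j)"
    if n: "n \<ge> n0" for n j
  proof -
    interpret regression_sample n "p n" "m n" "k n" "R n" "\<Gamma> n" "\<mu> n" "M n" "x n" by (rule sample[OF n])
    show ?thesis by (simp add: fun_eq_iff h_eq proj_lev_def sample_def aug_data_mat_restrict)
  qed
  show "exchangeable (M n) n (h n)" if n: "n \<ge> n0" for n
    using regression_sample.exchangeable_proj_lev[OF sample[OF n]] by (simp add: h[OF n, abs_def])
  \<comment> \<open>The rank is at most the number \<open>n - 1\<close> of rows. A single outcome of
    full rank suffices, and one exists since a probability space is not null.\<close>
  have k_le_n: "k n \<le> n" and n_pos: "0 < n" if n: "n \<ge> n0" for n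
  proof -
    interpret prob_space "M n" by (rule prob[OF n])
    let ?U = "\<lambda>\<omega>. drop_first_mat n * aug_data_mat n (p n) (\<lambda>i. x n i \<omega>)"
    obtain \<omega> where "vec_space.rank (n - 1) (?U \<omega>) = p n + 1"
      using eventually_happens[OF full_rank[OF n]] by (auto simp: ae_filter_eq_bot_iff emeasure_space_1)
    moreover have "?U \<omega> \<in> carrier_mat (n - 1) (Suc (p n))"
      by (rule mult_carrier_mat[OF _ aug_data_mat_carrier]) (simp add: drop_first_mat_def)
    ultimately have "p n + 1 \<le> n - 1" using vec_space.rank_le_dim by metis
    then show "k n \<le> n" "0 < n" using k_le[OF n] by simp_all
  qed
  show "tendsto_0_in_prob M (\<lambda>n \<omega>. \<bar>h n 0 \<omega> - real (k n) / real n\<bar>)"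
    unfolding tendsto_0_in_prob_def
  proof (intro allI impI)
    fix \<epsilon> :: real assume \<epsilon>: "0 < \<epsilon>"
    show "(\<lambda>n. measure (M n) {\<omega> \<in> space (M n). \<epsilon> < \<bar>\<bar>h n 0 \<omega> - real (k n) / real n\<bar>\<bar>}) \<longlonglongrightarrow> 0"
    proof (rule order_tendstoI)
      fix r :: real assume r: "0 < r"
      \<comment> \<open>Markov's inequality at level \<open>\<epsilon>\<close> asks for an
        expectation below \<open>s\<close>. Here \<open>2 \<surd>\<eta> = s/4\<close>, and
        \<open>\<delta> n < s/16\<close> adds less than \<open>s/4\<close>; the part
        \<open>\<surd>v = s/32\<close> of \<open>\<delta> n\<close> does not vanish in the limit,
        but stays below \<open>s/16\<close>.\<close>
      define s where "s = \<epsilon> * r"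
      have s: "0 < s" using \<epsilon> r by (simp add: s_def)
      define \<eta> where "\<eta> = (s / 8)\<^sup>2"
      have \<eta>: "0 < \<eta>" "sqrt \<eta> = s / 8" using s by (simp_all add: \<eta>_def)
      define L where "L = max (1 / \<eta>) (1 / \<eta>\<^sup>2)"
      have L: "1 / \<eta> \<le> L" "1 / \<eta>\<^sup>2 \<le> L" "0 \<le> L" using \<eta> by (auto simp: L_def le_max_iff_disj)
      define v where "v = (s / 32)\<^sup>2"
      have v: "0 < v" "sqrt v = s / 32" using s by (simp_all add: v_def)
      define \<delta> where "\<delta> n = 2 * sqrt (L / real n) + sqrt v + 1 / (\<eta> * real n)" for n
      have "\<delta> \<longlonglongrightarrow> 2 * sqrt 0 + sqrt v + 0"
        unfolding \<delta>_def[abs_def]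
        using lim_const_over_n[of "1 / \<eta>"]
        by (intro tendsto_add tendsto_mult tendsto_real_sqrt tendsto_const lim_const_over_n) simp
      then have "\<forall>\<^sub>F n in sequentially. \<delta> n < s / 16"
        by (rule order_tendstoD) (use s v in simp)
      moreover have "\<forall>\<^sub>F n in sequentially. \<forall>A\<in>carrier_mat (m n) (m n). A\<^sup>T = A \<longrightarrow>
          mat_trace (A * A) \<le> L / real n \<longrightarrow> \<bar>mat_trace A\<bar> \<le> L \<longrightarrow>
          integrable (M n) (\<lambda>\<omega>. (z n 0 \<omega> \<bullet> (A *\<^sub>v z n 0 \<omega>))\<^sup>2) \<and>
          prob_space.variance (M n) (\<lambda>\<omega>. z n 0 \<omega> \<bullet> (A *\<^sub>v z n 0 \<omega>)) \<le> v"
        by (rule uniform_variance_bound[where z = "\<lambda>n. z n 0", OF var_cond L(3) v(1)])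
      moreover note eventually_ge_at_top[of n0]
      ultimately
      show "\<forall>\<^sub>F n in sequentially. measure (M n) {\<omega> \<in> space (M n). \<epsilon> < \<bar>\<bar>h n 0 \<omega> - real (k n) / real n\<bar>\<bar>} < r"
      proof eventually_elim
        case (elim n)
        note n = \<open>n0 \<le> n\<close>
        interpret regression_sample n "p n" "m n" "k n" "R n" "\<Gamma> n" "\<mu> n" "M n" "x n" by (rule sample[OF n])
        have n1: "0 < n" "k n \<le> n" using n_pos[OF n] k_le_n[OF n] by auto
        have z: "random_variable (vec_borel (m n)) (z n 0)"
          using z_iid[OF n] n1 by (auto simp: iid_vecs_def indep_vars_def)
        have conc: "(\<integral>\<^sup>+\<omega>. ennreal \<bar>ridge_lev (\<eta> * real n) (sample \<omega>) 0 - 1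
            + 1 / (1 + ridge_trace (\<eta> * real n) (sample \<omega>))\<bar> \<partial>M n) \<le> ennreal (\<delta> n)"
          unfolding \<delta>_def
          by (rule ridge_lev_concentration[OF n1 \<eta>(1) L(1,2) z z_second[OF n] x_rep[OF n n1(1)] elim(2)])
        have \<delta>: "0 \<le> \<delta> n" using L(3) v \<eta> s by (simp add: \<delta>_def)
        let ?d = "\<lambda>\<omega>. \<bar>proj_lev (sample \<omega>) 0 - real (k n) / real n\<bar>"
        note E = expectation_abs_proj_lev[OF n1 \<eta>(1) \<delta> conc]
        have "measure (M n) {\<omega> \<in> space (M n). \<epsilon> < \<bar>\<bar>h n 0 \<omega> - real (k n) / real n\<bar>\<bar>} \<le>
            measure (M n) {\<omega> \<in> space (M n). \<epsilon> \<le> ?d \<omega>}"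
          unfolding h[OF n] using E(1) by (intro finite_measure_mono) auto
        also have "\<dots> \<le> expectation ?d / \<epsilon>"
          using integral_Markov_inequality_measure[OF E(1), of "{}" \<epsilon>] \<epsilon> by simp
        also have "\<dots> \<le> (2 * sqrt \<eta> + 4 * \<delta> n) / \<epsilon>"
          using E(2) \<epsilon> by (intro divide_right_mono) auto
        also have "\<dots> < r"
        proof -
          have "2 * sqrt \<eta> + 4 * \<delta> n < s" using elim(1) \<eta>(2) s by linarith
          then show ?thesis using \<epsilon> by (simp add: s_def divide_less_eq mult.commute)
        qed
        finally show ?case .
      qed
    qed (simp add: less_le_trans[OF _ measure_nonneg])
  qed
qed

end
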